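(* Let $\mathscr{H}$ be a complex Hilbert space, let $\mathcal{P}$ be the set of all invertible positive bounded linear operators on $\mathscr{H}$, let $m\ge 1$, let $A_j,B_j\in\mathcal{P}$ for $1\le j\le m$, and let $\sigma$ be an operator mean with dual $\sigma^{\bot}$. Then $$\sum_{j=1}^{m}(A_j\sharp B_j)\le\Big(\sum_{j=1}^{m}(A_j\sigma B_j)\Big)\sharp\Big(\sum_{j=1}^{m}(A_j\sigma^{\bot}B_j)\Big)\le\Big(\sum_{j=1}^{m}A_j\Big)\sharp\Big(\sum_{j=1}^{m}B_j\Big).$$ Furthermore, if $(\sigma_t)_{t\in[0,1]}$ is an interpolational path for $\sigma$ (so that, in particular, $\sigma$ is symmetric) such that $\sigma_t^{\bot}=\sigma_{1-t}$ for all $t\in[0,1]$, then $$\Big(\sum_{j=1}^{m}(A_j\sigma_s B_j)\Big)\sharp\Big(\sum_{j=1}^{m}(A_j\sigma_{1-s}B_j)\Big)\le\Big(\sum_{j=1}^{m}(A_j\sigma_t B_j)\Big)\sharp\Big(\sum_{j=1}^{m}(A_j\sigma_{1-t}B_j)\Big)$$ for all $t\in[0,1]$ and all $s$ between $t$ and $1-t$ (that is, $\min\{t,1-t\}\le s\le\max\{t,1-t\}$).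
   Context: $\mathbb{B}(\mathscr{H})$ is the algebra of bounded linear operators on $\mathscr{H}$, $I$ its identity, $\mathbb{B}(\mathscr{H})_+$ the cone of positive (i.e. positive semidefinite) operators, and $\le$ is the Loewner order ($X\le Y$ iff $Y-X\in\mathbb{B}(\mathscr{H})_+$). Operator mean (Kubo--Ando): a binary operation $\sigma:\mathbb{B}(\mathscr{H})_+\times\mathbb{B}(\mathscr{H})_+\to\mathbb{B}(\mathscr{H})_+$ such that (i) $I\sigma I=I$; (ii) $C^*(A\sigma B)C\le(C^*AC)\sigma(C^*BC)$; (iii) $A_n\downarrow A$ and $B_n\downarrow B$ imply $(A_n\sigma B_n)\downarrow A\sigma B$, where $A_n\downarrow A$ means $A_1\ge A_2\ge\cdots$ and $A_n\to A$ in the strong operator topology; (iv) $A\le B$ and $C\le D$ imply $A\sigma C\le B\sigma D$. Representing function: operator means correspond bijectively to positive operator monotone functions $f$ on $[0,\infty)$ with $f(1)=1$ via $f(t)I=I\sigma(tI)$, and $A\sigma B=A^{1/2}f(A^{-1/2}BA^{-1/2})A^{1/2}$ for $A,B\in\mathcal{P}$; $f$ is called the representing function of $\sigma$. Dual: $\sigma^{\bot}$ is the operator mean with representing function $t/f(t)$, so $A\sigma^{\bot}B=A^{1/2}(A^{-1/2}BA^{-1/2})f(A^{-1/2}BA^{-1/2})^{-1}A^{1/2}$ for $A,B\in\mathcal{P}$. Geometric mean: $A\sharp B=A^{1/2}(A^{-1/2}BA^{-1/2})^{1/2}A^{1/2}$ for $A,B\in\mathcal{P}$. Interpolational path: for an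 operator mean $\sigma$ that is symmetric ($A\sigma B=B\sigma A$ for all $A,B$), a family of operator means $(\sigma_t)_{t\in[0,1]}$ is an interpolational path for $\sigma$ if, for all $A,B\in\mathcal{P}$: (1) $A\sigma_0B=A$, $A\sigma_{1/2}B=A\sigma B$, $A\sigma_1B=B$; (2) $(A\sigma_pB)\sigma(A\sigma_qB)=A\sigma_{(p+q)/2}B$ for all $p,q\in[0,1]$; (3) the map $t\mapsto A\sigma_tB$ is norm continuous. *)

theory Defs
  imports "HOL-Analysis.Analysis" "HOL-Computational_Algebra.Polynomial"
begin

section \<open>Complex Hilbert spaces\<close>

text \<open>
  A complex Hilbert space is presented together with its underlying real Hilbert space: the real
  inner product of the library is the real part of the complex one.  The complex inner
  product is linear in its first argument.  The zero space is an instance that is not excluded.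
\<close>

class complex_hilbert_space = real_inner + complete_space +
  fixes scaleC :: "complex \<Rightarrow> 'a \<Rightarrow> 'a" (infixr \<open>*\<^sub>C\<close> 75)
    and cinner :: "'a \<Rightarrow> 'a \<Rightarrow> complex"
  assumes scaleC_add_right: "c *\<^sub>C (x + y) = c *\<^sub>C x + c *\<^sub>C y"
    and scaleC_add_left: "(c + d) *\<^sub>C x = c *\<^sub>C x + d *\<^sub>C x"
    and scaleC_scaleC: "c *\<^sub>C (d *\<^sub>C x) = (c * d) *\<^sub>C x"
    and scaleC_of_real: "complex_of_real r *\<^sub>C x = r *\<^sub>R x"
    and cinner_commute: "cinner x y = cnj (cinner y x)"
    and cinner_add_left: "cinner (x + y) z = cinner x z + cinner y z"
    and cinner_scaleC_left: "cinner (c *\<^sub>C x) y = c * cinner x y"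
    and inner_eq_Re_cinner: "inner x y = Re (cinner x y)"

subsection \<open>The sequence space\<close>

typedef ell2 = "{x :: nat \<Rightarrow> complex. summable (\<lambda>n. (cmod (x n))\<^sup>2)}"
  morphisms ell2_coord Abs_ell2
  by (rule exI[of _ "\<lambda>_. 0"]) simp

setup_lifting type_definition_ell2

lemma summable_ell2_coord: "summable (\<lambda>n. (cmod (ell2_coord x n))\<^sup>2)"
  using ell2_coord[of x] by simp

lemma ell2_eqI: "(\<And>n. ell2_coord x n = ell2_coord y n) \<Longrightarrow> x = y"
  by (metis ell2_coord_inject ext)

lemma summable_sq_add:
  fixes x y :: "nat \<Rightarrow> complex"
  assumes "summable (\<lambda>n. (cmod (x n))\<^sup>2)" "summable (\<lambda>n. (cmod (y n))\<^sup>2)"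
  shows "summable (\<lambda>n. (cmod (x n + y n))\<^sup>2)"
proof (rule summable_comparison_test')
  show "summable (\<lambda>n. 2 * (cmod (x n))\<^sup>2 + 2 * (cmod (y n))\<^sup>2)"
    by (intro summable_add summable_mult assms)
  fix n :: nat
  have "(cmod (x n + y n))\<^sup>2 \<le> (cmod (x n) + cmod (y n))\<^sup>2"
    by (intro power_mono norm_triangle_ineq norm_ge_zero)
  also have "\<dots> \<le> 2 * (cmod (x n))\<^sup>2 + 2 * (cmod (y n))\<^sup>2"
    using zero_le_power2[of "cmod (x n) - cmod (y n)"]
    by (simp add: power2_eq_square algebra_simps)
  finally show "norm ((cmod (x n + y n))\<^sup>2) \<le> 2 * (cmod (x n))\<^sup>2 + 2 * (cmod (y n))\<^sup>2"
    by simp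
qed

lemma summable_sq_scale:
  fixes x :: "nat \<Rightarrow> complex"
  assumes "summable (\<lambda>n. (cmod (x n))\<^sup>2)"
  shows "summable (\<lambda>n. (cmod (c * x n))\<^sup>2)"
  using summable_mult[OF assms, of "(cmod c)\<^sup>2"] by (simp add: norm_mult power_mult_distrib)

lemma summable_mult_cnj:
  fixes x y :: "nat \<Rightarrow> complex"
  assumes "summable (\<lambda>n. (cmod (x n))\<^sup>2)" "summable (\<lambda>n. (cmod (y n))\<^sup>2)"
  shows "summable (\<lambda>n. x n * cnj (y n))"
proof (rule summable_comparison_test')
  show "summable (\<lambda>n. (cmod (x n))\<^sup>2 + (cmod (y n))\<^sup>2)"
    by (intro summable_add assms)
  fix n :: nat
  have "2 * (cmod (x n) * cmod (y n)) \<le> (cmod (x n))\<^sup>2 + (cmod (y n))\<^sup>2"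
    using zero_le_power2[of "cmod (x n) - cmod (y n)"]
    by (simp add: power2_eq_square algebra_simps)
  moreover have "0 \<le> cmod (x n) * cmod (y n)" by simp
  ultimately show "norm (x n * cnj (y n)) \<le> (cmod (x n))\<^sup>2 + (cmod (y n))\<^sup>2"
    by (simp only: norm_mult complex_mod_cnj)
qed

instantiation ell2 :: real_vector
begin

lift_definition zero_ell2 :: ell2 is "\<lambda>_. 0" by simp
lift_definition plus_ell2 :: "ell2 \<Rightarrow> ell2 \<Rightarrow> ell2" is "\<lambda>x y n. x n + y n"
  by (rule summable_sq_add)
lift_definition uminus_ell2 :: "ell2 \<Rightarrow> ell2" is "\<lambda>x n. - x n" by simp
lift_definition minus_ell2 :: "ell2 \<Rightarrow> ell2 \<Rightarrow> ell2" is "\<lambda>x y n. x n - y n"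
  subgoal for x y using summable_sq_add[of x "\<lambda>n. - y n"] by simp
  done
lift_definition scaleR_ell2 :: "real \<Rightarrow> ell2 \<Rightarrow> ell2" is "\<lambda>r x n. complex_of_real r * x n"
  by (rule summable_sq_scale)

instance by intro_classes (transfer; simp add: algebra_simps)+

end

lemma ell2_coord_simps [simp]:
  "ell2_coord 0 n = 0"
  "ell2_coord (x + y) n = ell2_coord x n + ell2_coord y n"
  "ell2_coord (x - y) n = ell2_coord x n - ell2_coord y n"
  "ell2_coord (r *\<^sub>R x) n = complex_of_real r * ell2_coord x n"
  by (transfer; simp)+

instantiation ell2 :: real_inner
begin

definition norm_ell2 :: "ell2 \<Rightarrow> real"
  where "norm_ell2 x = sqrt (\<Sum>n. (cmod (ell2_coord x n))\<^sup>2)"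
definition sgn_ell2 :: "ell2 \<Rightarrow> ell2"
  where "sgn_ell2 x = x /\<^sub>R norm x"
definition dist_ell2 :: "ell2 \<Rightarrow> ell2 \<Rightarrow> real"
  where "dist_ell2 x y = norm (x - y)"
definition uniformity_ell2 :: "(ell2 \<times> ell2) filter"
  where "uniformity_ell2 = (INF e\<in>{0 <..}. principal {(x, y). dist x y < e})"
definition open_ell2 :: "ell2 set \<Rightarrow> bool"
  where "open_ell2 U \<longleftrightarrow> (\<forall>x\<in>U. eventually (\<lambda>(x', y). x' = x \<longrightarrow> y \<in> U) uniformity)"
definition inner_ell2 :: "ell2 \<Rightarrow> ell2 \<Rightarrow> real"
  where "inner_ell2 x y = Re (\<Sum>n. ell2_coord x n * cnj (ell2_coord y n))"

lemma ell2_summable: "summable (\<lambda>n. ell2_coord x n * cnj (ell2_coord y n))"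
  by (intro summable_mult_cnj summable_ell2_coord)

lemma inner_ell2_alt: "inner x y = (\<Sum>n. Re (ell2_coord x n * cnj (ell2_coord y n)))"
  unfolding inner_ell2_def using Re_suminf[OF ell2_summable] .

lemma inner_ell2_self: "inner x x = (\<Sum>n. (cmod (ell2_coord x n))\<^sup>2)"
  unfolding inner_ell2_alt by (simp only: complex_norm_square[symmetric] Re_complex_of_real)

instance
proof
  fix x y z :: ell2 and r :: real
  show "inner x y = inner y x"
    unfolding inner_ell2_alt by (simp add: mult.commute)
  show "inner (x + y) z = inner x z + inner y z"
    unfolding inner_ell2_def
    by (simp only: ell2_coord_simps distrib_right suminf_add[OF ell2_summable ell2_summable, symmetric]
        plus_complex.sel)
  show "inner (r *\<^sub>R x) y = r * inner x y"
    unfolding inner_ell2_def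
    by (simp only: ell2_coord_simps mult.assoc suminf_mult[OF ell2_summable]) simp
  show "0 \<le> inner x x"
    unfolding inner_ell2_self by (intro suminf_nonneg summable_ell2_coord) simp
  show "inner x x = 0 \<longleftrightarrow> x = 0"
  proof -
    have "inner x x = 0 \<longleftrightarrow> (\<forall>n. (cmod (ell2_coord x n))\<^sup>2 = 0)"
      unfolding inner_ell2_self by (intro suminf_eq_zero_iff summable_ell2_coord) simp
    also have "\<dots> \<longleftrightarrow> x = 0" by (auto intro: ell2_eqI)
    finally show ?thesis .
  qed
  show "norm x = sqrt (inner x x)"
    unfolding inner_ell2_self norm_ell2_def ..
qed (simp_all add: sgn_ell2_def dist_ell2_def uniformity_ell2_def open_ell2_def)

end

lemma norm_ell2_sq: "(norm x)\<^sup>2 = (\<Sum>n. (cmod (ell2_coord x n))\<^sup>2)"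
  by (simp only: power2_norm_eq_inner inner_ell2_self)

lemma ell2_partial_le: "(\<Sum>n<N. (cmod (ell2_coord x n))\<^sup>2) \<le> (norm x)\<^sup>2"
  unfolding norm_ell2_sq by (intro sum_le_suminf summable_ell2_coord) auto

lemma ell2_coord_le: "cmod (ell2_coord x n) \<le> norm x"
proof -
  have "(cmod (ell2_coord x n))\<^sup>2 \<le> (\<Sum>k<Suc n. (cmod (ell2_coord x k))\<^sup>2)"
    by (simp add: sum_nonneg)
  also have "\<dots> \<le> (norm x)\<^sup>2" by (rule ell2_partial_le)
  finally show ?thesis by (rule power2_le_imp_le) simp
qed

instance ell2 :: complete_space
proof
  fix X :: "nat \<Rightarrow> ell2"
  assume X: "Cauchy X"
  have "Cauchy (\<lambda>k. ell2_coord (X k) n)" for n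
  proof (rule CauchyI)
    fix e :: real assume "0 < e"
    with X obtain M where M: "\<And>k l. k \<ge> M \<Longrightarrow> l \<ge> M \<Longrightarrow> norm (X k - X l) < e"
      by (blast dest: CauchyD)
    have "norm (ell2_coord (X k) n - ell2_coord (X l) n) < e" if "k \<ge> M" "l \<ge> M" for k l
      using le_less_trans[OF ell2_coord_le[of "X k - X l" n] M[OF that]]
      by (simp only: ell2_coord_simps)
    then show "\<exists>M. \<forall>k\<ge>M. \<forall>l\<ge>M. norm (ell2_coord (X k) n - ell2_coord (X l) n) < e"
      by blast
  qed
  then have "\<forall>n. \<exists>l. (\<lambda>k. ell2_coord (X k) n) \<longlonglongrightarrow> l"
    using Cauchy_convergent convergent_def by blast
  then obtain L where L: "\<And>n. (\<lambda>k. ell2_coord (X k) n) \<longlonglongrightarrow> L n" by metis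
  have bound: "\<exists>M. \<forall>k\<ge>M. \<forall>N. (\<Sum>n<N. (cmod (ell2_coord (X k) n - L n))\<^sup>2) \<le> e\<^sup>2"
    if "0 < e" for e :: real
  proof -
    obtain M where M: "\<And>k l. k \<ge> M \<Longrightarrow> l \<ge> M \<Longrightarrow> norm (X k - X l) < e"
      using CauchyD[OF X \<open>0 < e\<close>] by blast
    have "(\<Sum>n<N. (cmod (ell2_coord (X k) n - L n))\<^sup>2) \<le> e\<^sup>2" if "k \<ge> M" for k N
    proof (rule tendsto_upperbound)
      show "(\<lambda>l. \<Sum>n<N. (cmod (ell2_coord (X k) n - ell2_coord (X l) n))\<^sup>2)
          \<longlonglongrightarrow> (\<Sum>n<N. (cmod (ell2_coord (X k) n - L n))\<^sup>2)"
        by (intro tendsto_intros L)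
      show "\<forall>\<^sub>F l in sequentially.
          (\<Sum>n<N. (cmod (ell2_coord (X k) n - ell2_coord (X l) n))\<^sup>2) \<le> e\<^sup>2"
      proof (rule eventually_sequentiallyI[of M])
        fix l assume "M \<le> l"
        have "(\<Sum>n<N. (cmod (ell2_coord (X k) n - ell2_coord (X l) n))\<^sup>2)
            \<le> (norm (X k - X l))\<^sup>2"
          using ell2_partial_le[of "X k - X l" N] by simp
        also have "\<dots> \<le> e\<^sup>2"
          using M[OF \<open>k \<ge> M\<close> \<open>M \<le> l\<close>] by (intro power_mono) auto
        finally show "(\<Sum>n<N. (cmod (ell2_coord (X k) n - ell2_coord (X l) n))\<^sup>2) \<le> e\<^sup>2" .
      qed
    qed simp
    then show ?thesis by blast
  qed
  from bound[OF zero_less_one] obtain M where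
    "\<forall>k\<ge>M. \<forall>N. (\<Sum>n<N. (cmod (ell2_coord (X k) n - L n))\<^sup>2) \<le> 1\<^sup>2" ..
  then have M: "(\<Sum>n<N. (cmod (ell2_coord (X M) n - L n))\<^sup>2) \<le> 1\<^sup>2" for N
    by (meson order_refl)
  have "summable (\<lambda>n. (cmod (ell2_coord (X M) n - L n))\<^sup>2)"
    by (rule summableI_nonneg_bounded[OF _ M]) simp
  then have "summable (\<lambda>n. (cmod (L n - ell2_coord (X M) n))\<^sup>2)"
    by (simp only: norm_minus_commute)
  from summable_sq_add[OF this summable_ell2_coord[of "X M"]]
  have sL: "summable (\<lambda>n. (cmod (L n))\<^sup>2)" by simp
  define Y where "Y = Abs_ell2 L"
  have Y: "ell2_coord Y n = L n" for n
    unfolding Y_def using sL by (simp add: Abs_ell2_inverse)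
  have "X \<longlonglongrightarrow> Y"
  proof (rule LIMSEQ_I)
    fix r :: real assume "0 < r"
    then have "0 < r / 2" by simp
    from bound[OF this] obtain K where
      K: "\<And>k N. k \<ge> K \<Longrightarrow> (\<Sum>n<N. (cmod (ell2_coord (X k) n - L n))\<^sup>2) \<le> (r/2)\<^sup>2" by blast
    have "norm (X k - Y) < r" if "k \<ge> K" for k
    proof -
      have coord: "ell2_coord (X k - Y) n = ell2_coord (X k) n - L n" for n
        by (simp only: ell2_coord_simps Y)
      have "(norm (X k - Y))\<^sup>2 \<le> (r/2)\<^sup>2"
        unfolding norm_ell2_sq
        by (rule suminf_le_const[OF summable_ell2_coord], simp only: coord, rule K[OF that])
      then have "norm (X k - Y) \<le> r / 2"
        by (rule power2_le_imp_le) (use \<open>0 < r\<close> in simp)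
      then show ?thesis using \<open>0 < r\<close> by simp
    qed
    then show "\<exists>no. \<forall>n\<ge>no. norm (X n - Y) < r" by blast
  qed
  then show "convergent X" by (rule convergentI)
qed

instantiation ell2 :: complex_hilbert_space
begin

lift_definition scaleC_ell2 :: "complex \<Rightarrow> ell2 \<Rightarrow> ell2" is "\<lambda>c x n. c * x n"
  by (rule summable_sq_scale)
definition cinner_ell2 :: "ell2 \<Rightarrow> ell2 \<Rightarrow> complex"
  where "cinner_ell2 x y = (\<Sum>n. ell2_coord x n * cnj (ell2_coord y n))"

instance
proof
  fix x y z :: ell2 and c d :: complex and r :: real
  show "c *\<^sub>C (x + y) = c *\<^sub>C x + c *\<^sub>C y" by transfer (simp add: algebra_simps)
  show "(c + d) *\<^sub>C x = c *\<^sub>C x + d *\<^sub>C x" by transfer (simp add: algebra_simps)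
  show "c *\<^sub>C (d *\<^sub>C x) = (c * d) *\<^sub>C x" by transfer (simp add: algebra_simps)
  show "complex_of_real r *\<^sub>C x = r *\<^sub>R x" by transfer simp
  have "(\<lambda>n. cnj (ell2_coord y n * cnj (ell2_coord x n)))
      sums cnj (\<Sum>n. ell2_coord y n * cnj (ell2_coord x n))"
    unfolding sums_cnj by (rule summable_sums[OF ell2_summable])
  then show "cinner x y = cnj (cinner y x)"
    unfolding cinner_ell2_def by (simp add: sums_iff mult.commute)
  show "cinner (x + y) z = cinner x z + cinner y z"
    unfolding cinner_ell2_def
    by (simp only: ell2_coord_simps distrib_right suminf_add[OF ell2_summable ell2_summable, symmetric])
  have "ell2_coord (c *\<^sub>C x) n = c * ell2_coord x n" for n by transfer simp
  then show "cinner (c *\<^sub>C x) y = c * cinner x y"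
    unfolding cinner_ell2_def by (simp only: mult.assoc suminf_mult[OF ell2_summable])
  show "inner x y = Re (cinner x y)"
    unfolding cinner_ell2_def inner_ell2_def ..
qed

end

section \<open>Bounded operators and the Loewner order\<close>

text \<open>
  The type \<open>'h \<Rightarrow>\<^sub>L 'h\<close> consists of the bounded \<^emph>\<open>real\<close>-linear maps, with the operator norm; the
  algebra of bounded operators of the complex space is the following subset.
\<close>

definition bounded_ops :: "('h::complex_hilbert_space \<Rightarrow>\<^sub>L 'h) set" where
  "bounded_ops = {T. \<forall>c x. blinfun_apply T (c *\<^sub>C x) = c *\<^sub>C blinfun_apply T x}"

definition pos_ops :: "('h::complex_hilbert_space \<Rightarrow>\<^sub>L 'h) set" where
  "pos_ops = {T \<in> bounded_ops. \<forall>x. cinner (blinfun_apply T x) x \<in> \<real>\<^sub>\<ge>\<^sub>0}"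

definition loewner_le ::
    "('h::complex_hilbert_space \<Rightarrow>\<^sub>L 'h) \<Rightarrow> ('h \<Rightarrow>\<^sub>L 'h) \<Rightarrow> bool" (infix \<open>\<preceq>\<close> 50) where
  "X \<preceq> Y \<longleftrightarrow> Y - X \<in> pos_ops"

definition invertible_op :: "('h::complex_hilbert_space \<Rightarrow>\<^sub>L 'h) \<Rightarrow> bool" where
  "invertible_op T \<longleftrightarrow>
     (\<exists>S\<in>bounded_ops. T o\<^sub>L S = id_blinfun \<and> S o\<^sub>L T = id_blinfun)"

definition pos_inv_ops :: "('h::complex_hilbert_space \<Rightarrow>\<^sub>L 'h) set" where
  "pos_inv_ops = {T \<in> pos_ops. invertible_op T}"

text \<open>The descriptions below denote the intended object whenever it exists (it is then unique).\<close>

definition adj_op :: "('h::complex_hilbert_space \<Rightarrow>\<^sub>L 'h) \<Rightarrow> ('h \<Rightarrow>\<^sub>L 'h)" where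
  "adj_op T = (THE S. S \<in> bounded_ops \<and> (\<forall>x y. cinner (T x) y = cinner x (S y)))"

definition inv_op :: "('h::complex_hilbert_space \<Rightarrow>\<^sub>L 'h) \<Rightarrow> ('h \<Rightarrow>\<^sub>L 'h)" where
  "inv_op T = (THE S. S \<in> bounded_ops \<and> T o\<^sub>L S = id_blinfun \<and> S o\<^sub>L T = id_blinfun)"

definition sqrt_op :: "('h::complex_hilbert_space \<Rightarrow>\<^sub>L 'h) \<Rightarrow> ('h \<Rightarrow>\<^sub>L 'h)" where
  "sqrt_op T = (THE S. S \<in> pos_ops \<and> S o\<^sub>L S = T)"

definition geometric_mean ::
    "('h::complex_hilbert_space \<Rightarrow>\<^sub>L 'h) \<Rightarrow> ('h \<Rightarrow>\<^sub>L 'h) \<Rightarrow> ('h \<Rightarrow>\<^sub>L 'h)" (infixl \<open>\<sharp>\<close> 70) where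
  "A \<sharp> B = sqrt_op A o\<^sub>L
     sqrt_op (inv_op (sqrt_op A) o\<^sub>L B o\<^sub>L inv_op (sqrt_op A)) o\<^sub>L sqrt_op A"

section \<open>Continuous functional calculus and operator monotone functions\<close>

definition poly_op :: "real poly \<Rightarrow> ('h::complex_hilbert_space \<Rightarrow>\<^sub>L 'h) \<Rightarrow> ('h \<Rightarrow>\<^sub>L 'h)" where
  "poly_op p T = (\<Sum>i\<le>degree p. coeff p i *\<^sub>R (((o\<^sub>L) T ^^ i) id_blinfun))"

text \<open>
  Used for self-adjoint operators only; these have real spectrum, so that nothing is lost by
  restricting to real numbers here and to real polynomials in the functional calculus.
\<close>

definition real_spectrum :: "('h::complex_hilbert_space \<Rightarrow>\<^sub>L 'h) \<Rightarrow> real set" where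
  "real_spectrum T = {t. \<not> invertible_op (T - t *\<^sub>R id_blinfun)}"

definition fun_op :: "(real \<Rightarrow> real) \<Rightarrow> ('h::complex_hilbert_space \<Rightarrow>\<^sub>L 'h) \<Rightarrow> ('h \<Rightarrow>\<^sub>L 'h)" where
  "fun_op f T = (THE S. \<exists>p :: nat \<Rightarrow> real poly.
     uniform_limit (real_spectrum T) (\<lambda>n. poly (p n)) f sequentially \<and>
     (\<lambda>n. poly_op (p n) T) \<longlonglongrightarrow> S)"

text \<open>
  Operator monotonicity of a continuous function on \<open>[0,\<infinity>)\<close> is a property of the function alone: it refers to the
  operators on an infinite-dimensional Hilbert space, here \<open>\<ell>\<^sup>2\<close> (equivalently, to
  all Hilbert spaces, or to matrices of all sizes).
\<close>

definition operator_monotone :: "(real \<Rightarrow> real) \<Rightarrow> bool" where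
  "operator_monotone f \<longleftrightarrow> continuous_on {0..} f \<and>
     (\<forall>A\<in>pos_ops. \<forall>B\<in>pos_ops. A \<preceq> B \<longrightarrow> fun_op f A \<preceq> fun_op f (B :: ell2 \<Rightarrow>\<^sub>L ell2))"

section \<open>Operator means\<close>

text \<open>
  A binary operation on the positive operators is a function on the whole type of which only the
  values at positive arguments are ever referred to.
\<close>

type_synonym 'h binop = "('h \<Rightarrow>\<^sub>L 'h) \<Rightarrow> ('h \<Rightarrow>\<^sub>L 'h) \<Rightarrow> ('h \<Rightarrow>\<^sub>L 'h)"

definition decreases_to ::
    "(nat \<Rightarrow> ('h::complex_hilbert_space \<Rightarrow>\<^sub>L 'h)) \<Rightarrow> ('h \<Rightarrow>\<^sub>L 'h) \<Rightarrow> bool" where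
  "decreases_to T L \<longleftrightarrow> (\<forall>n. T (Suc n) \<preceq> T n) \<and> (\<forall>x. (\<lambda>n. T n x) \<longlonglongrightarrow> L x)"

definition operator_mean :: "'h::complex_hilbert_space binop \<Rightarrow> bool" where
  "operator_mean \<sigma> \<longleftrightarrow>
     (\<forall>A\<in>pos_ops. \<forall>B\<in>pos_ops. \<sigma> A B \<in> pos_ops) \<and>
     \<sigma> id_blinfun id_blinfun = id_blinfun \<and>
     (\<forall>A\<in>pos_ops. \<forall>B\<in>pos_ops. \<forall>C\<in>bounded_ops.
        adj_op C o\<^sub>L \<sigma> A B o\<^sub>L C \<preceq> \<sigma> (adj_op C o\<^sub>L A o\<^sub>L C) (adj_op C o\<^sub>L B o\<^sub>L C)) \<and>
     (\<forall>S T A B. (\<forall>n. S n \<in> pos_ops) \<and> (\<forall>n. T n \<in> pos_ops) \<and> A \<in> pos_ops \<and> B \<in> pos_ops \<and>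
        decreases_to S A \<and> decreases_to T B \<longrightarrow> decreases_to (\<lambda>n. \<sigma> (S n) (T n)) (\<sigma> A B)) \<and>
     (\<forall>A\<in>pos_ops. \<forall>B\<in>pos_ops. \<forall>C\<in>pos_ops. \<forall>D\<in>pos_ops.
        A \<preceq> B \<and> C \<preceq> D \<longrightarrow> \<sigma> A C \<preceq> \<sigma> B D)"

text \<open>
  On an infinite-dimensional space every operator mean has a representing function by the
  Kubo--Ando theorem.  On a fixed space of finite dimension \<open>n\<close> the axioms above only see
  monotonicity for matrices of size \<open>n\<close>; operator monotonicity of the representing
  function is then a genuine requirement, as in the Kubo--Ando correspondence.
\<close>

definition representing_function :: "'h::complex_hilbert_space binop \<Rightarrow> (real \<Rightarrow> real) \<Rightarrow> bool" where
  "representing_function \<sigma> f \<longleftrightarrow>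
     operator_monotone f \<and> (\<forall>t\<ge>0. f t \<ge> 0) \<and> f 1 = 1 \<and>
     (\<forall>t\<ge>0. \<sigma> id_blinfun (t *\<^sub>R id_blinfun) = f t *\<^sub>R id_blinfun)"

text \<open>
  \<open>dual_mean \<sigma> \<tau>\<close>: the operator mean \<open>\<tau>\<close> is the dual of \<open>\<sigma>\<close>.  The value of \<open>t / f t\<close> at \<open>t = 0\<close> is
  meant as a limit (for \<open>f t = t\<close> it is \<open>1\<close>), which the continuity of \<open>g\<close> provides.
\<close>

definition dual_mean :: "'h::complex_hilbert_space binop \<Rightarrow> 'h binop \<Rightarrow> bool" where
  "dual_mean \<sigma> \<tau> \<longleftrightarrow> operator_mean \<sigma> \<and> operator_mean \<tau> \<and>
     (\<exists>f g. representing_function \<sigma> f \<and> representing_function \<tau> g \<and> (\<forall>t>0. g t = t / f t))"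

definition symmetric_mean :: "'h::complex_hilbert_space binop \<Rightarrow> bool" where
  "symmetric_mean \<sigma> \<longleftrightarrow> operator_mean \<sigma> \<and> (\<forall>A\<in>pos_ops. \<forall>B\<in>pos_ops. \<sigma> A B = \<sigma> B A)"

definition interpolational_path ::
    "'h::complex_hilbert_space binop \<Rightarrow> (real \<Rightarrow> 'h binop) \<Rightarrow> bool" where
  "interpolational_path \<sigma> \<sigma>t \<longleftrightarrow>
     symmetric_mean \<sigma> \<and> (\<forall>t\<in>{0..1}. operator_mean (\<sigma>t t)) \<and>
     (\<forall>A\<in>pos_inv_ops. \<forall>B\<in>pos_inv_ops.
        \<sigma>t 0 A B = A \<and> \<sigma>t (1/2) A B = \<sigma> A B \<and> \<sigma>t 1 A B = B \<and>
        (\<forall>p\<in>{0..1}. \<forall>q\<in>{0..1}. \<sigma> (\<sigma>t p A B) (\<sigma>t q A B) = \<sigma>t ((p + q) / 2) A B) \<and>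
        continuous_on {0..1} (\<lambda>t. \<sigma>t t A B))"

end

theory Submission
  imports Defs "HOL-Computational_Algebra.Fundamental_Theorem_Algebra"
begin

text \<open>
  Write \<open>I\<close> for the identity and \<open>X = A\<^sup>-\<^sup>1\<^sup>/\<^sup>2 B A\<^sup>-\<^sup>1\<^sup>/\<^sup>2\<close>.  Congruence with \<open>A\<^sup>1\<^sup>/\<^sup>2\<close> turns \<open>A \<sigma> B\<close> into \<open>I \<sigma> X\<close>,
  which commutes with the commutant of \<open>X\<close> and lies between \<open>f s\<close> and \<open>f t\<close> wherever \<open>s \<le> X \<le> t\<close>.
  Hence \<open>(I \<sigma> X) (I \<sigma>\<^sup>\<bottom> X) = X\<close>, so that \<open>(A \<sigma> B) \<sharp> (A \<sigma>\<^sup>\<bottom> B) = A \<sharp> B\<close>, and the first two inequalities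
  follow once \<open>\<sharp>\<close>, \<open>\<sigma>\<close> and \<open>\<sigma>\<^sup>\<bottom>\<close> are known to be superadditive and \<open>\<sharp>\<close> to be monotone.

  \<open>A \<sharp> B\<close> is the largest self-adjoint \<open>M\<close> with \<open>M A\<^sup>-\<^sup>1 M \<le> B\<close>, and \<open>(M, A) \<mapsto> M A\<^sup>-\<^sup>1 M\<close> is subadditive; the
  same argument applies to weighted harmonic means.  On a space of finite dimension the axioms of
  a mean do not make \<open>\<sigma>\<close> superadditive.  Here operator monotonicity of \<open>f\<close> on \<open>\<ell>\<^sup>2\<close> enters, through a
  finite form of Loewner's theorem: on finitely many points \<open>f\<close> is approximated by convex
  combinations of representing functions of weighted harmonic means.  The positivity behind it
  is that of the divided differences of \<open>q\<^sup>2 f\<close> for polynomials \<open>q\<close>, and duality between such functionals and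
  polynomials that are nonnegative on the half-line does the rest.

  For an interpolational path, \<open>(A \<sigma>\<^sub>t B) \<sigma>\<^sub>r (A \<sigma>\<^sub>1\<^sub>-\<^sub>t B) = A \<sigma>\<^sub>s B\<close> with \<open>s = (1 - r) t + r (1 - t)\<close>;
  the last inequality is an instance of the second one.
\<close>

subsection \<open>Bounded operators\<close>

text \<open>\<open>f(X)\<close> is never formed for an operator X on H. Its substitute is a positive
  E that commutes with X: \<open>t E \<le> E X\<close> says that X is at least t where E lives, and
  soft partitions of unity into such E replace spectral projections. The axioms of a mean fix
  \<open>E (I \<sigma> X)\<close> through f on each piece, so two operations whose functions are
  close on a fine grid are close on all X between fixed bounds. A finite grid therefore suffices,
  and the representing measure of Loewner's theorem is avoided.

  The link from \<ell>2 to scalars: interlacing nodes become the eigenvalues of two finite-rank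
  operators A \<le> B, and f(A) \<le> f(B), tested on one vector, is the divided difference of q^2
  f. A polynomial that is nonnegative on the half-line is built from r^2 and x r^2; the terms x r^2
  call for the divided differences of q^2 f, the terms r^2 for those of q^2 f(t)/t with the opposite
  sign. The latter follow from the former by means of extra nodes at 0 and near infinity.

  On the zero space all scalar multiples of I coincide and f cannot be read off; hence the vector
  \<open>x \<noteq> 0\<close> in many hypotheses.\<close>

instance complex_hilbert_space \<subseteq> banach ..

interpretation op_comp: bounded_bilinear "(o\<^sub>L)"
  by (rule bounded_bilinear_blinfun_compose)

lemmas op_comp_bilinear =
  op_comp.add_left op_comp.add_right op_comp.diff_left op_comp.diff_right
  op_comp.minus_left op_comp.minus_right op_comp.scaleR_left op_comp.scaleR_right

lemma op_comp_assoc: "(A o\<^sub>L B) o\<^sub>L C = A o\<^sub>L (B o\<^sub>L C)"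
  by (rule blinfun_eqI) simp

lemma op_comp_id [simp]: "id_blinfun o\<^sub>L A = A" "A o\<^sub>L id_blinfun = A"
  by (rule blinfun_eqI, simp)+

lemmas op_algebra = op_comp_bilinear op_comp_assoc

lemmas op_apply = blinfun.bilinear_simps

text \<open>Products are normalized by nesting them to the right; there \<open>C o\<^sub>L A\<close>
  is no longer a subterm when more factors follow, so equations between products are needed with a
  trailing factor Z. The same holds for \<open>op_left_commute\<close>.\<close>

lemma op_left_cancel: "C o\<^sub>L A = B \<Longrightarrow> C o\<^sub>L (A o\<^sub>L Z) = B o\<^sub>L Z"
  by (metis op_comp_assoc)

lemma op_left_commute: "A o\<^sub>L B = B o\<^sub>L A \<Longrightarrow> A o\<^sub>L (B o\<^sub>L Z) = B o\<^sub>L (A o\<^sub>L Z)"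
  by (metis op_comp_assoc)

section \<open>Complex scalars and the complex inner product\<close>

lemma scaleC_zero_right [simp]: "c *\<^sub>C (0::'h::complex_hilbert_space) = 0"
  using scaleC_add_right[of c 0 "0::'h"] by simp

lemma scaleC_minus_right: "c *\<^sub>C (- x) = - (c *\<^sub>C (x::'h::complex_hilbert_space))"
  using scaleC_add_right[of c "- x" x] by (simp add: eq_neg_iff_add_eq_0)

lemma scaleC_diff_right: "c *\<^sub>C (x - y) = c *\<^sub>C x - c *\<^sub>C (y::'h::complex_hilbert_space)"
  using scaleC_add_right[of c x "- y"] by (simp add: scaleC_minus_right)

lemma scaleC_scaleR: "c *\<^sub>C (r *\<^sub>R x) = r *\<^sub>R (c *\<^sub>C (x::'h::complex_hilbert_space))"
  by (simp add: scaleC_scaleC mult.commute flip: scaleC_of_real)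

lemma scaleC_minus_one: "(-1) *\<^sub>C (x::'h::complex_hilbert_space) = - x"
  using scaleC_of_real[of "-1" x] by simp

lemma cinner_scaleC_right: "cinner x (c *\<^sub>C y) = cnj c * cinner x (y::'h::complex_hilbert_space)"
  using cinner_scaleC_left[of c y x] by (simp add: cinner_commute[of x])

lemma cinner_add_right: "cinner x (y + z) = cinner x y + cinner x (z::'h::complex_hilbert_space)"
  using cinner_add_left[of y z x] by (simp add: cinner_commute[of x])

text \<open>Both parts of the complex inner product are real inner products, so everything below can
  be done with \<open>inner\<close> alone.\<close>

lemma Im_cinner: "Im (cinner x y) = inner x (\<i> *\<^sub>C (y::'h::complex_hilbert_space))"
  by (simp add: inner_eq_Re_cinner cinner_scaleC_right)

lemma cinner_eqI:
  fixes x y u v :: "'h::complex_hilbert_space"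
  assumes "inner x y = inner u v" "inner x (\<i> *\<^sub>C y) = inner u (\<i> *\<^sub>C v)"
  shows "cinner x y = cinner u v"
  by (rule complex_eqI) (use assms in \<open>simp_all add: inner_eq_Re_cinner[symmetric] Im_cinner\<close>)

lemma inner_scaleC_i: "inner (\<i> *\<^sub>C x) (\<i> *\<^sub>C y) = inner x (y::'h::complex_hilbert_space)"
  by (simp add: inner_eq_Re_cinner cinner_scaleC_left cinner_scaleC_right)

lemma inner_scaleC_i_left: "inner (\<i> *\<^sub>C x) y = - inner x (\<i> *\<^sub>C (y::'h::complex_hilbert_space))"
  by (simp add: inner_eq_Re_cinner cinner_scaleC_left cinner_scaleC_right)

lemma norm_scaleC: "norm (c *\<^sub>C x) = cmod c * norm (x::'h::complex_hilbert_space)"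
proof -
  have "Im (cinner x x) = 0"
    using cinner_commute[of x x] by (metis cnj.simps(2) eq_neg_iff_add_eq_0 mult_2 mult_eq_0_iff zero_neq_numeral)
  then have "inner (c *\<^sub>C x) (c *\<^sub>C x) = (cmod c)\<^sup>2 * inner x x"
    unfolding cmod_power2
    by (simp add: inner_eq_Re_cinner cinner_scaleC_left cinner_scaleC_right algebra_simps power2_eq_square)
  then have "(norm (c *\<^sub>C x))\<^sup>2 = (cmod c * norm x)\<^sup>2"
    by (simp add: power2_norm_eq_inner power_mult_distrib)
  then show ?thesis by simp
qed

lemma bounded_linear_scaleC: "bounded_linear ((*\<^sub>C) c :: 'h::complex_hilbert_space \<Rightarrow> 'h)"
  by (rule bounded_linear_intro[of _ "cmod c"])
    (simp_all add: scaleC_add_right scaleC_scaleR norm_scaleC)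

lemma bounded_opsI: "(\<And>c x. blinfun_apply T (c *\<^sub>C x) = c *\<^sub>C T x) \<Longrightarrow> T \<in> bounded_ops"
  and bounded_opsD: "T \<in> bounded_ops \<Longrightarrow> blinfun_apply T (c *\<^sub>C x) = c *\<^sub>C T x"
  by (auto simp: bounded_ops_def)

lemma bounded_ops_add: "S \<in> bounded_ops \<Longrightarrow> T \<in> bounded_ops \<Longrightarrow> S + T \<in> bounded_ops"
  and bounded_ops_diff: "S \<in> bounded_ops \<Longrightarrow> T \<in> bounded_ops \<Longrightarrow> S - T \<in> bounded_ops"
  and bounded_ops_minus: "S \<in> bounded_ops \<Longrightarrow> - S \<in> bounded_ops"
  and bounded_ops_scaleR: "S \<in> bounded_ops \<Longrightarrow> r *\<^sub>R S \<in> bounded_ops"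
  and bounded_ops_comp: "S \<in> bounded_ops \<Longrightarrow> T \<in> bounded_ops \<Longrightarrow> S o\<^sub>L T \<in> bounded_ops"
  and bounded_ops_id: "id_blinfun \<in> bounded_ops"
  and bounded_ops_zero: "0 \<in> bounded_ops"
  by (auto simp: bounded_ops_def op_apply scaleC_add_right scaleC_diff_right scaleC_minus_right scaleC_scaleR)

lemma closed_bounded_ops: "closed (bounded_ops :: ('h::complex_hilbert_space \<Rightarrow>\<^sub>L 'h) set)"
proof -
  have eq: "bounded_ops = (\<Inter>c. \<Inter>x. {T :: 'h \<Rightarrow>\<^sub>L 'h. T (c *\<^sub>C x) = c *\<^sub>C T x})"
    by (auto simp: bounded_ops_def)
  have cl: "closed {T :: 'h \<Rightarrow>\<^sub>L 'h. T (c *\<^sub>C x) = c *\<^sub>C T x}" for c x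
    by (intro closed_Collect_eq continuous_intros bounded_linear.continuous_on[OF bounded_linear_scaleC])
  show ?thesis unfolding eq by (intro closed_INT ballI cl)
qed

subsection \<open>Self-adjoint and positive operators\<close>

text \<open>Symmetry for the real part is enough: for a complex-linear T, replacing y by i y gives
  it for the imaginary part as well.\<close>

definition selfadj :: "('h::complex_hilbert_space \<Rightarrow>\<^sub>L 'h) \<Rightarrow> bool" where
  "selfadj T \<longleftrightarrow> T \<in> bounded_ops \<and> (\<forall>x y. inner (T x) y = inner x (T y))"

lemma selfadjD: "selfadj T \<Longrightarrow> inner (T x) y = inner x (T y)"
  and selfadj_bounded: "selfadj T \<Longrightarrow> T \<in> bounded_ops"
  by (auto simp: selfadj_def)

lemma selfadj_add: "selfadj S \<Longrightarrow> selfadj T \<Longrightarrow> selfadj (S + T)"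
  and selfadj_diff: "selfadj S \<Longrightarrow> selfadj T \<Longrightarrow> selfadj (S - T)"
  and selfadj_minus: "selfadj S \<Longrightarrow> selfadj (- S)"
  and selfadj_scaleR: "selfadj S \<Longrightarrow> selfadj (r *\<^sub>R S)"
  and selfadj_id: "selfadj id_blinfun"
  and selfadj_zero: "selfadj 0"
  by (auto simp: selfadj_def bounded_ops_add bounded_ops_diff bounded_ops_minus bounded_ops_scaleR
      bounded_ops_id bounded_ops_zero op_apply inner_add_left inner_add_right inner_diff_left inner_diff_right)

lemma selfadj_comp: "selfadj S \<Longrightarrow> selfadj T \<Longrightarrow> S o\<^sub>L T = T o\<^sub>L S \<Longrightarrow> selfadj (S o\<^sub>L T)"
  unfolding selfadj_def by (simp add: bounded_ops_comp) (metis blinfun_apply_blinfun_compose)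

lemma selfadj_congr: "selfadj C \<Longrightarrow> selfadj T \<Longrightarrow> selfadj (C o\<^sub>L T o\<^sub>L C)"
  by (simp add: selfadj_def bounded_ops_comp)

lemma closed_selfadj: "closed {T :: 'h::complex_hilbert_space \<Rightarrow>\<^sub>L 'h. selfadj T}"
proof -
  have "{T :: 'h \<Rightarrow>\<^sub>L 'h. selfadj T} = bounded_ops \<inter> (\<Inter>x. \<Inter>y. {T :: 'h \<Rightarrow>\<^sub>L 'h. inner (T x) y = inner x (T y)})"
    by (auto simp: selfadj_def)
  moreover have "closed {T :: 'h \<Rightarrow>\<^sub>L 'h. inner (T x) y = inner x (T y)}" for x y
    by (intro closed_Collect_eq continuous_intros)
  ultimately show ?thesis by (simp add: closed_Int closed_bounded_ops closed_INT)
qed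

text \<open>A quadratic form with real values is Hermitian: the imaginary part of the form at x + i
  y, once the contributions of x and of i y are removed, is the difference of the two sides of the
  symmetry condition.\<close>

lemma pos_ops_iff: "T \<in> pos_ops \<longleftrightarrow> selfadj T \<and> (\<forall>x. 0 \<le> inner (T x) x)"
proof (intro iffI conjI allI)
  assume T: "T \<in> pos_ops"
  then have b: "T \<in> bounded_ops" and p: "\<And>x. cinner (T x) x \<in> \<real>\<^sub>\<ge>\<^sub>0"
    by (auto simp: pos_ops_def)
  have im: "inner (T x) (\<i> *\<^sub>C x) = 0" for x
    using p[of x] by (simp add: Im_cinner[symmetric] complex_nonneg_Reals_iff)
  show "0 \<le> inner (T x) x" for x
    using p[of x] by (simp add: inner_eq_Re_cinner complex_nonneg_Reals_iff)
  have "inner (T x) y = inner x (T y)" for x y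
  proof -
    have "inner (T (x + \<i> *\<^sub>C y)) (\<i> *\<^sub>C (x + \<i> *\<^sub>C y)) = 0" by (rule im)
    then have "inner (T x) (\<i> *\<^sub>C \<i> *\<^sub>C y) + inner (\<i> *\<^sub>C T y) (\<i> *\<^sub>C x) = 0"
      using im[of x] im[of "\<i> *\<^sub>C y"]
      by (simp add: op_apply scaleC_add_right inner_add_left inner_add_right bounded_opsD[OF b])
    then have "- inner (T x) y + inner (T y) x = 0"
      by (simp only: scaleC_scaleC scaleC_minus_one inner_scaleC_i complex_i_mult_minus i_squared inner_minus_right)
    then show ?thesis by (simp add: inner_commute[of x])
  qed
  with b show "selfadj T" by (simp add: selfadj_def)
next
  assume T: "selfadj T \<and> (\<forall>x. 0 \<le> inner (T x) x)"
  then have b: "T \<in> bounded_ops" by (simp add: selfadj_def)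
  have "inner (T x) (\<i> *\<^sub>C x) = 0" for x
  proof -
    have "inner (T x) (\<i> *\<^sub>C x) = inner x (T (\<i> *\<^sub>C x))"
      using T by (intro selfadjD) simp
    also have "\<dots> = inner (\<i> *\<^sub>C T x) x"
      by (simp only: bounded_opsD[OF b] inner_commute)
    finally show ?thesis using inner_scaleC_i_left[of "T x" x] by simp
  qed
  with T show "T \<in> pos_ops"
    by (simp add: pos_ops_def b complex_nonneg_Reals_iff Im_cinner flip: inner_eq_Re_cinner)
qed

lemma pos_opsI: "selfadj T \<Longrightarrow> (\<And>x. 0 \<le> inner (T x) x) \<Longrightarrow> T \<in> pos_ops"
  and pos_ops_selfadj: "T \<in> pos_ops \<Longrightarrow> selfadj T"
  and pos_opsD: "T \<in> pos_ops \<Longrightarrow> 0 \<le> inner (T x) x"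
  and pos_ops_bounded: "T \<in> pos_ops \<Longrightarrow> T \<in> bounded_ops"
  by (auto simp: pos_ops_iff intro: selfadj_bounded)

lemma closed_pos_ops: "closed (pos_ops :: ('h::complex_hilbert_space \<Rightarrow>\<^sub>L 'h) set)"
proof -
  have eq: "pos_ops = {T :: 'h \<Rightarrow>\<^sub>L 'h. selfadj T} \<inter> (\<Inter>x. {T :: 'h \<Rightarrow>\<^sub>L 'h. 0 \<le> inner (T x) x})"
    by (auto simp: pos_ops_iff)
  have cl: "closed {T :: 'h \<Rightarrow>\<^sub>L 'h. 0 \<le> inner (T x) x}" for x
    by (intro closed_Collect_le continuous_intros)
  show ?thesis unfolding eq by (intro closed_Int closed_selfadj closed_INT ballI cl)
qed

lemma pos_ops_add: "S \<in> pos_ops \<Longrightarrow> T \<in> pos_ops \<Longrightarrow> S + T \<in> pos_ops"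
  and pos_ops_scaleR: "T \<in> pos_ops \<Longrightarrow> 0 \<le> r \<Longrightarrow> r *\<^sub>R T \<in> pos_ops"
  and pos_ops_id: "id_blinfun \<in> pos_ops"
  and pos_ops_zero: "0 \<in> pos_ops"
  by (simp_all add: pos_ops_iff selfadj_add selfadj_scaleR selfadj_id selfadj_zero op_apply inner_add_left)

lemma pos_ops_congr: "selfadj C \<Longrightarrow> T \<in> pos_ops \<Longrightarrow> C o\<^sub>L T o\<^sub>L C \<in> pos_ops"
  by (auto simp: pos_ops_iff selfadj_congr selfadjD[of C])

lemma pos_ops_square: "selfadj C \<Longrightarrow> C o\<^sub>L C \<in> pos_ops"
  using pos_ops_congr[OF _ pos_ops_id, of C] by simp

section \<open>The Loewner order\<close>

lemma loewner_refl [simp]: "T \<preceq> T"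
  by (simp add: loewner_le_def pos_ops_zero)

lemma loewner_trans [trans]: "R \<preceq> S \<Longrightarrow> S \<preceq> T \<Longrightarrow> R \<preceq> T"
  unfolding loewner_le_def using pos_ops_add[of "S - R" "T - S"] by simp

lemma loewner_zero: "0 \<preceq> T \<longleftrightarrow> T \<in> pos_ops"
  by (simp add: loewner_le_def)

lemma loewner_iff: "selfadj S \<Longrightarrow> selfadj T \<Longrightarrow> S \<preceq> T \<longleftrightarrow> (\<forall>x. inner (S x) x \<le> inner (T x) x)"
  by (auto simp: loewner_le_def pos_ops_iff selfadj_diff op_apply inner_diff_left)

lemma loewnerD: "S \<preceq> T \<Longrightarrow> inner (S x) x \<le> inner (T x) x"
  using pos_opsD[of "T - S" x] by (simp add: loewner_le_def op_apply inner_diff_left)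

text \<open>At x + T x the form reduces to 2 |T x|^2.\<close>

lemma selfadj_zero_form:
  assumes "selfadj T" "\<And>x. inner (T x) x = 0"
  shows "T = 0"
proof (rule blinfun_eqI)
  fix x
  have "inner (T (x + T x)) (x + T x) = 0" by (rule assms)
  then have "inner (T x) (T x) + inner (T (T x)) x = 0"
    using assms(2)[of x] assms(2)[of "T x"] by (simp add: op_apply inner_add_left inner_add_right)
  then show "T x = blinfun_apply 0 x" using selfadjD[OF assms(1), of "T x" x] by simp
qed

lemma loewner_antisym: "S \<preceq> T \<Longrightarrow> T \<preceq> S \<Longrightarrow> S = T"
proof -
  assume a: "S \<preceq> T" "T \<preceq> S"
  then have "selfadj (T - S)" by (simp add: loewner_le_def pos_ops_iff)
  moreover have "inner ((T - S) x) x = 0" for x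
    using loewnerD[OF a(1), of x] loewnerD[OF a(2), of x] by (simp add: op_apply inner_diff_left)
  ultimately show "S = T" using selfadj_zero_form[of "T - S"] by simp
qed

lemma loewner_add: "A \<preceq> B \<Longrightarrow> C \<preceq> D \<Longrightarrow> A + C \<preceq> B + D"
  using pos_ops_add[of "B - A" "D - C"] by (simp add: loewner_le_def algebra_simps)

lemma loewner_scaleR: "A \<preceq> B \<Longrightarrow> 0 \<le> r \<Longrightarrow> r *\<^sub>R A \<preceq> r *\<^sub>R B"
  using pos_ops_scaleR[of "B - A" r] by (simp add: loewner_le_def scaleR_diff_right)

lemma loewner_congr: "A \<preceq> B \<Longrightarrow> selfadj C \<Longrightarrow> C o\<^sub>L A o\<^sub>L C \<preceq> C o\<^sub>L B o\<^sub>L C"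
  using pos_ops_congr[of C "B - A"] by (simp add: loewner_le_def op_comp_bilinear)

lemma loewner_pos: "A \<preceq> B \<Longrightarrow> A \<in> pos_ops \<Longrightarrow> B \<in> pos_ops"
  using pos_ops_add[of A "B - A"] by (simp add: loewner_le_def)

lemma loewner_scaleR_id: "selfadj T \<Longrightarrow> T \<preceq> r *\<^sub>R id_blinfun \<longleftrightarrow> (\<forall>x. inner (T x) x \<le> r * (norm x)\<^sup>2)"
  and loewner_scaleR_id': "selfadj T \<Longrightarrow> r *\<^sub>R id_blinfun \<preceq> T \<longleftrightarrow> (\<forall>x. r * (norm x)\<^sup>2 \<le> inner (T x) x)"
  by (auto simp: loewner_iff selfadj_scaleR selfadj_id op_apply power2_norm_eq_inner)

lemma loewner_norm: assumes "selfadj T" shows "T \<preceq> norm T *\<^sub>R id_blinfun"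
proof -
  have "inner (T x) x \<le> norm T * (norm x)\<^sup>2" for x
  proof -
    have "inner (T x) x \<le> norm (T x) * norm x" by (rule norm_cauchy_schwarz)
    also have "\<dots> \<le> (norm T * norm x) * norm x"
      by (intro mult_right_mono norm_blinfun) auto
    finally show ?thesis by (simp add: power2_eq_square)
  qed
  then show ?thesis using assms by (simp add: loewner_scaleR_id)
qed

lemma loewner_scaleR_mono: "T \<in> pos_ops \<Longrightarrow> r \<le> s \<Longrightarrow> r *\<^sub>R T \<preceq> s *\<^sub>R T"
  using pos_ops_scaleR[of T "s - r"] by (simp add: loewner_le_def scaleR_diff_left)

lemma loewner_epsI:
  assumes "\<And>e. 0 < e \<Longrightarrow> S \<preceq> T + e *\<^sub>R R"
  shows "S \<preceq> T"
proof -
  have "(\<lambda>n. (T + (1 / real (Suc n)) *\<^sub>R R) - S) \<longlonglongrightarrow> (T + 0 *\<^sub>R R) - S"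
    by (intro tendsto_intros LIMSEQ_Suc lim_1_over_n)
  then have "T + 0 *\<^sub>R R - S \<in> pos_ops"
    by (rule closed_sequentially[OF closed_pos_ops, rotated]) (use assms in \<open>simp add: loewner_le_def\<close>)
  then show ?thesis by (simp add: loewner_le_def)
qed

text \<open>The numerical radius of a self-adjoint operator bounds its norm, by polarization and the
  parallelogram law.\<close>

lemma norm_selfadj_le:
  assumes K: "selfadj K" and q: "\<And>x. \<bar>inner (K x) x\<bar> \<le> q * (norm x)\<^sup>2" and "0 \<le> q"
  shows "norm K \<le> q"
proof (rule norm_blinfun_bound[OF \<open>0 \<le> q\<close>])
  fix x
  show "norm (K x) \<le> q * norm x"
  proof (cases "K x = 0 \<or> x = 0")
    case False
    \<comment> \<open>K x rescaled to the length of x: then the inner product of K x and y is |x| |K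
      x|, and the parallelogram law bounds its fourfold by 4 q |x|^2.\<close>
    define y where "y = (norm x / norm (K x)) *\<^sub>R K x"
    have ny: "norm y = norm x" using False by (simp add: y_def)
    have iy: "inner (K x) y = norm x * norm (K x)"
      using False by (simp add: y_def power2_norm_eq_inner[symmetric] power2_eq_square)
    have "4 * inner (K x) y = inner (K (x + y)) (x + y) - inner (K (x - y)) (x - y)"
      using selfadjD[OF K, of y x] by (simp add: op_apply inner_simps inner_commute)
    also have "\<dots> \<le> q * (norm (x + y))\<^sup>2 + q * (norm (x - y))\<^sup>2"
      using q[of "x + y"] q[of "x - y"] by linarith
    also have "\<dots> = 2 * q * ((norm x)\<^sup>2 + (norm y)\<^sup>2)"
      by (simp add: power2_norm_eq_inner inner_simps inner_commute algebra_simps)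
    finally have "norm x * norm (K x) \<le> norm x * (q * norm x)"
      by (simp add: iy ny power2_eq_square mult.left_commute)
    then show ?thesis using False by simp
  qed (use \<open>0 \<le> q\<close> in auto)
qed

text \<open>In operator terms T^2 \<le> |T| T, obtained before any square root exists: the form at x
  - r T x is nonnegative, and r = 1 / |T| minimizes the resulting bound.\<close>

lemma pos_ops_norm_square:
  assumes T: "T \<in> pos_ops"
  shows "(norm (T x))\<^sup>2 \<le> norm T * inner (T x) x"
proof (cases "norm T = 0")
  case False
  define r where "r = 1 / norm T"
  have "0 \<le> inner (T (x - r *\<^sub>R T x)) (x - r *\<^sub>R T x)" by (rule pos_opsD[OF T])
  also have "\<dots> = inner (T x) x - 2 * r * inner (T x) (T x) + r\<^sup>2 * inner (T (T x)) (T x)"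
    using selfadjD[OF pos_ops_selfadj[OF T], of "T x" x]
    by (simp add: op_apply inner_simps power2_eq_square algebra_simps)
  also have "inner (T (T x)) (T x) \<le> norm T * (norm (T x))\<^sup>2"
    using loewnerD[OF loewner_norm[OF pos_ops_selfadj[OF T]], of "T x"]
    by (simp add: op_apply power2_norm_eq_inner)
  finally have "0 \<le> inner (T x) x - 2 * r * (norm (T x))\<^sup>2 + r\<^sup>2 * (norm T * (norm (T x))\<^sup>2)"
    by (simp add: power2_norm_eq_inner mult_left_mono)
  also have "\<dots> = inner (T x) x - (norm (T x))\<^sup>2 / norm T"
    using False by (simp add: r_def power2_eq_square field_simps)
  finally show ?thesis using False by (simp add: field_simps)
qed simp

text \<open>After division by M the operator lies between e / M and 1, so its distance to the
  identity is less than 1. Inverse and square root are both found as fixed points that start from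
  this contraction.\<close>

lemma bounded_below_contraction:
  assumes T: "selfadj T" and e: "0 < e" "e *\<^sub>R id_blinfun \<preceq> T"
  obtains M q where "0 < M" "0 \<le> q" "q < 1" "norm (id_blinfun - (1 / M) *\<^sub>R T) \<le> q"
proof -
  \<comment> \<open>On the zero space \<open>norm T\<close> is 0; on any other space the maximum is
    \<open>norm T\<close>.\<close>
  define M where "M = max e (norm T)"
  have M: "e \<le> M" "norm T \<le> M" "0 < M" using e(1) by (auto simp: M_def)
  have lo: "e * (norm x)\<^sup>2 \<le> inner (T x) x" for x
    using e(2) T by (simp add: loewner_scaleR_id')
  have hi: "inner (T x) x \<le> M * (norm x)\<^sup>2" for x
    using loewner_norm[OF T] mult_right_mono[OF M(2), of "(norm x)\<^sup>2"] T
    by (auto simp: loewner_scaleR_id intro: order_trans)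
  define q where "q = 1 - e / M"
  have q: "0 \<le> q" "q < 1" using M e by (auto simp: q_def)
  define K where "K = id_blinfun - (1 / M) *\<^sub>R T"
  have "norm K \<le> q"
  proof (rule norm_selfadj_le[OF _ _ q(1)])
    show "selfadj K" by (simp add: K_def T selfadj_diff selfadj_id selfadj_scaleR)
    fix x
    have "inner (K x) x = (norm x)\<^sup>2 - inner (T x) x / M"
      by (simp add: K_def op_apply inner_simps power2_norm_eq_inner)
    moreover have "inner (T x) x / M \<le> (norm x)\<^sup>2" using hi[of x] M by (simp add: field_simps)
    moreover have "e / M * (norm x)\<^sup>2 \<le> inner (T x) x / M" using lo[of x] M by (simp add: field_simps)
    ultimately show "\<bar>inner (K x) x\<bar> \<le> q * (norm x)\<^sup>2" by (simp add: q_def algebra_simps)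
  qed
  with M(3) q show ?thesis by (auto simp: K_def intro: that)
qed

text \<open>The fixed point is the Neumann series of the inverse and a priori only a real-linear
  right inverse. Injectivity of T then yields both that it is a left inverse and that it is
  complex-linear.\<close>

lemma bounded_below_inverse:
  fixes T :: "'h::complex_hilbert_space \<Rightarrow>\<^sub>L 'h"
  assumes T: "selfadj T" and e: "0 < e" "e *\<^sub>R id_blinfun \<preceq> T"
  obtains S where "S \<in> bounded_ops" "T o\<^sub>L S = id_blinfun" "S o\<^sub>L T = id_blinfun"
proof -
  obtain M q where M: "0 < M" and q: "0 \<le> q" "q < 1" and n: "norm (id_blinfun - (1 / M) *\<^sub>R T) \<le> q"
    by (rule bounded_below_contraction[OF T e])
  define K where "K = id_blinfun - (1 / M) *\<^sub>R T"
  have "\<exists>!S\<in>UNIV. (1 / M) *\<^sub>R id_blinfun + (K o\<^sub>L S) = S"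
  proof (rule Banach_fix[OF _ _ q])
    show "dist ((1 / M) *\<^sub>R id_blinfun + (K o\<^sub>L x)) ((1 / M) *\<^sub>R id_blinfun + (K o\<^sub>L y)) \<le> q * dist x y"
      for x y :: "'h \<Rightarrow>\<^sub>L 'h"
    proof -
      have "norm (K o\<^sub>L (x - y)) \<le> norm K * norm (x - y)" by (rule norm_blinfun_compose)
      also have "\<dots> \<le> q * norm (x - y)" by (intro mult_right_mono) (use n in \<open>auto simp: K_def\<close>)
      finally show ?thesis by (simp add: dist_norm op_algebra)
    qed
  qed (auto simp: complete_UNIV)
  then obtain S where S: "(1 / M) *\<^sub>R id_blinfun + (K o\<^sub>L S) = S" by auto
  then have "(1 / M) *\<^sub>R id_blinfun = (1 / M) *\<^sub>R (T o\<^sub>L S)"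
    by (simp add: K_def op_algebra algebra_simps)
  then have TS: "T o\<^sub>L S = id_blinfun" using M unfolding scaleR_cancel_left by auto
  have inj: "x = y" if "T x = T y" for x y
  proof -
    have "e * (norm (x - y))\<^sup>2 \<le> inner (T (x - y)) (x - y)"
      using e(2) T by (simp add: loewner_scaleR_id')
    with that e(1) show ?thesis by (simp add: op_apply mult_le_0_iff)
  qed
  have TS': "T (S x) = x" for x
    using arg_cong[OF TS, of "\<lambda>F. blinfun_apply F x"] by simp
  have "S o\<^sub>L T = id_blinfun" by (rule blinfun_eqI) (rule inj, simp add: TS')
  moreover have "S \<in> bounded_ops"
    by (rule bounded_opsI, rule inj) (simp add: TS' bounded_opsD[OF selfadj_bounded[OF T]])
  ultimately show ?thesis using TS that by blast
qed

text \<open>If S inverts T, then |x| \<le> |S| |T x|, and \<open>pos_ops_norm_square\<close> bounds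
  |T x|^2 by the form of T. The lower bound is far easier to propagate than invertibility.\<close>

lemma pos_inv_ops_iff: "T \<in> pos_inv_ops \<longleftrightarrow> selfadj T \<and> (\<exists>e>0. e *\<^sub>R id_blinfun \<preceq> T)"
proof
  assume T: "T \<in> pos_inv_ops"
  then have p: "T \<in> pos_ops" and "invertible_op T" by (auto simp: pos_inv_ops_def)
  then obtain S where S: "S o\<^sub>L T = id_blinfun" by (auto simp: invertible_op_def)
  \<comment> \<open>The summand 1 keeps the denominator positive on the zero space, where both norms
    vanish.\<close>
  define e where "e = 1 / ((norm S)\<^sup>2 * norm T + 1)"
  have pos: "0 < (norm S)\<^sup>2 * norm T + 1"
    by (rule add_nonneg_pos) auto
  have "e * (norm x)\<^sup>2 \<le> inner (T x) x" for x
  proof -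
    have "norm x = norm (S (T x))"
      using arg_cong[OF S, of "\<lambda>F. blinfun_apply F x"] by simp
    also have "\<dots> \<le> norm S * norm (T x)" by (rule norm_blinfun)
    finally have "(norm x)\<^sup>2 \<le> (norm S)\<^sup>2 * (norm (T x))\<^sup>2"
      by (metis norm_ge_zero power_mono power_mult_distrib)
    also have "\<dots> \<le> (norm S)\<^sup>2 * (norm T * inner (T x) x)"
      by (intro mult_left_mono pos_ops_norm_square p) auto
    also have "\<dots> \<le> ((norm S)\<^sup>2 * norm T + 1) * inner (T x) x"
      using pos_opsD[OF p, of x] by (simp add: algebra_simps)
    finally show ?thesis using pos by (simp add: e_def field_simps)
  qed
  then have "e *\<^sub>R id_blinfun \<preceq> T" by (simp add: loewner_scaleR_id' pos_ops_selfadj[OF p])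
  moreover have "0 < e" using pos by (simp add: e_def)
  ultimately show "selfadj T \<and> (\<exists>e>0. e *\<^sub>R id_blinfun \<preceq> T)"
    using pos_ops_selfadj[OF p] by blast
next
  assume "selfadj T \<and> (\<exists>e>0. e *\<^sub>R id_blinfun \<preceq> T)"
  then obtain e where T: "selfadj T" and e: "0 < e" "e *\<^sub>R id_blinfun \<preceq> T" by blast
  obtain S where "S \<in> bounded_ops" "T o\<^sub>L S = id_blinfun" "S o\<^sub>L T = id_blinfun"
    by (rule bounded_below_inverse[OF T e])
  then have "invertible_op T" by (auto simp: invertible_op_def)
  moreover have "T \<in> pos_ops"
    by (rule loewner_pos[OF e(2)]) (use e in \<open>simp add: pos_ops_scaleR pos_ops_id\<close>)
  ultimately show "T \<in> pos_inv_ops" by (simp add: pos_inv_ops_def)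
qed

subsection \<open>Inverses and square roots\<close>

lemma comm_comp: "L o\<^sub>L A = A o\<^sub>L L \<Longrightarrow> L o\<^sub>L B = B o\<^sub>L L \<Longrightarrow> L o\<^sub>L (A o\<^sub>L B) = (A o\<^sub>L B) o\<^sub>L L"
  by (metis op_comp_assoc)

lemma comm_add: "L o\<^sub>L A = A o\<^sub>L L \<Longrightarrow> L o\<^sub>L B = B o\<^sub>L L \<Longrightarrow> L o\<^sub>L (A + B) = (A + B) o\<^sub>L L"
  and comm_diff: "L o\<^sub>L A = A o\<^sub>L L \<Longrightarrow> L o\<^sub>L B = B o\<^sub>L L \<Longrightarrow> L o\<^sub>L (A - B) = (A - B) o\<^sub>L L"
  and comm_scaleR: "L o\<^sub>L A = A o\<^sub>L L \<Longrightarrow> L o\<^sub>L (r *\<^sub>R A) = (r *\<^sub>R A) o\<^sub>L L"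
  and comm_id: "L o\<^sub>L id_blinfun = id_blinfun o\<^sub>L L"
  by (simp_all add: op_comp_bilinear)

lemmas comm_intros = comm_comp comm_add comm_diff comm_scaleR comm_id

lemma inv_op_eqI:
  assumes "S \<in> bounded_ops" "T o\<^sub>L S = id_blinfun" "S o\<^sub>L T = id_blinfun"
  shows "inv_op T = S"
  unfolding inv_op_def
proof (rule the_equality)
  fix R assume R: "R \<in> bounded_ops \<and> T o\<^sub>L R = id_blinfun \<and> R o\<^sub>L T = id_blinfun"
  have "R = (S o\<^sub>L T) o\<^sub>L R" using assms by simp
  also have "\<dots> = S" unfolding op_comp_assoc using R by simp
  finally show "R = S" .
qed (use assms in simp)

lemma pos_inv_opsI: "selfadj T \<Longrightarrow> 0 < e \<Longrightarrow> e *\<^sub>R id_blinfun \<preceq> T \<Longrightarrow> T \<in> pos_inv_ops"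
  by (auto simp: pos_inv_ops_iff)

lemma pos_inv_pos: "T \<in> pos_inv_ops \<Longrightarrow> T \<in> pos_ops"
  by (simp add: pos_inv_ops_def)

lemma pos_inv_selfadj: "T \<in> pos_inv_ops \<Longrightarrow> selfadj T"
  by (simp add: pos_inv_pos pos_ops_selfadj)

lemma inv_op_props:
  assumes "T \<in> pos_inv_ops"
  shows "inv_op T \<in> bounded_ops" "T o\<^sub>L inv_op T = id_blinfun" "inv_op T o\<^sub>L T = id_blinfun"
proof -
  obtain S where S: "S \<in> bounded_ops" "T o\<^sub>L S = id_blinfun" "S o\<^sub>L T = id_blinfun"
    using assms by (auto simp: pos_inv_ops_def invertible_op_def)
  from inv_op_eqI[OF this] S show "inv_op T \<in> bounded_ops" "T o\<^sub>L inv_op T = id_blinfun" "inv_op T o\<^sub>L T = id_blinfun"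
    by simp_all
qed

lemma inv_op_apply:
  assumes "T \<in> pos_inv_ops"
  shows "T (inv_op T x) = x" "inv_op T (T x) = x"
  using arg_cong[OF inv_op_props(2)[OF assms], of "\<lambda>F. blinfun_apply F x"]
    arg_cong[OF inv_op_props(3)[OF assms], of "\<lambda>F. blinfun_apply F x"] by simp_all

lemma inv_op_selfadj:
  assumes "T \<in> pos_inv_ops" shows "selfadj (inv_op T)"
proof -
  have "inner (inv_op T x) y = inner x (inv_op T y)" for x y
  proof -
    have "inner (inv_op T x) (T (inv_op T y)) = inner (T (inv_op T x)) (inv_op T y)"
      using selfadjD[OF pos_inv_selfadj[OF assms]] by simp
    then show ?thesis by (simp only: inv_op_apply[OF assms])
  qed
  then show ?thesis using inv_op_props(1)[OF assms] by (simp add: selfadj_def)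
qed

lemma inv_op_pos_inv:
  assumes T: "T \<in> pos_inv_ops" shows "inv_op T \<in> pos_inv_ops"
proof -
  have "0 \<le> inner (inv_op T x) x" for x
    using pos_opsD[OF pos_inv_pos[OF T], of "inv_op T x"] by (simp add: inv_op_apply[OF T] inner_commute)
  then have "inv_op T \<in> pos_ops" using inv_op_selfadj[OF T] by (simp add: pos_ops_iff)
  moreover have "invertible_op (inv_op T)"
    unfolding invertible_op_def
    using inv_op_props[OF T] selfadj_bounded[OF pos_inv_selfadj[OF T]] by blast
  ultimately show ?thesis by (simp add: pos_inv_ops_def)
qed

lemma inv_op_inv_op: "T \<in> pos_inv_ops \<Longrightarrow> inv_op (inv_op T) = T"
  by (intro inv_op_eqI inv_op_props pos_ops_bounded pos_inv_pos)

lemma inv_op_commute: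
  assumes T: "T \<in> pos_inv_ops" and L: "L o\<^sub>L T = T o\<^sub>L L"
  shows "L o\<^sub>L inv_op T = inv_op T o\<^sub>L L"
proof -
  have "inv_op T o\<^sub>L (L o\<^sub>L T) o\<^sub>L inv_op T = inv_op T o\<^sub>L (T o\<^sub>L L) o\<^sub>L inv_op T"
    by (simp add: L)
  then show ?thesis
    by (simp add: op_comp_assoc inv_op_props[OF T] op_left_cancel[OF inv_op_props(3)[OF T]])
qed

section \<open>The cone of invertible positive operators\<close>

lemma pos_inv_add: "S \<in> pos_inv_ops \<Longrightarrow> T \<in> pos_ops \<Longrightarrow> S + T \<in> pos_inv_ops"
proof -
  assume S: "S \<in> pos_inv_ops" and T: "T \<in> pos_ops"
  obtain e where "0 < e" "e *\<^sub>R id_blinfun \<preceq> S" using S by (auto simp: pos_inv_ops_iff)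
  moreover from this(2) T have "e *\<^sub>R id_blinfun + 0 \<preceq> S + T"
    by (intro loewner_add) (simp_all add: loewner_zero)
  ultimately show ?thesis
    using S T by (intro pos_inv_opsI[of _ e]) (auto simp: selfadj_add pos_ops_selfadj pos_inv_pos)
qed

lemma pos_inv_scaleR: "T \<in> pos_inv_ops \<Longrightarrow> 0 < r \<Longrightarrow> r *\<^sub>R T \<in> pos_inv_ops"
proof -
  assume T: "T \<in> pos_inv_ops" and r: "0 < r"
  obtain e where "0 < e" "e *\<^sub>R id_blinfun \<preceq> T" using T by (auto simp: pos_inv_ops_iff)
  then show ?thesis
    using r loewner_scaleR[of "e *\<^sub>R id_blinfun" T r] pos_inv_selfadj[OF T]
    by (intro pos_inv_opsI[of _ "r * e"]) (auto simp: selfadj_scaleR)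
qed

lemma pos_inv_mono: "S \<in> pos_inv_ops \<Longrightarrow> S \<preceq> T \<Longrightarrow> T \<in> pos_inv_ops"
  using pos_inv_add[of S "T - S"] by (simp add: loewner_le_def)

lemma pos_inv_id: "id_blinfun \<in> pos_inv_ops"
  by (rule pos_inv_opsI[of _ 1]) (simp_all add: selfadj_id)

lemma pos_inv_shift: "T \<in> pos_ops \<Longrightarrow> 0 < e \<Longrightarrow> T + e *\<^sub>R id_blinfun \<in> pos_inv_ops"
  using pos_inv_add[of "e *\<^sub>R id_blinfun" T] by (simp add: pos_inv_scaleR pos_inv_id add.commute)

lemma pos_inv_congr:
  assumes C: "C \<in> pos_inv_ops" and T: "T \<in> pos_inv_ops"
  shows "C o\<^sub>L T o\<^sub>L C \<in> pos_inv_ops" "inv_op (C o\<^sub>L T o\<^sub>L C) = inv_op C o\<^sub>L inv_op T o\<^sub>L inv_op C"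
proof -
  let ?S = "inv_op C o\<^sub>L inv_op T o\<^sub>L inv_op C"
  have *: "?S \<in> bounded_ops" "(C o\<^sub>L T o\<^sub>L C) o\<^sub>L ?S = id_blinfun" "?S o\<^sub>L (C o\<^sub>L T o\<^sub>L C) = id_blinfun"
    by (simp_all add: bounded_ops_comp inv_op_props C T op_comp_assoc
        op_left_cancel[OF inv_op_props(2)[OF C]] op_left_cancel[OF inv_op_props(3)[OF C]]
        op_left_cancel[OF inv_op_props(2)[OF T]] op_left_cancel[OF inv_op_props(3)[OF T]])
  then have "invertible_op (C o\<^sub>L T o\<^sub>L C)" unfolding invertible_op_def by blast
  then show "C o\<^sub>L T o\<^sub>L C \<in> pos_inv_ops"
    by (simp add: pos_inv_ops_def pos_ops_congr pos_inv_selfadj[OF C] pos_inv_pos[OF T])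
  show "inv_op (C o\<^sub>L T o\<^sub>L C) = ?S" by (rule inv_op_eqI[OF *])
qed

text \<open>The form of the inverse is the supremum over z of the left-hand side, attained at z =
  A^-1 u. Each of these lower bounds is affine in A and u, which is why antitonicity and joint
  convexity of the inverse follow by a suitable choice of z.\<close>

lemma inv_op_ge:
  assumes A: "A \<in> pos_inv_ops"
  shows "2 * inner u z - inner (A z) z \<le> inner (inv_op A u) u"
proof -
  have "0 \<le> inner (inv_op A (u - A z)) (u - A z)"
    by (intro pos_opsD pos_inv_pos inv_op_pos_inv A)
  also have "\<dots> = inner (inv_op A u) u - 2 * inner u z + inner (A z) z"
    using selfadjD[OF inv_op_selfadj[OF A], of u "A z"]
    by (simp add: op_apply inv_op_apply[OF A] inner_simps inner_commute)
  finally show ?thesis by simp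
qed

lemma inv_op_antimono:
  assumes A: "A \<in> pos_inv_ops" and AB: "A \<preceq> B"
  shows "inv_op B \<preceq> inv_op A"
proof -
  have B: "B \<in> pos_inv_ops" using A AB by (rule pos_inv_mono)
  have "inner (inv_op B u) u \<le> inner (inv_op A u) u" for u
    using inv_op_ge[OF A, of u "inv_op B u"] loewnerD[OF AB, of "inv_op B u"]
    by (simp add: inv_op_apply[OF B] inner_commute)
  then show ?thesis by (simp add: loewner_iff inv_op_selfadj A B)
qed

lemma congr_form: "selfadj C \<Longrightarrow> inner ((C o\<^sub>L T o\<^sub>L C) x) x = inner (T (C x)) (C x)"
  by (simp add: selfadjD[of C])

text \<open>For z = (A1 + A2)^-1 (u + v) the bounds of \<open>inv_op_ge\<close> for both summands
  use the same z, and their sum is exactly the form of the left-hand side.\<close>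

lemma inv_op_jointly_convex:
  assumes A: "A\<^sub>1 \<in> pos_inv_ops" "A\<^sub>2 \<in> pos_inv_ops" and M: "selfadj M\<^sub>1" "selfadj M\<^sub>2"
  shows "(M\<^sub>1 + M\<^sub>2) o\<^sub>L inv_op (A\<^sub>1 + A\<^sub>2) o\<^sub>L (M\<^sub>1 + M\<^sub>2)
    \<preceq> (M\<^sub>1 o\<^sub>L inv_op A\<^sub>1 o\<^sub>L M\<^sub>1) + (M\<^sub>2 o\<^sub>L inv_op A\<^sub>2 o\<^sub>L M\<^sub>2)"
proof -
  have B: "A\<^sub>1 + A\<^sub>2 \<in> pos_inv_ops" by (simp add: A pos_inv_add pos_inv_pos)
  have "inner (inv_op (A\<^sub>1 + A\<^sub>2) (u + v)) (u + v) \<le> inner (inv_op A\<^sub>1 u) u + inner (inv_op A\<^sub>2 v) v" for u v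
  proof -
    define z where "z = inv_op (A\<^sub>1 + A\<^sub>2) (u + v)"
    have "inner (A\<^sub>1 z) z + inner (A\<^sub>2 z) z = inner (u + v) z"
      using inv_op_apply(1)[OF B, of "u + v"]
      unfolding z_def[symmetric] by (simp add: blinfun.add_left flip: inner_add_left)
    then show ?thesis
      using inv_op_ge[OF A(1), of u z] inv_op_ge[OF A(2), of v z]
      by (simp add: z_def[symmetric] inner_commute[of z] inner_add_left)
  qed
  then have "inner (((M\<^sub>1 + M\<^sub>2) o\<^sub>L inv_op (A\<^sub>1 + A\<^sub>2) o\<^sub>L (M\<^sub>1 + M\<^sub>2)) x) x
      \<le> inner (((M\<^sub>1 o\<^sub>L inv_op A\<^sub>1 o\<^sub>L M\<^sub>1) + (M\<^sub>2 o\<^sub>L inv_op A\<^sub>2 o\<^sub>L M\<^sub>2)) x) x" for x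
    by (simp only: congr_form M selfadj_add blinfun.add_left inner_add_left)
  then show ?thesis
    using A B M by (simp only: loewner_iff selfadj_add selfadj_congr inv_op_selfadj simp_thms)
qed

text \<open>If \<open>d\<close> is the least number with \<open>D + d \<ge> 0\<close> and \<open>d > 0\<close>, the hypothesis bounds \<open>D + d\<close> below.\<close>

lemma lyapunov_pos:
  assumes S: "S \<in> pos_inv_ops" and D: "selfadj D" and SD: "(S o\<^sub>L D) + (D o\<^sub>L S) \<in> pos_ops"
  shows "D \<in> pos_ops"
proof -
  obtain e where e: "0 < e" "e *\<^sub>R id_blinfun \<preceq> S" using S by (auto simp: pos_inv_ops_iff)
  define \<Delta> where "\<Delta> = {r. 0 \<le> r \<and> D + r *\<^sub>R id_blinfun \<in> pos_ops}"
  have "norm D \<in> \<Delta>"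
    using loewner_norm[of "- D"] D by (simp add: \<Delta>_def loewner_le_def selfadj_minus add.commute)
  moreover have bdd: "bdd_below \<Delta>" by (auto simp: \<Delta>_def bdd_below_def)
  moreover have "closed \<Delta>"
  proof -
    have "\<Delta> = {0..} \<inter> (\<lambda>r. D + r *\<^sub>R id_blinfun) -` pos_ops" by (auto simp: \<Delta>_def)
    moreover have "closed ((\<lambda>r. D + r *\<^sub>R id_blinfun) -` pos_ops)"
      by (intro continuous_closed_vimage closed_pos_ops continuous_intros)
    ultimately show ?thesis by auto
  qed
  ultimately have d: "Inf \<Delta> \<in> \<Delta>" by (intro closed_contains_Inf) auto
  define d where "d = Inf \<Delta>"
  define F where "F = D + d *\<^sub>R id_blinfun"
  have F: "F \<in> pos_ops" "0 \<le> d" using d by (auto simp: \<Delta>_def F_def d_def)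
  have "d = 0"
  proof (rule ccontr)
    assume "d \<noteq> 0"
    then have "0 < d" using F by simp
    define N where "N = norm S + 1"
    define L where "L = norm F + 1"
    have N: "0 < N" "norm S \<le> N" and L: "0 < L" "norm F \<le> L"
      by (auto simp: N_def L_def intro: add_nonneg_pos)
    \<comment> \<open>The second entry is the lower bound for F derived below; the minimum with d
      keeps d - c nonnegative, as membership in \<Delta> demands.\<close>
    define c where "c = min d ((d * e / N)\<^sup>2 / L)"
    have c: "0 < c" "c \<le> d" "c \<le> (d * e / N)\<^sup>2 / L" using \<open>0 < d\<close> e N L by (auto simp: c_def)
    \<comment> \<open>In terms of F the hypothesis reads S F + F S \<ge> 2 d S \<ge> 2 d e. Hence |F
      x| is at least (d e / N) |x|, and \<open>pos_ops_norm_square\<close> turns this into a lower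
      bound for the form of F.\<close>
    have "c * (norm x)\<^sup>2 \<le> inner (F x) x" for x
    proof -
      have "0 \<le> inner (((S o\<^sub>L D) + (D o\<^sub>L S)) x) x" by (rule pos_opsD[OF SD])
      also have "\<dots> = 2 * inner (D x) (S x)"
        using selfadjD[OF pos_inv_selfadj[OF S], of "D x" x] selfadjD[OF D, of "S x" x]
        by (simp add: op_apply inner_simps inner_commute)
      also have "\<dots> = 2 * inner (F x) (S x) - 2 * d * inner (S x) x"
        by (simp add: F_def op_apply inner_simps inner_commute)
      finally have 1: "0 \<le> 2 * inner (F x) (S x) - 2 * d * inner (S x) x" .
      have 2: "inner (F x) (S x) \<le> norm (F x) * (N * norm x)"
      proof -
        have "inner (F x) (S x) \<le> norm (F x) * norm (S x)" by (rule norm_cauchy_schwarz)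
        also have "norm (S x) \<le> norm S * norm x" by (rule norm_blinfun)
        also have "\<dots> \<le> N * norm x" using N by (intro mult_right_mono) auto
        finally show ?thesis by (simp add: mult_left_mono)
      qed
      have "d * (e * (norm x)\<^sup>2) \<le> d * inner (S x) x"
        using e(2) \<open>0 < d\<close> by (simp add: loewner_scaleR_id' pos_inv_selfadj[OF S])
      with 1 2 have "d * e * (norm x)\<^sup>2 \<le> norm (F x) * (N * norm x)" by (simp add: algebra_simps)
      then have "norm x * (d * e * norm x) \<le> norm x * (N * norm (F x))"
        by (simp add: power2_eq_square mult_ac)
      then have "d * e / N * norm x \<le> norm (F x)"
        using N by (cases "x = 0") (auto simp: field_simps)
      then have "(d * e / N)\<^sup>2 * (norm x)\<^sup>2 \<le> (norm (F x))\<^sup>2"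
        using \<open>0 < d\<close> e N by (metis divide_nonneg_pos less_imp_le mult_nonneg_nonneg norm_ge_zero power_mono power_mult_distrib)
      also have "\<dots> \<le> norm F * inner (F x) x" by (rule pos_ops_norm_square[OF F(1)])
      also have "\<dots> \<le> L * inner (F x) x" using L pos_opsD[OF F(1)] by (intro mult_right_mono) auto
      finally have "(d * e / N)\<^sup>2 / L * (norm x)\<^sup>2 \<le> inner (F x) x" using L by (simp add: pos_divide_le_eq mult.commute[of L])
      moreover have "c * (norm x)\<^sup>2 \<le> (d * e / N)\<^sup>2 / L * (norm x)\<^sup>2"
        using c by (intro mult_right_mono) auto
      ultimately show ?thesis by linarith
    qed
    then have "c *\<^sub>R id_blinfun \<preceq> F" by (simp add: loewner_scaleR_id' pos_ops_selfadj[OF F(1)])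
    then have "d - c \<in> \<Delta>" using c by (simp add: \<Delta>_def loewner_le_def F_def algebra_simps)
    then have "d \<le> d - c" unfolding d_def by (intro cInf_lower bdd)
    then show False using c by simp
  qed
  then show ?thesis using F by (simp add: F_def)
qed

text \<open>With D = R - Z the identity R D + D R = R^2 - Z^2 + D^2 makes
  \<open>lyapunov_pos\<close> applicable; the shift by e makes R invertible. Z ranges over all
  self-adjoint operators because the geometric mean is to be maximal among these.\<close>

lemma selfadj_square_mono:
  assumes Z: "selfadj Z" and S: "S \<in> pos_ops" and ZS: "Z o\<^sub>L Z \<preceq> S o\<^sub>L S"
  shows "Z \<preceq> S"
proof (rule loewner_epsI)
  fix e :: real assume e: "0 < e"
  define R where "R = S + e *\<^sub>R id_blinfun"
  have R: "R \<in> pos_inv_ops" unfolding R_def by (rule pos_inv_shift[OF S e])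
  define D where "D = R - Z"
  have D: "selfadj D" by (simp add: D_def selfadj_diff Z pos_inv_selfadj[OF R])
  have "(R o\<^sub>L D) + (D o\<^sub>L R) = ((S o\<^sub>L S) - (Z o\<^sub>L Z)) + (2 * e) *\<^sub>R S + (e * e) *\<^sub>R id_blinfun + (D o\<^sub>L D)"
    by (simp add: D_def R_def op_algebra algebra_simps scaleR_2 flip: scaleR_scaleR)
  also have "\<dots> \<in> pos_ops"
    using ZS e S D by (intro pos_ops_add pos_ops_scaleR pos_ops_id pos_ops_square) (auto simp: loewner_le_def)
  finally have "D \<in> pos_ops" by (rule lyapunov_pos[OF R D])
  then show "Z \<preceq> S + e *\<^sub>R id_blinfun" by (simp add: D_def R_def loewner_le_def)
qed

text \<open>Hoelder continuity of the square root with exponent 1/2: S^2 \<le> R^2 + d^2 \<le> (R +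
  d)^2, and squares may be cancelled.\<close>

lemma norm_diff_le_of_squares:
  assumes S: "S \<in> pos_ops" and R: "R \<in> pos_ops" and d: "0 \<le> d"
    and n: "norm ((S o\<^sub>L S) - (R o\<^sub>L R)) \<le> d\<^sup>2"
  shows "norm (S - R) \<le> d"
proof -
  have le: "S \<preceq> R + d *\<^sub>R id_blinfun"
    if "S \<in> pos_ops" "R \<in> pos_ops" "norm ((S o\<^sub>L S) - (R o\<^sub>L R)) \<le> d\<^sup>2" for S R :: "'a \<Rightarrow>\<^sub>L 'a"
  proof (rule selfadj_square_mono)
    show "selfadj S" "R + d *\<^sub>R id_blinfun \<in> pos_ops"
      using that d by (auto simp: pos_ops_add pos_ops_scaleR pos_ops_id pos_ops_selfadj)
    have "(S o\<^sub>L S) - (R o\<^sub>L R) \<preceq> norm ((S o\<^sub>L S) - (R o\<^sub>L R)) *\<^sub>R id_blinfun"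
      using that by (intro loewner_norm selfadj_diff pos_ops_selfadj pos_ops_square)
    also have "\<dots> \<preceq> d\<^sup>2 *\<^sub>R id_blinfun" by (intro loewner_scaleR_mono pos_ops_id that)
    finally have "(S o\<^sub>L S) - (R o\<^sub>L R) + ((R o\<^sub>L R) + 0) \<preceq> d\<^sup>2 *\<^sub>R id_blinfun + ((R o\<^sub>L R) + (2 * d) *\<^sub>R R)"
      using that d by (intro loewner_add) (auto simp: loewner_zero pos_ops_scaleR)
    then show "S o\<^sub>L S \<preceq> (R + d *\<^sub>R id_blinfun) o\<^sub>L (R + d *\<^sub>R id_blinfun)"
      by (simp add: op_algebra algebra_simps power2_eq_square scaleR_2 flip: scaleR_scaleR)
  qed
  have "S \<preceq> R + d *\<^sub>R id_blinfun" "R \<preceq> S + d *\<^sub>R id_blinfun"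
    using le[OF S R n] le[OF R S] n by (simp_all add: norm_minus_commute)
  note * = this[THEN loewnerD]
  show ?thesis
  proof (rule norm_selfadj_le[OF _ _ d])
    show "selfadj (S - R)" using S R by (simp add: selfadj_diff pos_ops_selfadj)
    show "\<bar>inner ((S - R) x) x\<bar> \<le> d * (norm x)\<^sup>2" for x
      using *[of x] by (auto simp: op_apply inner_simps power2_norm_eq_inner abs_le_iff)
  qed
qed

section \<open>Existence and uniqueness of square roots\<close>

lemma closed_commutant: "closed {T :: 'a::real_normed_vector \<Rightarrow>\<^sub>L 'a. L o\<^sub>L T = T o\<^sub>L L}"
  by (intro closed_Collect_eq bounded_linear.continuous_on[OF op_comp.bounded_linear_right]
      bounded_linear.continuous_on[OF op_comp.bounded_linear_left] continuous_intros)

text \<open>Writing T / M = I - K and its root as I - Y turns the equation (I - Y)^2 = I - K into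
  the fixed point problem Y = (K + Y^2) / 2.\<close>

lemma sqrt_ex_pos_inv:
  fixes T :: "'h::complex_hilbert_space \<Rightarrow>\<^sub>L 'h"
  assumes T: "T \<in> pos_inv_ops"
  shows "\<exists>R\<in>pos_ops. R o\<^sub>L R = T \<and> (\<forall>L. L o\<^sub>L T = T o\<^sub>L L \<longrightarrow> L o\<^sub>L R = R o\<^sub>L L)"
proof -
  obtain e where e: "0 < e" "e *\<^sub>R id_blinfun \<preceq> T" using T by (auto simp: pos_inv_ops_iff)
  obtain M q where M: "0 < M" and q: "0 \<le> q" "q < 1" and n: "norm (id_blinfun - (1 / M) *\<^sub>R T) \<le> q"
    by (rule bounded_below_contraction[OF pos_inv_selfadj[OF T] e])
  define K where "K = id_blinfun - (1 / M) *\<^sub>R T"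
  \<comment> \<open>The smaller solution of r = (q + r^2) / 2: the map then sends the ball of radius
    r into itself, and r < 1 is also its Lipschitz constant there.\<close>
  define r where "r = 1 - sqrt (1 - q)"
  have r: "0 \<le> r" "r < 1" using q by (auto simp: r_def)
  have "(1 - r)\<^sup>2 = 1 - q" using q by (simp add: r_def)
  then have r2: "(q + r\<^sup>2) / 2 = r" by (simp add: power2_eq_square algebra_simps)
  define \<Phi> where "\<Phi> Y = (1/2) *\<^sub>R (K + (Y o\<^sub>L Y))" for Y
  \<comment> \<open>The bicommutant of T. It is closed and invariant under the iteration, so
    searching the fixed point inside it makes the root commute with whatever commutes with
    T.\<close>
  define C where "C = (\<Inter>L\<in>{L. L o\<^sub>L T = T o\<^sub>L L}. {Y. L o\<^sub>L Y = Y o\<^sub>L L})"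
  define X where "X = {Y. selfadj Y} \<inter> cball 0 r \<inter> C"
  have X0: "0 \<in> X" using r by (auto simp: X_def C_def selfadj_zero)
  have "\<exists>!Y\<in>X. \<Phi> Y = Y"
  proof (rule Banach_fix[OF _ _ r])
    have "closed X" unfolding X_def C_def
      by (intro closed_Int closed_selfadj closed_cball closed_INT ballI closed_commutant)
    then show "complete X" by (simp add: complete_eq_closed)
    show "X \<noteq> {}" using X0 by blast
    have "\<Phi> Y \<in> X" if "Y \<in> X" for Y
    proof -
      have Y: "selfadj Y" "norm Y \<le> r" "\<And>L. L o\<^sub>L T = T o\<^sub>L L \<Longrightarrow> L o\<^sub>L Y = Y o\<^sub>L L"
        using that by (auto simp: X_def C_def)
      have "norm (K + (Y o\<^sub>L Y)) \<le> norm K + norm (Y o\<^sub>L Y)" by (rule norm_triangle_ineq)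
      also have "norm (Y o\<^sub>L Y) \<le> norm Y * norm Y" by (rule norm_blinfun_compose)
      also have "\<dots> \<le> r * r" using Y r by (intro mult_mono) auto
      finally have "norm (K + (Y o\<^sub>L Y)) \<le> q + r\<^sup>2" using n by (simp add: K_def power2_eq_square)
      then have "norm (\<Phi> Y) \<le> r" using r2 by (simp add: \<Phi>_def)
      moreover have "selfadj (\<Phi> Y)" using Y(1) pos_inv_selfadj[OF T]
        by (auto simp: \<Phi>_def K_def intro!: selfadj_scaleR selfadj_add selfadj_diff selfadj_id selfadj_comp)
      moreover have "L o\<^sub>L \<Phi> Y = \<Phi> Y o\<^sub>L L" if "L o\<^sub>L T = T o\<^sub>L L" for L
        unfolding \<Phi>_def K_def by (intro comm_intros that Y(3)[OF that])
      ultimately show ?thesis by (auto simp: X_def C_def)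
    qed
    then show "\<Phi> ` X \<subseteq> X" by blast
    show "dist (\<Phi> Y) (\<Phi> Z) \<le> r * dist Y Z" if "Y \<in> X" "Z \<in> X" for Y Z :: "'h \<Rightarrow>\<^sub>L 'h"
    proof -
      have YZ: "norm Y \<le> r" "norm (Z :: 'h \<Rightarrow>\<^sub>L 'h) \<le> r" using that by (auto simp: X_def)
      have "norm ((Y o\<^sub>L (Y - Z)) + ((Y - Z) o\<^sub>L Z)) \<le> norm (Y o\<^sub>L (Y - Z)) + norm ((Y - Z) o\<^sub>L Z)"
        by (rule norm_triangle_ineq)
      also have "\<dots> \<le> norm Y * norm (Y - Z) + norm (Y - Z) * norm Z"
        by (intro add_mono norm_blinfun_compose)
      also have "\<dots> \<le> r * norm (Y - Z) + norm (Y - Z) * r"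
        using YZ by (intro add_mono mult_right_mono mult_left_mono) auto
      finally have "norm ((Y o\<^sub>L Y) - (Z o\<^sub>L Z)) \<le> 2 * (r * norm (Y - Z))"
        by (simp add: op_algebra)
      moreover have "\<Phi> Y - \<Phi> Z = (1/2) *\<^sub>R ((Y o\<^sub>L Y) - (Z o\<^sub>L Z))"
        by (simp add: \<Phi>_def algebra_simps)
      ultimately show ?thesis by (simp add: dist_norm)
    qed
  qed
  then obtain Y where "Y \<in> X" and fixp: "\<Phi> Y = Y" by blast
  then have Y: "selfadj Y" "norm Y \<le> r" "\<And>L. L o\<^sub>L T = T o\<^sub>L L \<Longrightarrow> L o\<^sub>L Y = Y o\<^sub>L L"
    by (auto simp: X_def C_def)
  define R where "R = sqrt M *\<^sub>R (id_blinfun - Y)"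
  have "2 *\<^sub>R \<Phi> Y = 2 *\<^sub>R Y" by (simp only: fixp)
  then have KY: "K + (Y o\<^sub>L Y) = 2 *\<^sub>R Y" by (simp add: \<Phi>_def)
  then have YY: "Y o\<^sub>L Y = 2 *\<^sub>R Y - K" by (simp add: algebra_simps)
  have "R o\<^sub>L R = M *\<^sub>R (id_blinfun - 2 *\<^sub>R Y + (Y o\<^sub>L Y))"
    using M by (simp add: R_def op_algebra algebra_simps scaleR_2)
  also have "\<dots> = T" using M by (simp add: YY K_def)
  finally have "R o\<^sub>L R = T" .
  moreover have "R \<in> pos_ops"
  proof -
    have "Y \<preceq> norm Y *\<^sub>R id_blinfun" by (rule loewner_norm[OF Y(1)])
    also have "\<dots> \<preceq> 1 *\<^sub>R id_blinfun" using Y(2) r by (intro loewner_scaleR_mono pos_ops_id) simp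
    finally show ?thesis using M by (simp add: R_def pos_ops_scaleR loewner_le_def)
  qed
  moreover have "L o\<^sub>L R = R o\<^sub>L L" if "L o\<^sub>L T = T o\<^sub>L L" for L
    using Y(3)[OF that] by (simp add: R_def op_algebra)
  ultimately show ?thesis by blast
qed

text \<open>The roots of T + 1/(n+1) form a Cauchy sequence by
  \<open>norm_diff_le_of_squares\<close>; the square and the commutation pass to the limit.\<close>

lemma sqrt_ex:
  fixes T :: "'h::complex_hilbert_space \<Rightarrow>\<^sub>L 'h"
  assumes T: "T \<in> pos_ops"
  shows "\<exists>R\<in>pos_ops. R o\<^sub>L R = T \<and> (\<forall>L. L o\<^sub>L T = T o\<^sub>L L \<longrightarrow> L o\<^sub>L R = R o\<^sub>L L)"
proof -
  define E where "E n = T + (1 / real (Suc n)) *\<^sub>R id_blinfun" for n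
  have "\<exists>R\<in>pos_ops. R o\<^sub>L R = E n \<and> (\<forall>L. L o\<^sub>L E n = E n o\<^sub>L L \<longrightarrow> L o\<^sub>L R = R o\<^sub>L L)" for n
    unfolding E_def by (intro sqrt_ex_pos_inv pos_inv_shift T) simp
  then have "\<forall>n. \<exists>R. R \<in> pos_ops \<and> R o\<^sub>L R = E n \<and> (\<forall>L. L o\<^sub>L E n = E n o\<^sub>L L \<longrightarrow> L o\<^sub>L R = R o\<^sub>L L)"
    by blast
  from choice[OF this] obtain R where
    R': "\<forall>n. R n \<in> pos_ops \<and> R n o\<^sub>L R n = E n \<and> (\<forall>L. L o\<^sub>L E n = E n o\<^sub>L L \<longrightarrow> L o\<^sub>L R n = R n o\<^sub>L L)" ..
  then have R: "\<And>n. R n \<in> pos_ops" "\<And>n. R n o\<^sub>L R n = E n"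
    and RL: "\<And>n L. L o\<^sub>L E n = E n o\<^sub>L L \<Longrightarrow> L o\<^sub>L R n = R n o\<^sub>L L" by simp_all
  have E: "E \<longlonglongrightarrow> T + 0 *\<^sub>R id_blinfun"
    unfolding E_def by (intro tendsto_intros LIMSEQ_Suc lim_1_over_n)
  have "Cauchy R"
  proof (rule CauchyI)
    fix e :: real assume e: "0 < e"
    then have "0 < (e/2)\<^sup>2" by simp
    from CauchyD[OF LIMSEQ_imp_Cauchy[OF E] this]
    obtain N where N: "\<forall>m\<ge>N. \<forall>n\<ge>N. norm (E m - E n) < (e/2)\<^sup>2" ..
    have "norm (R m - R n) < e" if "m \<ge> N" "n \<ge> N" for m n
    proof -
      have "norm (R m - R n) \<le> e / 2"
        by (rule norm_diff_le_of_squares[OF R(1) R(1)]) (use e N that in \<open>simp_all add: R(2) less_imp_le\<close>)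
      then show ?thesis using e by simp
    qed
    then show "\<exists>N. \<forall>m\<ge>N. \<forall>n\<ge>N. norm (R m - R n) < e" by blast
  qed
  then obtain S where S: "R \<longlonglongrightarrow> S" using Cauchy_convergent convergent_def by blast
  have "S \<in> pos_ops" by (rule closed_sequentially[OF closed_pos_ops R(1) S])
  moreover have "S o\<^sub>L S = T"
  proof (rule LIMSEQ_unique)
    show "(\<lambda>n. R n o\<^sub>L R n) \<longlonglongrightarrow> (S o\<^sub>L S)"
      by (rule op_comp.tendsto[OF S S])
    show "(\<lambda>n. R n o\<^sub>L R n) \<longlonglongrightarrow> T" using E by (simp add: R(2))
  qed
  moreover have "L o\<^sub>L S = S o\<^sub>L L" if "L o\<^sub>L T = T o\<^sub>L L" for L
    using closed_sequentially[OF closed_commutant _ S, of L] RL[of L] that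
    by (simp add: E_def op_algebra)
  ultimately show ?thesis by blast
qed

lemma sqrt_op_eqI:
  assumes "S \<in> pos_ops" "S o\<^sub>L S = T"
  shows "sqrt_op T = S"
  unfolding sqrt_op_def
proof (rule the_equality)
  fix R assume R: "R \<in> pos_ops \<and> R o\<^sub>L R = T"
  then have eq: "R o\<^sub>L R = S o\<^sub>L S" using assms by simp
  show "R = S"
  proof (rule loewner_antisym)
    show "R \<preceq> S" by (rule selfadj_square_mono) (use R assms(1) in \<open>simp_all add: pos_ops_selfadj eq\<close>)
    show "S \<preceq> R" by (rule selfadj_square_mono) (use R assms(1) in \<open>simp_all add: pos_ops_selfadj eq\<close>)
  qed
qed (use assms in simp)

lemma sqrt_op_props:
  assumes "T \<in> pos_ops"
  shows "sqrt_op T \<in> pos_ops" "sqrt_op T o\<^sub>L sqrt_op T = T"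
    "L o\<^sub>L T = T o\<^sub>L L \<Longrightarrow> L o\<^sub>L sqrt_op T = sqrt_op T o\<^sub>L L"
proof -
  from sqrt_ex[OF assms] obtain R where R: "R \<in> pos_ops" "R o\<^sub>L R = T"
    and RL: "\<forall>L. L o\<^sub>L T = T o\<^sub>L L \<longrightarrow> L o\<^sub>L R = R o\<^sub>L L" by (elim bexE conjE)
  have eq: "sqrt_op T = R" by (rule sqrt_op_eqI[OF R])
  show "sqrt_op T \<in> pos_ops" "sqrt_op T o\<^sub>L sqrt_op T = T" by (simp_all add: eq R)
  show "L o\<^sub>L T = T o\<^sub>L L \<Longrightarrow> L o\<^sub>L sqrt_op T = sqrt_op T o\<^sub>L L" unfolding eq by (rule RL[rule_format])
qed

lemma sqrt_op_pos_inv: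
  assumes T: "T \<in> pos_inv_ops" shows "sqrt_op T \<in> pos_inv_ops"
proof -
  let ?R = "sqrt_op T" let ?S = "inv_op T o\<^sub>L ?R"
  note R = sqrt_op_props[OF pos_inv_pos[OF T]]
  have c: "?R o\<^sub>L inv_op T = inv_op T o\<^sub>L ?R"
    by (rule inv_op_commute[OF T R(3)[OF refl, symmetric]])
  have "?S \<in> bounded_ops" "?R o\<^sub>L ?S = id_blinfun" "?S o\<^sub>L ?R = id_blinfun"
    using op_left_commute[OF c] by (simp_all add: R op_left_cancel[OF R(2)] bounded_ops_comp inv_op_props T pos_ops_bounded op_comp_assoc)
  then show ?thesis using R(1) by (auto simp: pos_inv_ops_def invertible_op_def)
qed

text \<open>If R is the root of A, it commutes with B, and the product is the congruence
  \<open>R o\<^sub>L B o\<^sub>L R\<close>.\<close>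

lemma pos_ops_comp:
  assumes A: "A \<in> pos_ops" and B: "B \<in> pos_ops" and AB: "A o\<^sub>L B = B o\<^sub>L A"
  shows "A o\<^sub>L B \<in> pos_ops"
proof -
  let ?R = "sqrt_op A"
  note R = sqrt_op_props[OF A]
  have c: "B o\<^sub>L ?R = ?R o\<^sub>L B" by (rule R(3)) (simp add: AB)
  have "?R o\<^sub>L B o\<^sub>L ?R = A o\<^sub>L B" by (simp add: op_comp_assoc c op_left_cancel[OF R(2)])
  then show ?thesis using pos_ops_congr[OF pos_ops_selfadj[OF R(1)] B] by simp
qed

subsection \<open>The geometric mean\<close>

lemma inv_op_id: "inv_op id_blinfun = id_blinfun"
  by (rule inv_op_eqI) (simp_all add: bounded_ops_id)

lemma inv_op_sqrt:
  assumes "A \<in> pos_inv_ops"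
  shows "inv_op A = inv_op (sqrt_op A) o\<^sub>L inv_op (sqrt_op A)"
proof -
  note R = sqrt_op_pos_inv[OF assms]
  show ?thesis
    using pos_inv_congr(2)[OF R pos_inv_id] sqrt_op_props(2)[OF pos_inv_pos[OF assms]] by (simp add: inv_op_id)
qed

lemma congr_cancel:
  assumes "R \<in> pos_inv_ops"
  shows "R o\<^sub>L (inv_op R o\<^sub>L T o\<^sub>L inv_op R) o\<^sub>L R = T" "inv_op R o\<^sub>L (R o\<^sub>L T o\<^sub>L R) o\<^sub>L inv_op R = T"
  by (simp_all add: op_comp_assoc inv_op_props[OF assms] op_left_cancel[OF inv_op_props(2)[OF assms]]
      op_left_cancel[OF inv_op_props(3)[OF assms]])

text \<open>Congruence with the inverse root of A turns the Riccati equation X A^-1 X = B into an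
  equation Z^2 = W with Z positive, where uniqueness of the root applies.\<close>

lemma geometric_mean_eqI:
  assumes A: "A \<in> pos_inv_ops" and X: "X \<in> pos_ops" and XB: "X o\<^sub>L inv_op A o\<^sub>L X = B"
  shows "A \<sharp> B = X"
proof -
  let ?R = "sqrt_op A"
  note R = sqrt_op_pos_inv[OF A]
  let ?Z = "inv_op ?R o\<^sub>L X o\<^sub>L inv_op ?R"
  have "?Z \<in> pos_ops" by (intro pos_ops_congr inv_op_selfadj R X)
  moreover have "?Z o\<^sub>L ?Z = inv_op ?R o\<^sub>L B o\<^sub>L inv_op ?R"
    by (simp add: XB[symmetric] inv_op_sqrt[OF A] op_comp_assoc)
  ultimately have "sqrt_op (inv_op ?R o\<^sub>L B o\<^sub>L inv_op ?R) = ?Z" by (rule sqrt_op_eqI)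
  then show ?thesis by (simp add: geometric_mean_def congr_cancel[OF R])
qed

lemma geometric_mean_props:
  assumes A: "A \<in> pos_inv_ops" and B: "B \<in> pos_inv_ops"
  shows "A \<sharp> B \<in> pos_inv_ops" "(A \<sharp> B) o\<^sub>L inv_op A o\<^sub>L (A \<sharp> B) = B"
proof -
  let ?R = "sqrt_op A" let ?W = "inv_op ?R o\<^sub>L B o\<^sub>L inv_op ?R"
  note R = sqrt_op_pos_inv[OF A]
  have W: "?W \<in> pos_inv_ops" by (intro pos_inv_congr inv_op_pos_inv R B)
  show "A \<sharp> B \<in> pos_inv_ops"
    unfolding geometric_mean_def by (intro pos_inv_congr sqrt_op_pos_inv W A)
  have "(A \<sharp> B) o\<^sub>L inv_op A o\<^sub>L (A \<sharp> B) = ?R o\<^sub>L (sqrt_op ?W o\<^sub>L sqrt_op ?W) o\<^sub>L ?R"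
    by (simp add: geometric_mean_def inv_op_sqrt[OF A] op_comp_assoc
        op_left_cancel[OF inv_op_props(2)[OF R]] op_left_cancel[OF inv_op_props(3)[OF R]])
  also have "\<dots> = B" by (simp only: sqrt_op_props(2)[OF pos_inv_pos[OF W]] congr_cancel[OF R])
  finally show "(A \<sharp> B) o\<^sub>L inv_op A o\<^sub>L (A \<sharp> B) = B" .
qed

lemma geometric_mean_maximal:
  assumes A: "A \<in> pos_inv_ops" and B: "B \<in> pos_inv_ops" and X: "selfadj X"
    and XB: "X o\<^sub>L inv_op A o\<^sub>L X \<preceq> B"
  shows "X \<preceq> A \<sharp> B"
proof -
  let ?R = "sqrt_op A" let ?W = "inv_op ?R o\<^sub>L B o\<^sub>L inv_op ?R"
  note R = sqrt_op_pos_inv[OF A]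
  let ?Z = "inv_op ?R o\<^sub>L X o\<^sub>L inv_op ?R"
  have W: "?W \<in> pos_inv_ops" by (intro pos_inv_congr inv_op_pos_inv R B)
  have Z: "selfadj ?Z" by (intro selfadj_congr inv_op_selfadj R X)
  have "?Z o\<^sub>L ?Z = inv_op ?R o\<^sub>L (X o\<^sub>L inv_op A o\<^sub>L X) o\<^sub>L inv_op ?R"
    by (simp add: inv_op_sqrt[OF A] op_comp_assoc)
  also have "\<dots> \<preceq> ?W" by (intro loewner_congr XB inv_op_selfadj R)
  finally have "?Z o\<^sub>L ?Z \<preceq> sqrt_op ?W o\<^sub>L sqrt_op ?W"
    by (simp only: sqrt_op_props(2)[OF pos_inv_pos[OF W]])
  then have "?Z \<preceq> sqrt_op ?W" by (rule selfadj_square_mono[OF Z sqrt_op_props(1)[OF pos_inv_pos[OF W]]])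
  then have "?R o\<^sub>L ?Z o\<^sub>L ?R \<preceq> ?R o\<^sub>L sqrt_op ?W o\<^sub>L ?R"
    by (intro loewner_congr pos_inv_selfadj R)
  then show ?thesis by (simp only: congr_cancel[OF R] geometric_mean_def)
qed

text \<open>\<open>A \<sharp> B\<close> competes in the maximum that characterizes
  \<open>A' \<sharp> B'\<close>, since A'^-1 \<le> A^-1.\<close>

lemma geometric_mean_mono:
  assumes A: "A \<in> pos_inv_ops" and B: "B \<in> pos_inv_ops" and le: "A \<preceq> A'" "B \<preceq> B'"
  shows "A \<sharp> B \<preceq> A' \<sharp> B'"
proof (rule geometric_mean_maximal)
  note G = geometric_mean_props[OF A B]
  show "A' \<in> pos_inv_ops" "B' \<in> pos_inv_ops" using A B le pos_inv_mono by auto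
  show "selfadj (A \<sharp> B)" by (rule pos_inv_selfadj[OF G(1)])
  have "(A \<sharp> B) o\<^sub>L inv_op A' o\<^sub>L (A \<sharp> B) \<preceq> (A \<sharp> B) o\<^sub>L inv_op A o\<^sub>L (A \<sharp> B)"
    by (intro loewner_congr inv_op_antimono A le pos_inv_selfadj[OF G(1)])
  then show "(A \<sharp> B) o\<^sub>L inv_op A' o\<^sub>L (A \<sharp> B) \<preceq> B'"
    unfolding G(2) using le(2) by (rule loewner_trans)
qed

subsection \<open>Superadditive operations\<close>

definition superadditive :: "'h::complex_hilbert_space binop \<Rightarrow> bool" where
  "superadditive \<phi> \<longleftrightarrow> (\<forall>A\<in>pos_inv_ops. \<forall>B\<in>pos_inv_ops. \<forall>C\<in>pos_inv_ops. \<forall>D\<in>pos_inv_ops.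
     \<phi> A B + \<phi> C D \<preceq> \<phi> (A + C) (B + D))"

lemma superadditiveD:
  "superadditive \<phi> \<Longrightarrow> A \<in> pos_inv_ops \<Longrightarrow> B \<in> pos_inv_ops \<Longrightarrow> C \<in> pos_inv_ops \<Longrightarrow> D \<in> pos_inv_ops
    \<Longrightarrow> \<phi> A B + \<phi> C D \<preceq> \<phi> (A + C) (B + D)"
  by (simp add: superadditive_def)

lemma pos_inv_sum:
  assumes "finite J" "J \<noteq> {}" "\<And>j. j \<in> J \<Longrightarrow> A j \<in> pos_inv_ops"
  shows "sum A J \<in> pos_inv_ops"
  using assms by (induction J rule: finite_ne_induct) (auto intro: pos_inv_add pos_inv_pos)

lemma superadditive_sum:
  assumes \<phi>: "superadditive \<phi>" and J: "finite J" "J \<noteq> {}"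
    and AB: "\<And>j. j \<in> J \<Longrightarrow> A j \<in> pos_inv_ops" "\<And>j. j \<in> J \<Longrightarrow> B j \<in> pos_inv_ops"
  shows "(\<Sum>j\<in>J. \<phi> (A j) (B j)) \<preceq> \<phi> (sum A J) (sum B J)"
  using J AB
proof (induction J rule: finite_ne_induct)
  case (insert j J)
  have "\<phi> (A j) (B j) + (\<Sum>j\<in>J. \<phi> (A j) (B j)) \<preceq> \<phi> (A j) (B j) + \<phi> (sum A J) (sum B J)"
    using insert by (intro loewner_add) auto
  also have "\<dots> \<preceq> \<phi> (A j + sum A J) (B j + sum B J)"
    using insert by (intro superadditiveD[OF \<phi>] pos_inv_sum) auto
  finally show ?case using insert by simp
qed simp

lemma superadditive_geometric_mean: "superadditive (\<sharp>)"
  unfolding superadditive_def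
proof (intro ballI)
  fix A B C D :: "'a \<Rightarrow>\<^sub>L 'a"
  assume A: "A \<in> pos_inv_ops" and B: "B \<in> pos_inv_ops" and C: "C \<in> pos_inv_ops" and D: "D \<in> pos_inv_ops"
  note G = geometric_mean_props[OF A B] and H = geometric_mean_props[OF C D]
  note s = pos_inv_selfadj[OF G(1)] pos_inv_selfadj[OF H(1)]
  show "A \<sharp> B + C \<sharp> D \<preceq> (A + C) \<sharp> (B + D)"
  proof (rule geometric_mean_maximal)
    show "A + C \<in> pos_inv_ops" "B + D \<in> pos_inv_ops"
      by (simp_all add: A B C D pos_inv_add pos_inv_pos)
    show "selfadj (A \<sharp> B + C \<sharp> D)" by (intro selfadj_add s)
    show "(A \<sharp> B + C \<sharp> D) o\<^sub>L inv_op (A + C) o\<^sub>L (A \<sharp> B + C \<sharp> D) \<preceq> B + D"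
      using inv_op_jointly_convex[OF A C s] by (simp only: G(2) H(2))
  qed
qed

subsection \<open>Weighted harmonic means\<close>

definition harmonic_mean :: "real \<Rightarrow> 'h::complex_hilbert_space binop" where
  "harmonic_mean s A B = inv_op ((1 - s) *\<^sub>R inv_op A + s *\<^sub>R inv_op B)"

text \<open>The representing function of \<open>harmonic_mean s\<close>, equal to 1 for s = 0 and to
  t for s = 1. In Loewner's theorem the representing functions of means are the averages of these
  over s.\<close>

definition harmonic_fun :: "real \<Rightarrow> real \<Rightarrow> real" where
  "harmonic_fun s t = 1 / ((1 - s) + s / t)"

lemma pos_inv_convex:
  assumes "A \<in> pos_inv_ops" "B \<in> pos_inv_ops" "0 \<le> s" "s \<le> 1"
  shows "(1 - s) *\<^sub>R A + s *\<^sub>R B \<in> pos_inv_ops"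
proof (cases "s = 1")
  case False
  then show ?thesis using assms by (intro pos_inv_add pos_inv_scaleR pos_ops_scaleR pos_inv_pos) auto
qed (use assms in simp)

lemma harmonic_mean_props:
  assumes "A \<in> pos_inv_ops" "B \<in> pos_inv_ops" "0 \<le> s" "s \<le> 1"
  shows "harmonic_mean s A B \<in> pos_inv_ops"
    "inv_op (harmonic_mean s A B) = (1 - s) *\<^sub>R inv_op A + s *\<^sub>R inv_op B"
  unfolding harmonic_mean_def
  by (intro inv_op_pos_inv inv_op_inv_op pos_inv_convex assms)+

text \<open>Let M be the sum of the means and N the mean of the sums. Joint convexity, averaged over
  both arguments, gives M N^-1 M \<le> M1 M1^-1 M1 + M2 M2^-1 M2 = M; cancelling M leaves N^-1 \<le>
  M^-1.\<close>

lemma superadditive_harmonic_mean: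
  assumes s: "0 \<le> s" "s \<le> 1"
  shows "superadditive (harmonic_mean s)"
  unfolding superadditive_def
proof (intro ballI)
  fix A B C D :: "'a \<Rightarrow>\<^sub>L 'a"
  assume A: "A \<in> pos_inv_ops" and B: "B \<in> pos_inv_ops" and C: "C \<in> pos_inv_ops" and D: "D \<in> pos_inv_ops"
  let ?M1 = "harmonic_mean s A B" let ?M2 = "harmonic_mean s C D"
  let ?M = "?M1 + ?M2" let ?N = "harmonic_mean s (A + C) (B + D)"
  note M1 = harmonic_mean_props[OF A B s] and M2 = harmonic_mean_props[OF C D s]
  have AC: "A + C \<in> pos_inv_ops" and BD: "B + D \<in> pos_inv_ops"
    by (simp_all add: A B C D pos_inv_add pos_inv_pos)
  note N = harmonic_mean_props[OF AC BD s]
  have M: "?M \<in> pos_inv_ops" using M1 M2 by (simp add: pos_inv_add pos_inv_pos)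
  note sa = pos_inv_selfadj[OF M1(1)] pos_inv_selfadj[OF M2(1)]
  have "(1 - s) *\<^sub>R (?M o\<^sub>L inv_op (A + C) o\<^sub>L ?M) + s *\<^sub>R (?M o\<^sub>L inv_op (B + D) o\<^sub>L ?M)
    \<preceq> (1 - s) *\<^sub>R ((?M1 o\<^sub>L inv_op A o\<^sub>L ?M1) + (?M2 o\<^sub>L inv_op C o\<^sub>L ?M2))
      + s *\<^sub>R ((?M1 o\<^sub>L inv_op B o\<^sub>L ?M1) + (?M2 o\<^sub>L inv_op D o\<^sub>L ?M2))"
    using s by (intro loewner_add loewner_scaleR inv_op_jointly_convex A B C D sa) auto
  also have "\<dots> = (?M1 o\<^sub>L inv_op ?M1 o\<^sub>L ?M1) + (?M2 o\<^sub>L inv_op ?M2 o\<^sub>L ?M2)"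
    unfolding M1(2) M2(2) by (simp add: op_comp_bilinear scaleR_add_right)
  also have "\<dots> = ?M" by (simp add: inv_op_props M1(1) M2(1))
  also have "(1 - s) *\<^sub>R (?M o\<^sub>L inv_op (A + C) o\<^sub>L ?M) + s *\<^sub>R (?M o\<^sub>L inv_op (B + D) o\<^sub>L ?M) = ?M o\<^sub>L inv_op ?N o\<^sub>L ?M"
    unfolding N(2) by (simp add: op_comp_bilinear scaleR_add_right)
  finally have "?M o\<^sub>L inv_op ?N o\<^sub>L ?M \<preceq> ?M o\<^sub>L inv_op ?M o\<^sub>L ?M"
    by (simp add: inv_op_props M)
  then have "inv_op ?M o\<^sub>L (?M o\<^sub>L inv_op ?N o\<^sub>L ?M) o\<^sub>L inv_op ?M
      \<preceq> inv_op ?M o\<^sub>L (?M o\<^sub>L inv_op ?M o\<^sub>L ?M) o\<^sub>L inv_op ?M"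
    by (rule loewner_congr[OF _ inv_op_selfadj[OF M]])
  then have "inv_op ?N \<preceq> inv_op ?M" by (simp only: congr_cancel[OF M])
  then have "inv_op (inv_op ?M) \<preceq> inv_op (inv_op ?N)" by (rule inv_op_antimono[OF inv_op_pos_inv[OF N(1)]])
  then show "?M \<preceq> ?N" by (simp only: inv_op_inv_op M N(1))
qed

lemma harmonic_mean_congr:
  assumes A: "A \<in> pos_inv_ops" and B: "B \<in> pos_inv_ops" and s: "0 \<le> s" "s \<le> 1"
  defines "R \<equiv> sqrt_op A"
  shows "R o\<^sub>L harmonic_mean s id_blinfun (inv_op R o\<^sub>L B o\<^sub>L inv_op R) o\<^sub>L R = harmonic_mean s A B"
proof -
  note R = sqrt_op_pos_inv[OF A, folded R_def]
  let ?W = "inv_op R o\<^sub>L B o\<^sub>L inv_op R"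
  let ?T = "(1 - s) *\<^sub>R id_blinfun + s *\<^sub>R inv_op ?W"
  have W: "?W \<in> pos_inv_ops" by (intro pos_inv_congr inv_op_pos_inv R B)
  have T: "?T \<in> pos_inv_ops" by (intro pos_inv_convex pos_inv_id inv_op_pos_inv W s)
  have "inv_op ?W = R o\<^sub>L inv_op B o\<^sub>L R"
    using pos_inv_congr(2)[OF inv_op_pos_inv[OF R] B] by (simp add: inv_op_inv_op[OF R])
  then have "inv_op R o\<^sub>L ?T o\<^sub>L inv_op R = (1 - s) *\<^sub>R inv_op A + s *\<^sub>R inv_op B"
    using congr_cancel(2)[OF R, of "inv_op B"] by (simp add: op_comp_bilinear inv_op_sqrt[OF A] R_def)
  then have "harmonic_mean s A B = inv_op (inv_op R o\<^sub>L ?T o\<^sub>L inv_op R)"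
    by (simp only: harmonic_mean_def)
  also have "\<dots> = R o\<^sub>L inv_op ?T o\<^sub>L R"
    using pos_inv_congr(2)[OF inv_op_pos_inv[OF R] T] by (simp only: inv_op_inv_op[OF R])
  finally show ?thesis by (simp only: harmonic_mean_def inv_op_id)
qed

text \<open>E stands in for a spectral projection: the hypothesis compares X with t only where E
  lives. Such a comparison may be multiplied by the positive operator X^-1 because everything
  commutes.\<close>

lemma inv_op_local:
  assumes E: "E \<in> pos_ops" and X: "X \<in> pos_inv_ops" and c: "E o\<^sub>L X = X o\<^sub>L E" and t: "0 < t"
  shows "t *\<^sub>R E \<preceq> E o\<^sub>L X \<Longrightarrow> E o\<^sub>L inv_op X \<preceq> (1 / t) *\<^sub>R E"
    and "E o\<^sub>L X \<preceq> t *\<^sub>R E \<Longrightarrow> (1 / t) *\<^sub>R E \<preceq> E o\<^sub>L inv_op X"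
proof -
  have c': "E o\<^sub>L inv_op X = inv_op X o\<^sub>L E" by (rule inv_op_commute[OF X c])
  have cX: "(E o\<^sub>L X) o\<^sub>L inv_op X = inv_op X o\<^sub>L (E o\<^sub>L X)"
    by (metis op_comp_assoc c c' inv_op_props(2,3)[OF X] op_comp_id)
  have X': "inv_op X \<in> pos_ops" by (intro pos_inv_pos inv_op_pos_inv X)
  have EX: "(E o\<^sub>L X) o\<^sub>L inv_op X = E" by (simp add: op_comp_assoc inv_op_props[OF X])
  show "E o\<^sub>L inv_op X \<preceq> (1 / t) *\<^sub>R E" if "t *\<^sub>R E \<preceq> E o\<^sub>L X"
  proof -
    have "((E o\<^sub>L X) - t *\<^sub>R E) o\<^sub>L inv_op X \<in> pos_ops"
      by (rule pos_ops_comp[OF _ X']) (use that cX c' in \<open>simp_all add: loewner_le_def op_comp_bilinear\<close>)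
    then have "(1 / t) *\<^sub>R (E - t *\<^sub>R (E o\<^sub>L inv_op X)) \<in> pos_ops"
      using t by (intro pos_ops_scaleR) (simp_all add: op_comp_bilinear EX)
    then show ?thesis using t by (simp add: loewner_le_def scaleR_diff_right)
  qed
  show "(1 / t) *\<^sub>R E \<preceq> E o\<^sub>L inv_op X" if "E o\<^sub>L X \<preceq> t *\<^sub>R E"
  proof -
    have "(t *\<^sub>R E - (E o\<^sub>L X)) o\<^sub>L inv_op X \<in> pos_ops"
      by (rule pos_ops_comp[OF _ X']) (use that cX c' in \<open>simp_all add: loewner_le_def op_comp_bilinear\<close>)
    then have "(1 / t) *\<^sub>R (t *\<^sub>R (E o\<^sub>L inv_op X) - E) \<in> pos_ops"
      using t by (intro pos_ops_scaleR) (simp_all add: op_comp_bilinear EX)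
    then show ?thesis using t by (simp add: loewner_le_def scaleR_diff_right)
  qed
qed

text \<open>The mean is the inverse of an affine function of X^-1, so \<open>inv_op_local\<close> is
  used twice and the two order reversals cancel.\<close>

lemma harmonic_mean_local:
  assumes E: "E \<in> pos_ops" and X: "X \<in> pos_inv_ops" and c: "E o\<^sub>L X = X o\<^sub>L E" and t: "0 < t"
    and s: "0 \<le> s" "s \<le> 1"
  shows "t *\<^sub>R E \<preceq> E o\<^sub>L X \<Longrightarrow> harmonic_fun s t *\<^sub>R E \<preceq> E o\<^sub>L harmonic_mean s id_blinfun X"
    and "E o\<^sub>L X \<preceq> t *\<^sub>R E \<Longrightarrow> E o\<^sub>L harmonic_mean s id_blinfun X \<preceq> harmonic_fun s t *\<^sub>R E"
proof -
  let ?T = "(1 - s) *\<^sub>R id_blinfun + s *\<^sub>R inv_op X"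
  have T: "?T \<in> pos_inv_ops" by (intro pos_inv_convex pos_inv_id inv_op_pos_inv X s)
  have cT: "E o\<^sub>L ?T = ?T o\<^sub>L E" by (intro comm_intros inv_op_commute X c)
  have pos: "0 < 1 - s + s / t"
    using s t by (cases "s = 1") (auto intro: add_pos_nonneg)
  note T_local = inv_op_local[OF E T cT pos]
  have ET: "E o\<^sub>L ?T = (1 - s) *\<^sub>R E + s *\<^sub>R (E o\<^sub>L inv_op X)"
    and kE: "(1 - s + s / t) *\<^sub>R E = (1 - s) *\<^sub>R E + s *\<^sub>R ((1 / t) *\<^sub>R E)"
    by (simp_all add: op_comp_bilinear scaleR_add_left)
  show "harmonic_fun s t *\<^sub>R E \<preceq> E o\<^sub>L harmonic_mean s id_blinfun X" if "t *\<^sub>R E \<preceq> E o\<^sub>L X"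
    unfolding harmonic_fun_def harmonic_mean_def inv_op_id
    by (rule T_local(2), unfold ET kE)
      (intro loewner_add loewner_refl loewner_scaleR inv_op_local[OF E X c t] that s(1))
  show "E o\<^sub>L harmonic_mean s id_blinfun X \<preceq> harmonic_fun s t *\<^sub>R E" if "E o\<^sub>L X \<preceq> t *\<^sub>R E"
    unfolding harmonic_fun_def harmonic_mean_def inv_op_id
    by (rule T_local(1), unfold ET kE)
      (intro loewner_add loewner_refl loewner_scaleR inv_op_local[OF E X c t] that s(1))
qed

subsection \<open>Operator means\<close>

lemma adj_op_eqI:
  assumes C: "C \<in> bounded_ops" "C' \<in> bounded_ops" and a: "\<And>x y. inner (C x) y = inner x (C' y)"
  shows "adj_op C = C'"
  unfolding adj_op_def
proof (rule the_equality)
  have "cinner (C x) y = cinner x (C' y)" for x y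
    by (rule cinner_eqI) (use a[of x y] a[of x "\<i> *\<^sub>C y"] in \<open>simp_all add: bounded_opsD[OF C(2)]\<close>)
  then show "C' \<in> bounded_ops \<and> (\<forall>x y. cinner (C x) y = cinner x (C' y))" using C by simp
next
  fix S assume S: "S \<in> bounded_ops \<and> (\<forall>x y. cinner (C x) y = cinner x (S y))"
  show "S = C'"
  proof (rule blinfun_eqI)
    fix y
    have "inner x (S y) = inner x (C' y)" for x
      using S a[of x y] by (simp add: inner_eq_Re_cinner)
    then show "S y = C' y" by (metis vector_eq_ldot)
  qed
qed

lemma adj_op_selfadj: "selfadj C \<Longrightarrow> adj_op C = C"
  by (rule adj_op_eqI) (auto simp: selfadj_bounded dest: selfadjD)

lemma operator_mean_pos: "operator_mean \<sigma> \<Longrightarrow> A \<in> pos_ops \<Longrightarrow> B \<in> pos_ops \<Longrightarrow> \<sigma> A B \<in> pos_ops"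
  by (simp add: operator_mean_def)

lemma operator_mean_id: "operator_mean \<sigma> \<Longrightarrow> \<sigma> id_blinfun id_blinfun = id_blinfun"
  by (simp add: operator_mean_def)

lemma operator_mean_mono:
  "operator_mean \<sigma> \<Longrightarrow> A \<in> pos_ops \<Longrightarrow> B \<in> pos_ops \<Longrightarrow> C \<in> pos_ops \<Longrightarrow> D \<in> pos_ops
    \<Longrightarrow> A \<preceq> B \<Longrightarrow> C \<preceq> D \<Longrightarrow> \<sigma> A C \<preceq> \<sigma> B D"
  by (simp add: operator_mean_def)

lemma operator_mean_transform:
  "operator_mean \<sigma> \<Longrightarrow> A \<in> pos_ops \<Longrightarrow> B \<in> pos_ops \<Longrightarrow> C \<in> bounded_ops
    \<Longrightarrow> adj_op C o\<^sub>L \<sigma> A B o\<^sub>L C \<preceq> \<sigma> (adj_op C o\<^sub>L A o\<^sub>L C) (adj_op C o\<^sub>L B o\<^sub>L C)"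
  by (simp add: operator_mean_def)

lemma operator_mean_decreasing:
  "operator_mean \<sigma> \<Longrightarrow> (\<And>n. S n \<in> pos_ops) \<Longrightarrow> (\<And>n. T n \<in> pos_ops) \<Longrightarrow> A \<in> pos_ops \<Longrightarrow> B \<in> pos_ops
    \<Longrightarrow> decreases_to S A \<Longrightarrow> decreases_to T B \<Longrightarrow> decreases_to (\<lambda>n. \<sigma> (S n) (T n)) (\<sigma> A B)"
  unfolding operator_mean_def by (elim conjE) simp

text \<open>The transformer inequality for C^-1, conjugated back by C, is the reverse of the one for
  C.\<close>

lemma operator_mean_congr:
  assumes m: "operator_mean \<sigma>" and A: "A \<in> pos_ops" and B: "B \<in> pos_ops" and C: "C \<in> pos_inv_ops"
  shows "C o\<^sub>L \<sigma> A B o\<^sub>L C = \<sigma> (C o\<^sub>L A o\<^sub>L C) (C o\<^sub>L B o\<^sub>L C)"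
proof (rule loewner_antisym)
  have le: "K o\<^sub>L \<sigma> S T o\<^sub>L K \<preceq> \<sigma> (K o\<^sub>L S o\<^sub>L K) (K o\<^sub>L T o\<^sub>L K)"
    if "selfadj K" "S \<in> pos_ops" "T \<in> pos_ops" for K S T
    using operator_mean_transform[OF m that(2,3) selfadj_bounded[OF that(1)]]
    by (simp only: adj_op_selfadj[OF that(1)])
  note sC = pos_inv_selfadj[OF C]
  show "C o\<^sub>L \<sigma> A B o\<^sub>L C \<preceq> \<sigma> (C o\<^sub>L A o\<^sub>L C) (C o\<^sub>L B o\<^sub>L C)" by (rule le[OF sC A B])
  have "inv_op C o\<^sub>L \<sigma> (C o\<^sub>L A o\<^sub>L C) (C o\<^sub>L B o\<^sub>L C) o\<^sub>L inv_op C \<preceq> \<sigma> A B"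
    using le[OF inv_op_selfadj[OF C] pos_ops_congr[OF sC A] pos_ops_congr[OF sC B]]
    by (simp only: congr_cancel[OF C])
  from loewner_congr[OF this sC] show "\<sigma> (C o\<^sub>L A o\<^sub>L C) (C o\<^sub>L B o\<^sub>L C) \<preceq> C o\<^sub>L \<sigma> A B o\<^sub>L C"
    by (simp only: congr_cancel[OF C])
qed

text \<open>V is the adjoint of U. Conjugation by U fixes A and B, so the transformer inequality
  gives V S U \<le> S for the mean S; the one for V supplies the reverse.\<close>

lemma operator_mean_commute_unitary:
  assumes m: "operator_mean \<sigma>" and A: "A \<in> pos_ops" and B: "B \<in> pos_ops"
    and U: "U \<in> bounded_ops" "V \<in> bounded_ops" "\<And>x y. inner (U x) y = inner x (V y)"
    and UV: "U o\<^sub>L V = id_blinfun" "V o\<^sub>L U = id_blinfun"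
    and c: "U o\<^sub>L A = A o\<^sub>L U" "U o\<^sub>L B = B o\<^sub>L U"
  shows "\<sigma> A B o\<^sub>L U = U o\<^sub>L \<sigma> A B"
proof -
  let ?S = "\<sigma> A B"
  have V: "inner (V x) y = inner x (U y)" for x y using U(3)[of y x] by (simp add: inner_commute)
  have VTU: "V o\<^sub>L T o\<^sub>L U = T" "U o\<^sub>L T o\<^sub>L V = T" if "U o\<^sub>L T = T o\<^sub>L U" for T
    by (simp add: op_comp_assoc op_left_cancel[OF UV(2)] flip: that)
      (simp add: that op_comp_assoc UV)
  have le: "V o\<^sub>L ?S o\<^sub>L U \<preceq> ?S" "U o\<^sub>L ?S o\<^sub>L V \<preceq> ?S"
    using operator_mean_transform[OF m A B U(1)] operator_mean_transform[OF m A B U(2)]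
    by (simp_all only: adj_op_eqI[OF U] adj_op_eqI[OF U(2,1) V] VTU[OF c(1)] VTU[OF c(2)])
  have "V o\<^sub>L (?S - (U o\<^sub>L ?S o\<^sub>L V)) o\<^sub>L U \<in> pos_ops"
  proof (rule pos_opsI)
    have p: "?S - (U o\<^sub>L ?S o\<^sub>L V) \<in> pos_ops" using le(2) by (simp add: loewner_le_def)
    show "selfadj (V o\<^sub>L (?S - (U o\<^sub>L ?S o\<^sub>L V)) o\<^sub>L U)"
      using pos_ops_selfadj[OF p] U(1,2) by (simp add: selfadj_def bounded_ops_comp V flip: U(3))
    show "0 \<le> inner ((V o\<^sub>L (?S - (U o\<^sub>L ?S o\<^sub>L V)) o\<^sub>L U) x) x" for x
      using pos_opsD[OF p, of "U x"] by (simp add: V)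
  qed
  then have "?S \<preceq> V o\<^sub>L ?S o\<^sub>L U"
    by (simp add: loewner_le_def op_algebra UV op_left_cancel[OF UV(2)])
  with le(1) have "V o\<^sub>L ?S o\<^sub>L U = ?S" by (rule loewner_antisym)
  then have "U o\<^sub>L (V o\<^sub>L ?S o\<^sub>L U) = U o\<^sub>L ?S" by simp
  then show ?thesis by (simp add: op_comp_assoc op_left_cancel[OF UV(1)])
qed

text \<open>A self-adjoint contraction \<open>L\<close> is a multiple of the difference of the unitary operators
  \<open>\<surd>(1 - L\<^sup>2) \<plusminus> i L\<close>.\<close>

lemma operator_mean_commute:
  fixes K :: "'h::complex_hilbert_space \<Rightarrow>\<^sub>L 'h"
  assumes m: "operator_mean \<sigma>" and A: "A \<in> pos_ops" and B: "B \<in> pos_ops"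
    and K: "selfadj K" and KA: "K o\<^sub>L A = A o\<^sub>L K" and KB: "K o\<^sub>L B = B o\<^sub>L K"
  shows "K o\<^sub>L \<sigma> A B = \<sigma> A B o\<^sub>L K"
proof -
  define k where "k = norm K + 1"
  have k: "0 < k" "norm K \<le> k" by (auto simp: k_def intro: add_nonneg_pos)
  define L where "L = (1 / k) *\<^sub>R K"
  have L: "selfadj L" "norm L \<le> 1" using K k by (simp_all add: L_def selfadj_scaleR)
  have LA: "A o\<^sub>L L = L o\<^sub>L A" and LB: "B o\<^sub>L L = L o\<^sub>L B" by (simp_all add: L_def op_comp_bilinear KA KB)
  have T: "id_blinfun - (L o\<^sub>L L) \<in> pos_ops"
  proof -
    have "norm (L o\<^sub>L L) \<le> norm L * norm L" by (rule norm_blinfun_compose)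
    also have "\<dots> \<le> 1 * 1" using L by (intro mult_mono) auto
    finally have n: "norm (L o\<^sub>L L) \<le> 1" by simp
    have "L o\<^sub>L L \<preceq> norm (L o\<^sub>L L) *\<^sub>R id_blinfun" by (intro loewner_norm pos_ops_selfadj pos_ops_square L)
    also have "\<dots> \<preceq> 1 *\<^sub>R id_blinfun" by (intro loewner_scaleR_mono pos_ops_id n)
    finally show ?thesis by (simp add: loewner_le_def)
  qed
  define C where "C = sqrt_op (id_blinfun - (L o\<^sub>L L))"
  note C = sqrt_op_props[OF T, folded C_def]
  have sC: "selfadj C" by (rule pos_ops_selfadj[OF C(1)])
  have comm_C: "S o\<^sub>L C = C o\<^sub>L S" if "S o\<^sub>L L = L o\<^sub>L S" for S by (intro C(3) comm_intros that)
  \<comment> \<open>Operators form only a real vector space here; the scalar i has to enter as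
    composition with an operator that commutes with all of \<open>bounded_ops\<close>.\<close>
  define J where "J = Blinfun ((*\<^sub>C) \<i> :: 'h \<Rightarrow> 'h)"
  have J: "J x = \<i> *\<^sub>C x" for x by (simp add: J_def bounded_linear_Blinfun_apply[OF bounded_linear_scaleC])
  have Jb: "J \<in> bounded_ops" by (rule bounded_opsI) (simp add: J scaleC_scaleC mult.commute)
  have JJ: "J o\<^sub>L J = - id_blinfun" by (rule blinfun_eqI) (simp add: J scaleC_scaleC scaleC_minus_one op_apply)
  have JT: "T o\<^sub>L J = J o\<^sub>L T" if "T \<in> bounded_ops" for T
    by (rule blinfun_eqI) (simp add: J bounded_opsD[OF that])
  have JL: "L o\<^sub>L J = J o\<^sub>L L" and JC: "C o\<^sub>L J = J o\<^sub>L C"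
    using JT selfadj_bounded[OF L(1)] pos_ops_bounded[OF C(1)] by auto
  have LC: "L o\<^sub>L C = C o\<^sub>L L" by (rule comm_C) simp
  define U where "U = C + (J o\<^sub>L L)"
  define V where "V = C - (J o\<^sub>L L)"
  have UV: "U o\<^sub>L V = id_blinfun" "V o\<^sub>L U = id_blinfun"
  proof -
    have 1: "C o\<^sub>L (J o\<^sub>L L) = J o\<^sub>L (L o\<^sub>L C)" "(J o\<^sub>L L) o\<^sub>L C = J o\<^sub>L (L o\<^sub>L C)"
      by (simp_all add: op_comp_assoc LC op_left_commute[OF JC])
    have 2: "(J o\<^sub>L L) o\<^sub>L (J o\<^sub>L L) = - (L o\<^sub>L L)"
      by (simp add: op_comp_assoc op_left_commute[OF JL] op_left_cancel[OF JJ] op_comp_bilinear)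
    show "U o\<^sub>L V = id_blinfun" "V o\<^sub>L U = id_blinfun"
      unfolding U_def V_def op_comp_bilinear 1 2 C(2) by simp_all
  qed
  have b: "U \<in> bounded_ops" "V \<in> bounded_ops"
    using Jb L(1) pos_ops_bounded[OF C(1)] selfadj_bounded
    by (auto simp: U_def V_def intro!: bounded_ops_add bounded_ops_diff bounded_ops_comp)
  have adj: "inner (U x) y = inner x (V y)" for x y
  proof -
    have "inner (J (L x)) y = - inner x (J (L y))"
      using selfadjD[OF L(1), of x "\<i> *\<^sub>C y"]
      by (simp add: J inner_scaleC_i_left bounded_opsD[OF selfadj_bounded[OF L(1)]])
    then show ?thesis using selfadjD[OF sC, of x y] by (simp add: U_def V_def op_apply inner_simps)
  qed
  have UA: "U o\<^sub>L T = T o\<^sub>L U" if "T \<in> pos_ops" "T o\<^sub>L L = L o\<^sub>L T" for T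
    using comm_add[OF comm_C[OF that(2)] comm_comp[OF JT[OF pos_ops_bounded[OF that(1)]] that(2)]]
    by (simp add: U_def)
  let ?S = "\<sigma> A B"
  have SU: "?S o\<^sub>L U = U o\<^sub>L ?S"
    by (rule operator_mean_commute_unitary[OF m A B b adj UV UA[OF A LA] UA[OF B LB]])
  then have "V o\<^sub>L (?S o\<^sub>L U) o\<^sub>L V = V o\<^sub>L (U o\<^sub>L ?S) o\<^sub>L V" by simp
  then have SV: "?S o\<^sub>L V = V o\<^sub>L ?S" by (simp add: op_comp_assoc UV op_left_cancel[OF UV(2)])
  have "U - V = 2 *\<^sub>R (J o\<^sub>L L)" by (simp add: U_def V_def scaleR_2)
  then have "?S o\<^sub>L (J o\<^sub>L L) = (J o\<^sub>L L) o\<^sub>L ?S"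
    using comm_diff[OF SU SV] by (simp add: op_comp_bilinear)
  moreover have "?S o\<^sub>L (J o\<^sub>L L) = J o\<^sub>L (?S o\<^sub>L L)"
    by (rule op_left_commute[OF JT[OF pos_ops_bounded[OF operator_mean_pos[OF m A B]]]])
  ultimately have "J o\<^sub>L (?S o\<^sub>L L) = J o\<^sub>L (L o\<^sub>L ?S)" by (simp only: op_comp_assoc)
  then have "J o\<^sub>L (J o\<^sub>L (?S o\<^sub>L L)) = J o\<^sub>L (J o\<^sub>L (L o\<^sub>L ?S))" by simp
  then have "?S o\<^sub>L L = L o\<^sub>L ?S" by (simp add: op_left_cancel[OF JJ] op_comp_bilinear)
  then have "k *\<^sub>R (?S o\<^sub>L L) = k *\<^sub>R (L o\<^sub>L ?S)" by simp
  then show ?thesis using k by (simp add: L_def op_comp_bilinear)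
qed

text \<open>For invertible E this is congruence with the root of E, which commutes with X and, by
  \<open>operator_mean_commute\<close>, with the mean. A general E is approached from above by E +
  1/(n+1), and the axiom on decreasing sequences allows the limit.\<close>

lemma operator_mean_local:
  assumes m: "operator_mean \<sigma>" and X: "X \<in> pos_ops" and E: "E \<in> pos_ops" and c: "E o\<^sub>L X = X o\<^sub>L E"
  shows "E o\<^sub>L \<sigma> id_blinfun X = \<sigma> E (E o\<^sub>L X)"
proof -
  define h where "h n = 1 / real (Suc n)" for n
  have h: "h \<longlonglongrightarrow> 0" "\<And>n. 0 < h n" "\<And>n. h (Suc n) \<le> h n"
    unfolding h_def by (rule LIMSEQ_Suc[OF lim_1_over_n]) (auto intro: divide_left_mono)
  define F where "F n = E + h n *\<^sub>R id_blinfun" for n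
  have F: "F n \<in> pos_inv_ops" for n unfolding F_def by (rule pos_inv_shift[OF E h(2)])
  have FX: "F n o\<^sub>L X = (E o\<^sub>L X) + h n *\<^sub>R X" for n by (simp add: F_def op_comp_bilinear)
  have eq: "F n o\<^sub>L \<sigma> id_blinfun X = \<sigma> (F n) (F n o\<^sub>L X)" for n
  proof -
    let ?C = "sqrt_op (F n)"
    note C = sqrt_op_pos_inv[OF F[of n]] and P = sqrt_op_props[OF pos_inv_pos[OF F[of n]]]
    have XF: "X o\<^sub>L F n = F n o\<^sub>L X" unfolding F_def by (intro comm_intros c[symmetric])
    have XC: "X o\<^sub>L ?C = ?C o\<^sub>L X" by (rule P(3)[OF XF])
    have YC: "?C o\<^sub>L \<sigma> id_blinfun X = \<sigma> id_blinfun X o\<^sub>L ?C"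
      by (rule operator_mean_commute[OF m pos_ops_id X pos_inv_selfadj[OF C]]) (simp_all add: XC)
    have "?C o\<^sub>L \<sigma> id_blinfun X o\<^sub>L ?C = \<sigma> (?C o\<^sub>L id_blinfun o\<^sub>L ?C) (?C o\<^sub>L X o\<^sub>L ?C)"
      by (rule operator_mean_congr[OF m pos_ops_id X C])
    then show ?thesis by (simp add: op_comp_assoc XC op_left_cancel[OF P(2)] P(2) flip: YC)
  qed
  have EX: "E o\<^sub>L X \<in> pos_ops" by (rule pos_ops_comp[OF E X c])
  have dec: "decreases_to (\<lambda>n. S + h n *\<^sub>R T) S" if "T \<in> pos_ops" for S T :: "'a \<Rightarrow>\<^sub>L 'a"
    unfolding decreases_to_def
  proof (intro conjI allI)
    show "S + h (Suc n) *\<^sub>R T \<preceq> S + h n *\<^sub>R T" for n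
      by (intro loewner_add loewner_refl loewner_scaleR_mono that h)
    have "(\<lambda>n. S x + h n *\<^sub>R T x) \<longlonglongrightarrow> S x + 0 *\<^sub>R T x" for x by (intro tendsto_intros h)
    then show "(\<lambda>n. (S + h n *\<^sub>R T) x) \<longlonglongrightarrow> S x" for x by (simp add: op_apply)
  qed
  have "decreases_to (\<lambda>n. \<sigma> (F n) (F n o\<^sub>L X)) (\<sigma> E (E o\<^sub>L X))"
  proof (rule operator_mean_decreasing[OF m])
    show "decreases_to F E" unfolding F_def by (rule dec[OF pos_ops_id])
    show "decreases_to (\<lambda>n. F n o\<^sub>L X) (E o\<^sub>L X)" unfolding FX by (rule dec[OF X])
    show "F n \<in> pos_ops" for n by (rule pos_inv_pos[OF F])
    show "F n o\<^sub>L X \<in> pos_ops" for n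
      unfolding FX by (intro pos_ops_add pos_ops_scaleR EX X less_imp_le[OF h(2)])
  qed (fact E EX)+
  then have 1: "(\<lambda>n. (F n o\<^sub>L \<sigma> id_blinfun X) x) \<longlonglongrightarrow> \<sigma> E (E o\<^sub>L X) x" for x
    by (simp only: decreases_to_def eq)
  have 2: "(\<lambda>n. (F n o\<^sub>L \<sigma> id_blinfun X) x) \<longlonglongrightarrow> (E o\<^sub>L \<sigma> id_blinfun X) x" for x
    using dec[OF pos_ops_id, of E] by (simp add: decreases_to_def F_def)
  show ?thesis by (rule blinfun_eqI) (rule LIMSEQ_unique[OF 2 1])
qed

text \<open>By \<open>operator_mean_local\<close> the two sides are \<sigma> E (E X) and \<sigma> E
  (t E), so monotonicity in the second argument is all that is left. These inequalities replace the
  formula I \<sigma> X = f(X).\<close>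

lemma representing_function_local:
  assumes m: "operator_mean \<sigma>" and f: "representing_function \<sigma> f"
    and X: "X \<in> pos_ops" and E: "E \<in> pos_ops" and c: "E o\<^sub>L X = X o\<^sub>L E" and t: "0 \<le> t"
  shows "E o\<^sub>L X \<preceq> t *\<^sub>R E \<Longrightarrow> E o\<^sub>L \<sigma> id_blinfun X \<preceq> f t *\<^sub>R E"
    and "t *\<^sub>R E \<preceq> E o\<^sub>L X \<Longrightarrow> f t *\<^sub>R E \<preceq> E o\<^sub>L \<sigma> id_blinfun X"
proof -
  have "E o\<^sub>L \<sigma> id_blinfun (t *\<^sub>R id_blinfun) = \<sigma> E (E o\<^sub>L t *\<^sub>R id_blinfun)"
    by (intro operator_mean_local m E pos_ops_scaleR pos_ops_id t) (simp add: op_comp_bilinear)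
  then have ft: "f t *\<^sub>R E = \<sigma> E (t *\<^sub>R E)"
    using f t by (simp add: representing_function_def op_comp_bilinear)
  have p: "E o\<^sub>L X \<in> pos_ops" "t *\<^sub>R E \<in> pos_ops" by (intro pos_ops_comp pos_ops_scaleR E X c t)+
  show "E o\<^sub>L X \<preceq> t *\<^sub>R E \<Longrightarrow> E o\<^sub>L \<sigma> id_blinfun X \<preceq> f t *\<^sub>R E"
    "t *\<^sub>R E \<preceq> E o\<^sub>L X \<Longrightarrow> f t *\<^sub>R E \<preceq> E o\<^sub>L \<sigma> id_blinfun X"
    unfolding ft operator_mean_local[OF m X E c]
    by (rule operator_mean_mono[OF m E E]; simp add: p)+
qed

subsection \<open>Localization\<close>

text \<open>P = (|S| + S) / 2 with |S| the root of S^2. Both S and -S are below |S|, and P S = |S| P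
  is a product of commuting positive operators.\<close>

lemma positive_part:
  assumes S: "selfadj S"
  shows "\<exists>P\<in>pos_ops. S \<preceq> P \<and> P o\<^sub>L S \<in> pos_ops \<and> (\<forall>L. L o\<^sub>L S = S o\<^sub>L L \<longrightarrow> L o\<^sub>L P = P o\<^sub>L L)"
proof -
  define R where "R = sqrt_op (S o\<^sub>L S)"
  note R = sqrt_op_props[OF pos_ops_square[OF S], folded R_def]
  define P where "P = (1/2) *\<^sub>R (R + S)"
  have comm: "L o\<^sub>L R = R o\<^sub>L L" if "L o\<^sub>L S = S o\<^sub>L L" for L by (intro R(3) comm_intros that)
  have le: "S \<preceq> R" "- S \<preceq> R"
    by (rule selfadj_square_mono[OF _ R(1)]; simp add: S selfadj_minus R(2) op_comp_bilinear)+
  have "P \<in> pos_ops" using le(2) by (simp add: P_def loewner_le_def pos_ops_scaleR)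
  moreover have "S \<preceq> P"
  proof -
    have "P - S = (1/2) *\<^sub>R (R - S)" by (simp add: P_def algebra_simps) (simp flip: scaleR_add_left)
    then show ?thesis using le(1) by (simp add: loewner_le_def pos_ops_scaleR)
  qed
  moreover have c: "L o\<^sub>L P = P o\<^sub>L L" if "L o\<^sub>L S = S o\<^sub>L L" for L
    unfolding P_def by (intro comm_intros comm that)
  moreover have "P o\<^sub>L S \<in> pos_ops"
  proof -
    have SR: "S o\<^sub>L R = R o\<^sub>L S" by (rule comm) simp
    have "P o\<^sub>L S = R o\<^sub>L P" by (simp add: P_def op_comp_bilinear R(2) add.commute)
    moreover have "R o\<^sub>L P = P o\<^sub>L R" by (rule c) (simp add: SR)
    ultimately show ?thesis using pos_ops_comp[OF R(1) \<open>P \<in> pos_ops\<close>] by simp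
  qed
  ultimately show ?thesis by (intro bexI[of _ P] conjI allI impI)
qed

text \<open>A soft spectral cut. With P = (X - a)_+ and Q = (b - X)_+ one has P + Q \<ge> b - a, so
  G = P (P + Q)^-1 makes sense; it lives where X \<ge> a, and I - G = Q (P + Q)^-1 where X \<le> b.
  The overlap between a and b is the price for avoiding projections.\<close>

lemma cutoff:
  assumes X: "selfadj X" and ab: "a < b"
  shows "\<exists>G\<in>pos_ops. id_blinfun - G \<in> pos_ops \<and> (\<forall>L. L o\<^sub>L X = X o\<^sub>L L \<longrightarrow> L o\<^sub>L G = G o\<^sub>L L) \<and>
    G o\<^sub>L (X - a *\<^sub>R id_blinfun) \<in> pos_ops \<and> (id_blinfun - G) o\<^sub>L (b *\<^sub>R id_blinfun - X) \<in> pos_ops"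
proof -
  let ?S = "X - a *\<^sub>R id_blinfun" let ?T = "b *\<^sub>R id_blinfun - X"
  have s: "selfadj ?S" "selfadj ?T" by (intro selfadj_diff selfadj_scaleR selfadj_id X)+
  from positive_part[OF s(1)] obtain P where P: "P \<in> pos_ops" "?S \<preceq> P" "P o\<^sub>L ?S \<in> pos_ops"
    and Pc: "\<forall>L. L o\<^sub>L ?S = ?S o\<^sub>L L \<longrightarrow> L o\<^sub>L P = P o\<^sub>L L" by (elim bexE conjE)
  from positive_part[OF s(2)] obtain Q where Q: "Q \<in> pos_ops" "?T \<preceq> Q" "Q o\<^sub>L ?T \<in> pos_ops"
    and Qc: "\<forall>L. L o\<^sub>L ?T = ?T o\<^sub>L L \<longrightarrow> L o\<^sub>L Q = Q o\<^sub>L L" by (elim bexE conjE)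
  have "(b - a) *\<^sub>R id_blinfun \<preceq> P + Q"
    using loewner_add[OF P(2) Q(2)] by (simp add: algebra_simps)
  then have N: "P + Q \<in> pos_inv_ops"
    using ab P Q by (intro pos_inv_opsI[of _ "b - a"] selfadj_add pos_ops_selfadj) auto
  have LP: "L o\<^sub>L P = P o\<^sub>L L" and LQ: "L o\<^sub>L Q = Q o\<^sub>L L" if "L o\<^sub>L X = X o\<^sub>L L" for L
    by (intro Pc[rule_format] Qc[rule_format] comm_intros that)+
  let ?I = "inv_op (P + Q)"
  have LI: "L o\<^sub>L ?I = ?I o\<^sub>L L" if "L o\<^sub>L X = X o\<^sub>L L" for L
    by (intro inv_op_commute[OF N] comm_add LP LQ that)
  have XP: "P o\<^sub>L X = X o\<^sub>L P" and XQ: "Q o\<^sub>L X = X o\<^sub>L Q" using LP[of X] LQ[of X] by simp_all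
  have IX: "?I o\<^sub>L X = X o\<^sub>L ?I" using LI[of X] by simp
  have PI: "P o\<^sub>L ?I = ?I o\<^sub>L P" and QI: "Q o\<^sub>L ?I = ?I o\<^sub>L Q" by (rule LI[OF XP] LI[OF XQ])+
  have Ip: "?I \<in> pos_ops" by (intro pos_inv_pos inv_op_pos_inv N)
  have IS: "?I o\<^sub>L ?S = ?S o\<^sub>L ?I" and IT: "?I o\<^sub>L ?T = ?T o\<^sub>L ?I" by (intro comm_intros IX)+
  have "(P o\<^sub>L ?I) + (Q o\<^sub>L ?I) = id_blinfun"
    using inv_op_props(2)[OF N] by (simp add: op_comp_bilinear)
  then have G': "id_blinfun - (P o\<^sub>L ?I) = Q o\<^sub>L ?I" by (simp add: algebra_simps)
  have "(P o\<^sub>L ?I) o\<^sub>L ?S = ?I o\<^sub>L (P o\<^sub>L ?S)" "(Q o\<^sub>L ?I) o\<^sub>L ?T = ?I o\<^sub>L (Q o\<^sub>L ?T)"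
    unfolding PI QI by (simp_all only: op_comp_assoc)
  moreover have "?I o\<^sub>L (P o\<^sub>L ?S) \<in> pos_ops"
    by (intro pos_ops_comp Ip P comm_comp PI[symmetric] IS)
  moreover have "?I o\<^sub>L (Q o\<^sub>L ?T) \<in> pos_ops"
    by (intro pos_ops_comp Ip Q comm_comp QI[symmetric] IT)
  moreover have "P o\<^sub>L ?I \<in> pos_ops" "Q o\<^sub>L ?I \<in> pos_ops" by (intro pos_ops_comp Ip P Q PI QI)+
  moreover have "L o\<^sub>L (P o\<^sub>L ?I) = (P o\<^sub>L ?I) o\<^sub>L L" if "L o\<^sub>L X = X o\<^sub>L L" for L
    by (intro comm_comp LP LI that)
  ultimately show ?thesis
    by (intro bexI[of _ "P o\<^sub>L ?I"] conjI allI impI) (simp_all only: G')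
qed

text \<open>E is cut repeatedly from below. Each cut has its overlap between t (k + 1) and t (k +
  2): the piece split off satisfies t k \<le> X \<le> t (k + 2), and on the rest X \<ge> t (k + 1).
  Cells therefore span two grid steps.\<close>

lemma localization:
  fixes t :: "nat \<Rightarrow> real"
  assumes X: "selfadj X" and N: "2 \<le> N" and t: "\<And>k. t k < t (Suc k)"
    and lo: "t 0 *\<^sub>R id_blinfun \<preceq> X" and hi: "X \<preceq> t N *\<^sub>R id_blinfun"
    and cell: "\<And>k E. k + 2 \<le> N \<Longrightarrow> E \<in> pos_ops \<Longrightarrow> E o\<^sub>L X = X o\<^sub>L E
      \<Longrightarrow> t k *\<^sub>R E \<preceq> E o\<^sub>L X \<Longrightarrow> E o\<^sub>L X \<preceq> t (k + 2) *\<^sub>R E \<Longrightarrow> E o\<^sub>L D \<in> pos_ops"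
  shows "D \<in> pos_ops"
proof -
  have "E o\<^sub>L D \<in> pos_ops"
    if "k + 2 + j = N" "E \<in> pos_ops" "E o\<^sub>L X = X o\<^sub>L E" "t k *\<^sub>R E \<preceq> E o\<^sub>L X" for k j E
    using that
  proof (induction j arbitrary: k E)
    case 0
    have "E o\<^sub>L (t N *\<^sub>R id_blinfun - X) \<in> pos_ops"
      using hi 0 by (intro pos_ops_comp comm_intros) (auto simp: loewner_le_def)
    then have "E o\<^sub>L X \<preceq> t N *\<^sub>R E" by (simp add: loewner_le_def op_comp_bilinear)
    with 0 show ?case by (intro cell[of k]) auto
  next
    case (Suc j)
    note E = Suc.prems(2) and EX = Suc.prems(3)
    have "t (Suc k) < t (Suc (Suc k))" by (rule t)
    from cutoff[OF X this] obtain G where G: "G \<in> pos_ops" "id_blinfun - G \<in> pos_ops"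
      and Gc': "\<forall>L. L o\<^sub>L X = X o\<^sub>L L \<longrightarrow> L o\<^sub>L G = G o\<^sub>L L"
      and G1: "G o\<^sub>L (X - t (Suc k) *\<^sub>R id_blinfun) \<in> pos_ops"
      and G2: "(id_blinfun - G) o\<^sub>L (t (Suc (Suc k)) *\<^sub>R id_blinfun - X) \<in> pos_ops" by (elim bexE conjE)
    note Gc = Gc'[rule_format]
    have EG: "E o\<^sub>L G = G o\<^sub>L E" by (rule Gc[OF EX])
    have XG: "X o\<^sub>L G = G o\<^sub>L X" by (rule Gc) simp
    have EG': "E o\<^sub>L (id_blinfun - G) = (id_blinfun - G) o\<^sub>L E" by (intro comm_intros EG)
    have c1: "(E o\<^sub>L G) o\<^sub>L X = X o\<^sub>L (E o\<^sub>L G)"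
      and c2: "(E o\<^sub>L (id_blinfun - G)) o\<^sub>L X = X o\<^sub>L (E o\<^sub>L (id_blinfun - G))"
      by (rule sym, intro comm_intros EX[symmetric] XG)+
    have p1: "E o\<^sub>L G \<in> pos_ops" by (rule pos_ops_comp[OF E G(1) EG])
    have p2: "E o\<^sub>L (id_blinfun - G) \<in> pos_ops" by (rule pos_ops_comp[OF E G(2) EG'])
    have "E o\<^sub>L (G o\<^sub>L (X - t (Suc k) *\<^sub>R id_blinfun)) \<in> pos_ops"
      by (intro pos_ops_comp[OF E G1] comm_intros EG EX)
    then have 1: "t (Suc k) *\<^sub>R (E o\<^sub>L G) \<preceq> (E o\<^sub>L G) o\<^sub>L X"
      by (simp add: loewner_le_def op_comp_bilinear op_comp_assoc)
    have "E o\<^sub>L ((id_blinfun - G) o\<^sub>L (t (Suc (Suc k)) *\<^sub>R id_blinfun - X)) \<in> pos_ops"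
      by (intro pos_ops_comp[OF E G2] comm_intros EG EX)
    then have 2: "(E o\<^sub>L (id_blinfun - G)) o\<^sub>L X \<preceq> t (k + 2) *\<^sub>R (E o\<^sub>L (id_blinfun - G))"
      by (simp add: loewner_le_def op_comp_bilinear op_comp_assoc algebra_simps)
    have "(id_blinfun - G) o\<^sub>L ((E o\<^sub>L X) - t k *\<^sub>R E) \<in> pos_ops"
    proof (rule pos_ops_comp[OF G(2)])
      show "(E o\<^sub>L X) - t k *\<^sub>R E \<in> pos_ops" using Suc.prems(4) by (simp add: loewner_le_def)
      show "(id_blinfun - G) o\<^sub>L ((E o\<^sub>L X) - t k *\<^sub>R E) = ((E o\<^sub>L X) - t k *\<^sub>R E) o\<^sub>L (id_blinfun - G)"
        by (rule sym, intro comm_intros, rule sym, intro comm_intros) (simp_all add: EG XG)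
    qed
    then have 3: "t k *\<^sub>R (E o\<^sub>L (id_blinfun - G)) \<preceq> (E o\<^sub>L (id_blinfun - G)) o\<^sub>L X"
      unfolding EG' by (simp add: loewner_le_def op_comp_bilinear op_comp_assoc algebra_simps)
    have "(E o\<^sub>L G) o\<^sub>L D \<in> pos_ops" using Suc.prems(1) by (intro Suc.IH[of "Suc k"] p1 c1 1) simp
    moreover have "(E o\<^sub>L (id_blinfun - G)) o\<^sub>L D \<in> pos_ops"
      using Suc.prems(1) by (intro cell[of k] p2 c2 2 3) simp
    ultimately have "((E o\<^sub>L G) o\<^sub>L D) + ((E o\<^sub>L (id_blinfun - G)) o\<^sub>L D) \<in> pos_ops" by (rule pos_ops_add)
    then show ?case by (simp add: op_comp_bilinear)
  qed
  from this[of 0 "N - 2" id_blinfun] show ?thesis using N lo by (simp add: pos_ops_id)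
qed

text \<open>The grid must not depend on \<open>X\<close> and \<open>D\<close>: the function that approximates on it is chosen first.\<close>

lemma localization_grid:
  assumes ab: "a < b" and d: "0 < d"
  shows "\<exists>S. finite S \<and> S \<subseteq> {a..b} \<and>
    (\<forall>X D :: 'h::complex_hilbert_space \<Rightarrow>\<^sub>L 'h. selfadj X \<longrightarrow> a *\<^sub>R id_blinfun \<preceq> X \<longrightarrow> X \<preceq> b *\<^sub>R id_blinfun \<longrightarrow>
      (\<forall>E\<in>pos_ops. \<forall>s\<in>S. \<forall>t\<in>S. s < t \<longrightarrow> t - s < d \<longrightarrow> E o\<^sub>L X = X o\<^sub>L E \<longrightarrow>
        s *\<^sub>R E \<preceq> E o\<^sub>L X \<longrightarrow> E o\<^sub>L X \<preceq> t *\<^sub>R E \<longrightarrow> E o\<^sub>L D \<in> pos_ops) \<longrightarrow>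
      D \<in> pos_ops)"
proof -
  obtain N :: nat where N: "2 * (b - a) / d < real N" using reals_Archimedean2 by blast
  \<comment> \<open>Two steps of length (b - a) / M must stay below d, whence the factor 2 in the
    choice of N; the summand 2 guarantees that there is at least one cell.\<close>
  define M where "M = N + 2"
  define \<delta> where "\<delta> = (b - a) / M"
  define t where "t k = a + real k * \<delta>" for k
  have M: "0 < real M" "2 \<le> M" by (simp_all add: M_def)
  have "2 * (b - a) < d * real N" using N d by (simp add: field_simps)
  also have "\<dots> \<le> d * real M" using d by (simp add: M_def)
  finally have \<delta>: "0 < \<delta>" "2 * \<delta> < d" using ab M by (simp_all add: \<delta>_def field_simps)
  have t_step: "t k < t (Suc k)" for k using \<delta> by (simp add: t_def algebra_simps)
  have tM: "t M = b" "t 0 = a" using M by (simp_all add: t_def \<delta>_def)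
  have t_in: "t k \<in> {a..b}" if "k \<le> M" for k
  proof -
    have "0 \<le> real k * \<delta>" "real k * \<delta> \<le> real M * \<delta>" using \<delta> that by (auto intro: mult_right_mono)
    then show ?thesis using tM by (simp add: t_def)
  qed
  have gap: "t k < t (k + 2)" "t (k + 2) - t k < d" for k using \<delta> by (simp_all add: t_def algebra_simps)
  have "D \<in> pos_ops"
    if X: "selfadj X" "a *\<^sub>R id_blinfun \<preceq> X" "X \<preceq> b *\<^sub>R id_blinfun"
      and cell: "\<forall>E\<in>pos_ops. \<forall>u\<in>t ` {..M}. \<forall>v\<in>t ` {..M}. u < v \<longrightarrow> v - u < d \<longrightarrow> E o\<^sub>L X = X o\<^sub>L E \<longrightarrow>
        u *\<^sub>R E \<preceq> E o\<^sub>L X \<longrightarrow> E o\<^sub>L X \<preceq> v *\<^sub>R E \<longrightarrow> E o\<^sub>L D \<in> pos_ops" for X D :: "'h \<Rightarrow>\<^sub>L 'h"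
  proof (rule localization[OF X(1) M(2) t_step X(2,3)[folded tM]])
    fix k E assume k: "k + 2 \<le> M"
      and E: "E \<in> pos_ops" "E o\<^sub>L X = X o\<^sub>L E" "t k *\<^sub>R E \<preceq> E o\<^sub>L X" "E o\<^sub>L X \<preceq> t (k + 2) *\<^sub>R E"
    show "E o\<^sub>L D \<in> pos_ops"
      by (rule cell[rule_format, OF E(1) _ _ gap E(2-4)]) (use k in auto)
  qed
  moreover have "finite (t ` {..M})" "t ` {..M} \<subseteq> {a..b}" using t_in by auto
  ultimately show ?thesis by (intro exI[of _ "t ` {..M}"] conjI allI impI)
qed

subsection \<open>Divided differences\<close>

text \<open>The derivative of the node polynomial at \<open>c k\<close>. Its reciprocal is the
  weight of the value at \<open>c k\<close> in the divided difference over all nodes.\<close>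

definition nodal :: "(nat \<Rightarrow> real) \<Rightarrow> nat \<Rightarrow> nat \<Rightarrow> real" where
  "nodal c N k = (\<Prod>l\<in>{..<N} - {k}. c k - c l)"

definition lagrange :: "(nat \<Rightarrow> real) \<Rightarrow> nat \<Rightarrow> (nat \<Rightarrow> real) \<Rightarrow> real poly" where
  "lagrange c N v = (\<Sum>k<N. smult (v k / nodal c N k) (\<Prod>l\<in>{..<N} - {k}. [:- c l, 1:]))"

lemma nodal_nonzero: "inj_on c {..<N} \<Longrightarrow> k < N \<Longrightarrow> nodal c N k \<noteq> 0"
  by (auto simp: nodal_def inj_on_def)

lemma degree_lagrange_factor: "k < N \<Longrightarrow> degree (\<Prod>l\<in>{..<N} - {k}. [:- c l, 1::real:]) = N - 1"
  by (subst degree_prod_eq_sum_degree) auto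

lemma coeff_lagrange_factor: "k < N \<Longrightarrow> coeff (\<Prod>l\<in>{..<N} - {k}. [:- c l, 1::real:]) (N - 1) = 1"
  using degree_lagrange_factor[of k N c] lead_coeff_prod[of "\<lambda>l. [:- c l, 1:]" "{..<N} - {k}"]
  by simp

lemma degree_lagrange: "0 < N \<Longrightarrow> degree (lagrange c N v) < N"
proof -
  assume "0 < N"
  have "degree (lagrange c N v) \<le> N - 1"
    unfolding lagrange_def
    by (intro degree_sum_le order.trans[OF degree_smult_le]) (auto simp: degree_lagrange_factor)
  with \<open>0 < N\<close> show ?thesis by simp
qed

text \<open>Every basis polynomial of the interpolation is monic of degree N - 1. The right-hand
  side is the divided difference of the data v.\<close>

lemma coeff_lagrange: "coeff (lagrange c N v) (N - 1) = (\<Sum>k<N. v k / nodal c N k)"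
  unfolding lagrange_def coeff_sum
  by (rule sum.cong) (simp_all add: coeff_lagrange_factor del: One_nat_def)

lemma poly_lagrange:
  assumes "inj_on c {..<N}" "j < N"
  shows "poly (lagrange c N v) (c j) = v j"
proof -
  have "poly (lagrange c N v) (c j) = (\<Sum>k<N. v k / nodal c N k * (\<Prod>l\<in>{..<N} - {k}. c j - c l))"
    by (simp add: lagrange_def poly_sum poly_prod)
  also have "\<dots> = (\<Sum>k<N. if k = j then v j else 0)"
  proof (rule sum.cong)
    fix k assume k: "k \<in> {..<N}"
    show "v k / nodal c N k * (\<Prod>l\<in>{..<N} - {k}. c j - c l) = (if k = j then v j else 0)"
    proof (cases "k = j")
      case True
      then show ?thesis using nodal_nonzero[OF assms] by (simp add: nodal_def)
    next
      case False
      then have "(\<Prod>l\<in>{..<N} - {k}. c j - c l) = 0" using assms by (intro prod_zero) auto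
      with False show ?thesis by simp
    qed
  qed simp
  also have "\<dots> = v j" using assms by simp
  finally show ?thesis .
qed

lemma lagrange_unique:
  assumes c: "inj_on c {..<N}" and p: "degree p < N"
  shows "lagrange c N (\<lambda>k. poly p (c k)) = p"
proof (rule ccontr)
  let ?d = "lagrange c N (\<lambda>k. poly p (c k)) - p"
  assume "\<not> ?thesis"
  then have "?d \<noteq> 0" by simp
  have "c ` {..<N} \<subseteq> {x. poly ?d x = 0}" by (auto simp: poly_lagrange[OF c])
  then have "card (c ` {..<N}) \<le> card {x. poly ?d x = 0}"
    by (intro card_mono poly_roots_finite \<open>?d \<noteq> 0\<close>)
  also have "\<dots> \<le> degree ?d" by (rule card_poly_roots_bound[OF \<open>?d \<noteq> 0\<close>])
  also have "\<dots> < N" using p degree_lagrange[of N c "\<lambda>k. poly p (c k)"] by (intro degree_diff_less) auto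
  finally show False using c by (simp add: card_image)
qed

lemma divided_difference_poly:
  assumes "inj_on c {..<N}" "degree p < N"
  shows "(\<Sum>k<N. poly p (c k) / nodal c N k) = coeff p (N - 1)"
  using coeff_lagrange[of c N "\<lambda>k. poly p (c k)"] lagrange_unique[OF assms] by simp

text \<open>The negative factors are those with l > k, and there are 2 n - 1 - k of them.\<close>

lemma nodal_sign:
  assumes c: "strict_mono_on {..<2 * n} c" and k: "k < 2 * n"
  shows "even k \<Longrightarrow> nodal c (2 * n) k < 0" and "odd k \<Longrightarrow> 0 < nodal c (2 * n) k"
proof -
  have lt: "c i < c j" if "i < j" "j < 2 * n" for i j
    using strict_mono_onD[OF c, of i j] that by simp
  have split: "{..<2 * n} - {k} = {..<k} \<union> {k<..<2 * n}" using k by auto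
  have "nodal c (2 * n) k = (\<Prod>l\<in>{..<k} \<union> {k<..<2 * n}. c k - c l)"
    by (simp only: nodal_def split)
  also have "\<dots> = (\<Prod>l<k. c k - c l) * (\<Prod>l\<in>{k<..<2 * n}. c k - c l)"
    by (rule prod.union_disjoint) auto
  also have "(\<Prod>l\<in>{k<..<2 * n}. c k - c l) = (\<Prod>l\<in>{k<..<2 * n}. (- 1) * (c l - c k))"
    by (rule prod.cong) auto
  also have "\<dots> = (- 1) ^ (2 * n - Suc k) * (\<Prod>l\<in>{k<..<2 * n}. c l - c k)"
    by (simp only: prod.distrib prod_constant card_greaterThanLessThan)
  finally have eq: "nodal c (2 * n) k
    = (- 1) ^ (2 * n - Suc k) * ((\<Prod>l<k. c k - c l) * (\<Prod>l\<in>{k<..<2 * n}. c l - c k))"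
    by simp
  have pos: "0 < (\<Prod>l<k. c k - c l) * (\<Prod>l\<in>{k<..<2 * n}. c l - c k)"
    using k by (intro mult_pos_pos prod_pos) (auto intro!: lt)
  show "nodal c (2 * n) k < 0" if "even k"
  proof -
    have "odd (2 * n - Suc k)" using that k by simp
    then show ?thesis using pos by (simp add: eq)
  qed
  show "0 < nodal c (2 * n) k" if "odd k"
  proof -
    have "even (2 * n - Suc k)" using that k by simp
    then show ?thesis using pos by (simp add: eq)
  qed
qed

lemma sum_even_odd: "(\<Sum>k<2 * n. g k) = (\<Sum>i<n. g (2 * i)) + (\<Sum>i<n. g (2 * i + 1))"
  for g :: "nat \<Rightarrow> 'a::comm_monoid_add"
  by (induction n) (simp_all add: algebra_simps)

text \<open>Evaluation at the nodes of even and of odd index gives two isometric embeddings of the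
  polynomials of degree less than \<open>n\<close> into \<open>\<real>\<^sup>n\<close>, as the divided difference of \<open>q\<^sup>2\<close> vanishes;
  \<open>M\<close> is the resulting orthogonal matrix.\<close>

lemma interlacing_orthogonal_matrix:
  assumes n: "0 < n" and c: "strict_mono_on {..<2 * n} c"
  defines "w \<equiv> \<lambda>k. 1 / nodal c (2 * n) k"
  shows "\<exists>M :: nat \<Rightarrow> nat \<Rightarrow> real.
    (\<forall>j<n. \<forall>k<n. (\<Sum>i<n. M j i * M k i) = (if j = k then 1 else 0)) \<and>
    (\<forall>h. (\<Sum>i<n. c (2 * i) * (h i)\<^sup>2) \<le> (\<Sum>j<n. c (2 * j + 1) * (\<Sum>i<n. M j i * h i)\<^sup>2)) \<and>
    (\<forall>q. degree q < n \<longrightarrow> (\<exists>h. (\<forall>i<n. (h i)\<^sup>2 = - w (2 * i) * (poly q (c (2 * i)))\<^sup>2) \<and>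
      (\<forall>j<n. (\<Sum>i<n. M j i * h i)\<^sup>2 = w (2 * j + 1) * (poly q (c (2 * j + 1)))\<^sup>2) \<and>
      (\<Sum>i<n. (h i)\<^sup>2) = (\<Sum>j<n. (\<Sum>i<n. M j i * h i)\<^sup>2)))"
proof -
  define a where "a i = c (2 * i)" for i
  define b where "b i = c (2 * i + 1)" for i
  define u where "u i = - w (2 * i)" for i
  define v where "v i = w (2 * i + 1)" for i
  have u: "0 < u i" if "i < n" for i
    using nodal_sign(1)[OF c, of "2 * i"] that by (simp add: u_def w_def divide_neg_neg)
  have v: "0 < v i" if "i < n" for i
    using nodal_sign(2)[OF c, of "2 * i + 1"] that by (simp add: v_def w_def)
  have inj: "inj_on c {..<2 * n}" by (rule strict_mono_on_imp_inj_on[OF c])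
  have inja: "inj_on a {..<n}" and injb: "inj_on b {..<n}"
    by (auto simp: a_def b_def intro!: inj_onI dest!: inj_onD[OF inj])
  \<comment> \<open>The divided difference over all 2 n nodes, with the terms at the even-indexed
    nodes, whose weights are negative, moved to the other side.\<close>
  have dd: "(\<Sum>j<n. v j * poly p (b j)) = (\<Sum>i<n. u i * poly p (a i)) + coeff p (2 * n - 1)"
    if "degree p < 2 * n" for p
    using divided_difference_poly[OF inj that] sum_even_odd[of "\<lambda>k. poly p (c k) / nodal c (2 * n) k" n]
    by (simp add: u_def v_def w_def a_def b_def sum_negf)
  have bil: "(\<Sum>j<n. v j * (poly p (b j) * poly q (b j))) = (\<Sum>i<n. u i * (poly p (a i) * poly q (a i)))"
    if "degree p < n" "degree q < n" for p q
  proof -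
    have "degree (p * q) < 2 * n - 1" using degree_mult_le[of p q] that by linarith
    then show ?thesis using dd[of "p * q"] by (simp add: coeff_eq_0)
  qed
  define m where "m j = lagrange b n (\<lambda>k. if k = j then 1 else 0)" for j
  have m: "degree (m j) < n" "k < n \<Longrightarrow> poly (m j) (b k) = (if k = j then 1 else 0)" for j k
    unfolding m_def using n by (simp_all add: degree_lagrange poly_lagrange[OF injb])
  \<comment> \<open>Row j lists the values at the even-indexed nodes of the Lagrange polynomial of
    the j-th odd-indexed node, normalized for both embeddings. Thus M carries the coordinates of a
    polynomial in the first embedding to those in the second.\<close>
  define M where "M j i = sqrt (u i) * poly (m j) (a i) / sqrt (v j)" for j i
  have Mq: "(\<Sum>i<n. M j i * (sqrt (u i) * poly q (a i))) = sqrt (v j) * poly q (b j)"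
    if "j < n" "degree q < n" for j q
  proof -
    have "(\<Sum>i<n. M j i * (sqrt (u i) * poly q (a i))) = (\<Sum>i<n. u i * (poly (m j) (a i) * poly q (a i))) / sqrt (v j)"
      unfolding M_def sum_divide_distrib
    proof (intro sum.cong refl)
      fix i assume "i \<in> {..<n}"
      then have "sqrt (u i) * sqrt (u i) = u i" using u[of i] by simp
      then show "sqrt (u i) * poly (m j) (a i) / sqrt (v j) * (sqrt (u i) * poly q (a i)) = u i * (poly (m j) (a i) * poly q (a i)) / sqrt (v j)"
        by (simp add: field_simps)
    qed
    also have "\<dots> = (\<Sum>k<n. v k * (poly (m j) (b k) * poly q (b k))) / sqrt (v j)"
      using bil[OF m(1) that(2)] by simp
    also have "(\<Sum>k<n. v k * (poly (m j) (b k) * poly q (b k))) = (\<Sum>k<n. if k = j then v j * poly q (b j) else 0)"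
      by (rule sum.cong) (auto simp: m)
    also have "\<dots> / sqrt (v j) = sqrt (v j) * poly q (b j)"
      using that v[of j] by (simp add: field_simps)
    finally show ?thesis .
  qed
  have "(\<Sum>i<n. M j i * M k i) = (if j = k then 1 else 0)" if "j < n" "k < n" for j k
  proof -
    have "(\<Sum>i<n. M j i * M k i) = (\<Sum>i<n. M j i * (sqrt (u i) * poly (m k) (a i))) / sqrt (v k)"
      unfolding sum_divide_distrib by (rule sum.cong) (simp_all add: M_def)
    also have "\<dots> = sqrt (v j) * poly (m k) (b j) / sqrt (v k)" by (simp add: Mq that m)
    also have "\<dots> = (if j = k then 1 else 0)" using that v[of k] by (auto simp: m)
    finally show ?thesis .
  qed
  \<comment> \<open>The difference of the two quadratic forms is the divided difference of x q^2,
    that is its coefficient of degree 2 n - 1, which is the square of the coefficient of q of degree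
    n - 1. This makes the matrix with the larger eigenvalues dominate.\<close>
  moreover have "(\<Sum>i<n. a i * (h i)\<^sup>2) \<le> (\<Sum>j<n. b j * (\<Sum>i<n. M j i * h i)\<^sup>2)" for h
  proof -
    define q where "q = lagrange a n (\<lambda>i. h i / sqrt (u i))"
    have q: "degree q < n" "\<And>i. i < n \<Longrightarrow> sqrt (u i) * poly q (a i) = h i"
      unfolding q_def using n u by (auto simp: degree_lagrange poly_lagrange[OF inja] dest: less_imp_neq[OF u])
    let ?p = "pCons 0 (q * q)"
    have dq: "degree (q * q) < 2 * n - 1" using degree_mult_le[of q q] q(1) by linarith
    then have dp: "degree ?p < 2 * n" using degree_pCons_le[of 0 "q * q"] by linarith
    have "(\<Sum>i<n. M j i * h i) = sqrt (v j) * poly q (b j)" if "j < n" for j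
      using Mq[OF that q(1)] q(2) by simp
    then have "(\<Sum>j<n. b j * (\<Sum>i<n. M j i * h i)\<^sup>2) = (\<Sum>j<n. v j * poly ?p (b j))"
      using v by (intro sum.cong refl) (auto simp: power_mult_distrib power2_eq_square less_imp_le)
    moreover have "(\<Sum>i<n. a i * (h i)\<^sup>2) = (\<Sum>i<n. u i * poly ?p (a i))"
    proof (intro sum.cong refl)
      fix i assume i: "i \<in> {..<n}"
      then have "(h i)\<^sup>2 = u i * (poly q (a i))\<^sup>2"
        using q(2)[of i, symmetric] u[of i] by (simp add: power_mult_distrib)
      then show "a i * (h i)\<^sup>2 = u i * poly ?p (a i)" by (simp add: power2_eq_square)
    qed
    moreover have "0 \<le> coeff ?p (2 * n - 1)"
    proof -
      have "2 * n - 1 = Suc ((n - 1) + (n - 1))" using n by simp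
      then have "coeff ?p (2 * n - 1) = coeff (q * q) ((n - 1) + (n - 1))" by (simp only: coeff_pCons_Suc)
      also have "\<dots> = coeff q (n - 1) * coeff q (n - 1)"
      proof (cases "degree q = n - 1")
        case True
        then show ?thesis using coeff_mult_degree_sum[of q q] by simp
      next
        case False
        then have "degree q < n - 1" using q(1) by linarith
        then show ?thesis using degree_mult_le[of q q] by (simp add: coeff_eq_0)
      qed
      finally show ?thesis by simp
    qed
    ultimately show ?thesis using dd[OF dp] by simp
  qed
  moreover have "\<exists>h. (\<forall>i<n. (h i)\<^sup>2 = u i * (poly q (a i))\<^sup>2) \<and>
      (\<forall>j<n. (\<Sum>i<n. M j i * h i)\<^sup>2 = v j * (poly q (b j))\<^sup>2) \<and>
      (\<Sum>i<n. (h i)\<^sup>2) = (\<Sum>j<n. (\<Sum>i<n. M j i * h i)\<^sup>2)" if q: "degree q < n" for q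
  proof (intro exI[of _ "\<lambda>i. sqrt (u i) * poly q (a i)"] conjI allI impI)
    show 1: "(sqrt (u i) * poly q (a i))\<^sup>2 = u i * (poly q (a i))\<^sup>2" if "i < n" for i
      using u[OF that] by (simp add: power_mult_distrib)
    show 2: "(\<Sum>i<n. M j i * (sqrt (u i) * poly q (a i)))\<^sup>2 = v j * (poly q (b j))\<^sup>2" if "j < n" for j
      using v[OF that] by (simp add: Mq[OF that q] power_mult_distrib)
    show "(\<Sum>i<n. (sqrt (u i) * poly q (a i))\<^sup>2) = (\<Sum>j<n. (\<Sum>i<n. M j i * (sqrt (u i) * poly q (a i)))\<^sup>2)"
      using bil[OF q q] by (simp add: 1 2 power2_eq_square[of "poly q _"])
  qed
  ultimately show ?thesis unfolding a_def b_def u_def v_def by blast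
qed

subsection \<open>Functions of operators with finite spectrum\<close>

lemma orthogonal_idempotents_mult:
  fixes R :: "nat \<Rightarrow> ('a::real_normed_vector \<Rightarrow>\<^sub>L 'a)"
  assumes RR: "\<And>i j. i \<le> n \<Longrightarrow> j \<le> n \<Longrightarrow> R i o\<^sub>L R j = (if i = j then R i else 0)"
  shows "(\<Sum>j\<le>n. d j *\<^sub>R R j) o\<^sub>L (\<Sum>j\<le>n. e j *\<^sub>R R j) = (\<Sum>j\<le>n. (d j * e j) *\<^sub>R R j)"
proof -
  have "(\<Sum>j\<le>n. d j *\<^sub>R R j) o\<^sub>L (\<Sum>k\<le>n. e k *\<^sub>R R k) = (\<Sum>j\<le>n. d j *\<^sub>R R j o\<^sub>L (\<Sum>k\<le>n. e k *\<^sub>R R k))"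
    by (rule op_comp.sum_left)
  also have "\<dots> = (\<Sum>j\<le>n. \<Sum>k\<le>n. d j *\<^sub>R R j o\<^sub>L e k *\<^sub>R R k)"
    by (rule sum.cong[OF refl], rule op_comp.sum_right)
  also have "\<dots> = (\<Sum>j\<le>n. \<Sum>k\<le>n. if k = j then (d j * e j) *\<^sub>R R j else 0)"
    by (rule sum.cong[OF refl], rule sum.cong[OF refl]) (auto simp: RR op_comp_bilinear)
  finally show ?thesis by simp
qed

lemma poly_op_finite_spectrum:
  fixes R :: "nat \<Rightarrow> ('h::complex_hilbert_space \<Rightarrow>\<^sub>L 'h)"
  assumes RR: "\<And>i j. i \<le> n \<Longrightarrow> j \<le> n \<Longrightarrow> R i o\<^sub>L R j = (if i = j then R i else 0)"
    and R1: "(\<Sum>j\<le>n. R j) = id_blinfun"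
  shows "poly_op p (\<Sum>j\<le>n. d j *\<^sub>R R j) = (\<Sum>j\<le>n. poly p (d j) *\<^sub>R R j)"
proof -
  let ?T = "\<Sum>j\<le>n. d j *\<^sub>R R j"
  have pow: "((o\<^sub>L) ?T ^^ i) id_blinfun = (\<Sum>j\<le>n. d j ^ i *\<^sub>R R j)" for i
    by (induction i) (simp_all add: R1 orthogonal_idempotents_mult[OF RR])
  have "poly_op p ?T = (\<Sum>i\<le>degree p. \<Sum>j\<le>n. (coeff p i * d j ^ i) *\<^sub>R R j)"
    by (simp add: poly_op_def pow scaleR_sum_right)
  also have "\<dots> = (\<Sum>j\<le>n. \<Sum>i\<le>degree p. (coeff p i * d j ^ i) *\<^sub>R R j)" by (rule sum.swap)
  finally show ?thesis by (simp add: poly_altdef scaleR_sum_left)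
qed

text \<open>Some \<open>R j\<close> may vanish, and then \<open>d j\<close> can lie outside the
  spectrum. Existence uses that the spectrum is contained in the set of all \<open>d j\<close>, with
  a constant sequence of one interpolating polynomial; uniqueness uses that \<open>d j\<close> lies
  in it whenever \<open>R j\<close> is nonzero.\<close>

lemma fun_op_finite_spectrum:
  fixes R :: "nat \<Rightarrow> ('h::complex_hilbert_space \<Rightarrow>\<^sub>L 'h)"
  assumes Rb: "\<And>j. j \<le> n \<Longrightarrow> R j \<in> bounded_ops"
    and RR: "\<And>i j. i \<le> n \<Longrightarrow> j \<le> n \<Longrightarrow> R i o\<^sub>L R j = (if i = j then R i else 0)"
    and R1: "(\<Sum>j\<le>n. R j) = id_blinfun"
  shows "fun_op f (\<Sum>j\<le>n. d j *\<^sub>R R j) = (\<Sum>j\<le>n. f (d j) *\<^sub>R R j)"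
proof -
  define T where "T e = (\<Sum>j\<le>n. e j *\<^sub>R R j)" for e
  have poly_T: "poly_op p (T e) = T (\<lambda>j. poly p (e j))" for p e
    unfolding T_def by (rule poly_op_finite_spectrum[OF RR R1])
  have T_mult: "T e o\<^sub>L T e' = T (\<lambda>j. e j * e' j)" for e e'
    unfolding T_def by (rule orthogonal_idempotents_mult[OF RR])
  have T_b: "T e \<in> bounded_ops" for e
  proof -
    have "(\<Sum>j\<in>J. e j *\<^sub>R R j) \<in> bounded_ops" if "finite J" "J \<subseteq> {..n}" for J
      using that by (induction J rule: finite_induct)
        (auto intro!: bounded_ops_zero bounded_ops_add bounded_ops_scaleR Rb)
    then show ?thesis by (simp add: T_def)
  qed
  have T_shift: "T d - t *\<^sub>R id_blinfun = T (\<lambda>j. d j - t)" for t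
    by (simp add: T_def scaleR_diff_left sum_subtractf R1[symmetric] scaleR_sum_right)
  have spec_sub: "real_spectrum (T d) \<subseteq> d ` {..n}"
  proof
    fix t assume t: "t \<in> real_spectrum (T d)"
    show "t \<in> d ` {..n}"
    proof (rule ccontr)
      assume nt: "t \<notin> d ` {..n}"
      have "T (\<lambda>j. (d j - t) * (1 / (d j - t))) = id_blinfun"
        unfolding T_def R1[symmetric] using nt by (intro sum.cong) auto
      then have "T (\<lambda>j. d j - t) o\<^sub>L T (\<lambda>j. 1 / (d j - t)) = id_blinfun"
        "T (\<lambda>j. 1 / (d j - t)) o\<^sub>L T (\<lambda>j. d j - t) = id_blinfun"
        by (simp_all add: T_mult mult.commute)
      then have "invertible_op (T (\<lambda>j. d j - t))"
        unfolding invertible_op_def using T_b by (intro bexI[of _ "T (\<lambda>j. 1 / (d j - t))"]) auto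
      then show False using t by (simp add: real_spectrum_def T_shift)
    qed
  qed
  have in_spec: "d j \<in> real_spectrum (T d)" if j: "j \<le> n" and nz: "R j \<noteq> 0" for j
  proof (rule ccontr)
    assume "d j \<notin> real_spectrum (T d)"
    then have "invertible_op (T (\<lambda>i. d i - d j))" by (simp add: real_spectrum_def T_shift)
    then obtain S where S: "T (\<lambda>i. d i - d j) o\<^sub>L S = id_blinfun" unfolding invertible_op_def by blast
    have "R j = T (\<lambda>i. if i = j then 1 else 0)"
    proof -
      have "T (\<lambda>i. if i = j then 1 else 0) = (\<Sum>i\<le>n. if i = j then R j else 0)"
        unfolding T_def by (rule sum.cong) auto
      then show ?thesis using j by simp
    qed
    then have "R j o\<^sub>L T (\<lambda>i. d i - d j) = T (\<lambda>i. (if i = j then 1 else 0) * (d i - d j))"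
      by (simp only: T_mult)
    also have "\<dots> = 0" unfolding T_def by (rule sum.neutral) auto
    finally have "(R j o\<^sub>L T (\<lambda>i. d i - d j)) o\<^sub>L S = 0" by simp
    then show False using nz by (simp add: op_comp_assoc S)
  qed
  show ?thesis unfolding T_def[symmetric] fun_op_def
  proof (rule the_equality)
    have fin: "finite (d ` {..n})" by simp
    obtain p :: "real poly" where p: "\<And>x. x \<in> d ` {..n} \<Longrightarrow> poly p x = f x"
    proof -
      obtain g :: "nat \<Rightarrow> real" where g: "bij_betw g {..<card (d ` {..n})} (d ` {..n})"
        using ex_bij_betw_nat_finite[OF fin] by (auto simp: atLeast0LessThan)
      have "poly (lagrange g (card (d ` {..n})) (\<lambda>k. f (g k))) x = f x" if "x \<in> d ` {..n}" for x
      proof -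
        have "x \<in> g ` {..<card (d ` {..n})}" using g that by (simp only: bij_betw_def)
        then obtain k where "k < card (d ` {..n})" "x = g k" by blast
        then show ?thesis using poly_lagrange[of g "card (d ` {..n})" k] g by (simp add: bij_betw_def)
      qed
      then show ?thesis by (rule that)
    qed
    have "uniform_limit (real_spectrum (T d)) (\<lambda>_. poly p) f sequentially"
      using p spec_sub by (intro uniform_limitI) (auto simp: subset_iff)
    moreover have "poly_op p (T d) = T (\<lambda>j. f (d j))"
      unfolding poly_T by (simp add: T_def p)
    ultimately show "\<exists>p. uniform_limit (real_spectrum (T d)) (\<lambda>n. poly (p n)) f sequentially \<and>
        (\<lambda>n. poly_op (p n) (T d)) \<longlonglongrightarrow> T (\<lambda>j. f (d j))"
      by (intro exI[of _ "\<lambda>_. p"]) simp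
  next
    fix S
    assume "\<exists>p. uniform_limit (real_spectrum (T d)) (\<lambda>n. poly (p n)) f sequentially \<and>
        (\<lambda>n. poly_op (p n) (T d)) \<longlonglongrightarrow> S"
    then obtain p where p: "uniform_limit (real_spectrum (T d)) (\<lambda>n. poly (p n)) f sequentially"
      and S: "(\<lambda>n. poly_op (p n) (T d)) \<longlonglongrightarrow> S" by (elim exE conjE)
    have "(\<lambda>k. poly (p k) (d j) *\<^sub>R R j) \<longlonglongrightarrow> f (d j) *\<^sub>R R j" if "j \<le> n" for j
    proof (cases "R j = 0")
      case False
      then show ?thesis using tendsto_uniform_limitI[OF p in_spec[OF that]] by (intro tendsto_intros)
    qed simp
    then have "(\<lambda>k. T (\<lambda>j. poly (p k) (d j))) \<longlonglongrightarrow> T (\<lambda>j. f (d j))"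
      unfolding T_def by (intro tendsto_sum) auto
    with S show "S = T (\<lambda>j. f (d j))" unfolding poly_T by (rule LIMSEQ_unique)
  qed
qed

subsection \<open>Diagonal operators\<close>

text \<open>A crude Cauchy-Schwarz bound, from real and imaginary part separately; the constant only
  has to make \<open>rank1\<close> bounded.\<close>

lemma cmod_cinner_le: "cmod (cinner x y) \<le> 2 * (norm x * norm (y::'h::complex_hilbert_space))"
proof -
  have "cmod (cinner x y) \<le> \<bar>Re (cinner x y)\<bar> + \<bar>Im (cinner x y)\<bar>" by (rule cmod_le)
  also have "\<dots> = \<bar>inner x y\<bar> + \<bar>inner x (\<i> *\<^sub>C y)\<bar>" by (simp add: inner_eq_Re_cinner[of x y] Im_cinner)
  also have "\<dots> \<le> norm x * norm y + norm x * norm (\<i> *\<^sub>C y)" by (intro add_mono Cauchy_Schwarz_ineq2)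
  finally show ?thesis by (simp add: norm_scaleC)
qed

definition rank1 :: "'h::complex_hilbert_space \<Rightarrow> ('h \<Rightarrow>\<^sub>L 'h)" where
  "rank1 y = Blinfun (\<lambda>x. cinner x y *\<^sub>C y)"

lemma rank1_apply: "rank1 y x = cinner x y *\<^sub>C y"
proof -
  have "bounded_linear (\<lambda>x. cinner x y *\<^sub>C y)"
  proof (rule bounded_linear_intro[of _ "2 * norm y * norm y"])
    show "cinner (x + z) y *\<^sub>C y = cinner x y *\<^sub>C y + cinner z y *\<^sub>C y" for x z
      by (simp add: cinner_add_left scaleC_add_left)
    show "cinner (r *\<^sub>R x) y *\<^sub>C y = r *\<^sub>R cinner x y *\<^sub>C y" for r x
      by (simp add: cinner_scaleC_left scaleC_scaleC flip: scaleC_of_real)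
    show "norm (cinner x y *\<^sub>C y) \<le> norm x * (2 * norm y * norm y)" for x
      using mult_right_mono[OF cmod_cinner_le[of x y], of "norm y"] by (simp add: norm_scaleC mult_ac)
  qed
  then show ?thesis by (simp add: rank1_def bounded_linear_Blinfun_apply)
qed

lemma rank1_form: "inner (rank1 y x) x = (cmod (cinner x y))\<^sup>2"
proof -
  have "inner (rank1 y x) x = Re (cinner x y * cnj (cinner x y))"
    by (simp add: inner_eq_Re_cinner rank1_apply cinner_scaleC_left cinner_commute[of y x])
  then show ?thesis by (simp only: complex_norm_square[symmetric] Re_complex_of_real)
qed

lemma rank1_pos: "rank1 y \<in> pos_ops"
proof (rule pos_opsI)
  have "inner (rank1 y x) z = inner x (rank1 y z)" for x z
    by (simp add: inner_eq_Re_cinner rank1_apply cinner_scaleC_left cinner_scaleC_right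
        cinner_commute[of y z] mult.commute)
  moreover have "rank1 y \<in> bounded_ops"
    by (rule bounded_opsI) (simp add: rank1_apply cinner_scaleC_left scaleC_scaleC)
  ultimately show "selfadj (rank1 y)" by (simp add: selfadj_def)
qed (simp add: rank1_form)

lemma sum_rank1_pos:
  fixes n :: nat
  assumes "\<And>j. j < n \<Longrightarrow> 0 \<le> d j"
  shows "(\<Sum>j<n. d j *\<^sub>R rank1 (y j)) \<in> pos_ops"
  using assms by (induction n) (auto intro!: pos_ops_add pos_ops_scaleR pos_ops_zero rank1_pos)

lemma sum_rank1_form: "inner ((\<Sum>j<n::nat. d j *\<^sub>R rank1 (y j)) x) x = (\<Sum>j<n. d j * (cmod (cinner x (y j)))\<^sup>2)"
  by (simp add: op_apply inner_sum_left rank1_form)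

lemma scaleC_zero_left: "0 *\<^sub>C (x::'h::complex_hilbert_space) = 0"
  using scaleC_of_real[of 0 x] by simp

text \<open>On the orthogonal complement of the y j the operator is 0, so f contributes f 0 times
  the projection onto it. That projection is added to the family as the idempotent with index
  n.\<close>

lemma fun_op_diagonal_form:
  fixes y :: "nat \<Rightarrow> 'h::complex_hilbert_space"
  assumes y: "\<And>i j. i < n \<Longrightarrow> j < n \<Longrightarrow> cinner (y i) (y j) = (if i = j then 1 else 0)"
  shows "inner (fun_op f (\<Sum>j<n. d j *\<^sub>R rank1 (y j)) x) x
    = (\<Sum>j<n. f (d j) * (cmod (cinner x (y j)))\<^sup>2) + f 0 * ((norm x)\<^sup>2 - (\<Sum>j<n. (cmod (cinner x (y j)))\<^sup>2))"
proof -
  define P where "P = (\<Sum>j<n. rank1 (y j))"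
  define R where "R j = (if j = n then id_blinfun - P else rank1 (y j))" for j
  have yy: "rank1 (y i) o\<^sub>L rank1 (y j) = (if i = j then rank1 (y i) else 0)" if "i < n" "j < n" for i j
    by (rule blinfun_eqI) (use that in \<open>auto simp: rank1_apply cinner_scaleC_left y op_apply scaleC_zero_left\<close>)
  have yP: "rank1 (y i) o\<^sub>L P = rank1 (y i)" if "i < n" for i
  proof -
    have "rank1 (y i) o\<^sub>L P = (\<Sum>j<n. rank1 (y i) o\<^sub>L rank1 (y j))"
      unfolding P_def by (rule op_comp.sum_right)
    also have "\<dots> = (\<Sum>j<n. if i = j then rank1 (y i) else 0)"
      by (rule sum.cong) (use that in \<open>auto simp: yy\<close>)
    finally show ?thesis using that by simp
  qed
  have Py: "P o\<^sub>L rank1 (y i) = rank1 (y i)" if "i < n" for i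
  proof -
    have "P o\<^sub>L rank1 (y i) = (\<Sum>j<n. rank1 (y j) o\<^sub>L rank1 (y i))"
      unfolding P_def by (rule op_comp.sum_left)
    also have "\<dots> = (\<Sum>j<n. if j = i then rank1 (y i) else 0)"
      by (rule sum.cong) (use that in \<open>auto simp: yy\<close>)
    finally show ?thesis using that by simp
  qed
  have PP: "P o\<^sub>L P = P"
  proof -
    have "P o\<^sub>L P = (\<Sum>j<n. rank1 (y j) o\<^sub>L P)"
      unfolding P_def by (rule op_comp.sum_left)
    also have "\<dots> = P" by (simp add: yP) (simp add: P_def)
    finally show ?thesis .
  qed
  have Rb: "R j \<in> bounded_ops" for j
  proof -
    have "P \<in> pos_ops" using sum_rank1_pos[of n "\<lambda>_. 1" y] by (simp add: P_def)
    then show ?thesis by (auto simp: R_def intro: bounded_ops_diff bounded_ops_id pos_ops_bounded rank1_pos)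
  qed
  have RR: "R i o\<^sub>L R j = (if i = j then R i else 0)" if "i \<le> n" "j \<le> n" for i j
    using that by (auto simp: R_def op_comp_bilinear yy yP Py PP)
  have split: "(\<Sum>j\<le>n. e j *\<^sub>R R j) = (\<Sum>j<n. e j *\<^sub>R rank1 (y j)) + e n *\<^sub>R (id_blinfun - P)" for e
  proof -
    have "(\<Sum>j\<le>n. e j *\<^sub>R R j) = (\<Sum>j<n. e j *\<^sub>R R j) + e n *\<^sub>R R n"
      by (simp flip: lessThan_Suc_atMost)
    moreover have "(\<Sum>j<n. e j *\<^sub>R R j) = (\<Sum>j<n. e j *\<^sub>R rank1 (y j))"
      by (rule sum.cong) (auto simp: R_def)
    ultimately show ?thesis by (simp add: R_def)
  qed
  have R1: "(\<Sum>j\<le>n. R j) = id_blinfun" using split[of "\<lambda>_. 1"] by (simp add: P_def)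
  define d' where "d' j = (if j = n then 0 else d j)" for j
  have e1: "(\<Sum>j<n. d' j *\<^sub>R rank1 (y j)) = (\<Sum>j<n. d j *\<^sub>R rank1 (y j))"
    and e2: "(\<Sum>j<n. f (d' j) *\<^sub>R rank1 (y j)) = (\<Sum>j<n. f (d j) *\<^sub>R rank1 (y j))"
    by (auto simp: d'_def intro!: sum.cong)
  have "fun_op f (\<Sum>j<n. d j *\<^sub>R rank1 (y j)) = (\<Sum>j<n. f (d j) *\<^sub>R rank1 (y j)) + f 0 *\<^sub>R (id_blinfun - P)"
    using fun_op_finite_spectrum[OF Rb RR R1, of f d'] unfolding split e1 e2 by (simp add: d'_def)
  moreover have "inner (P x) x = (\<Sum>j<n. (cmod (cinner x (y j)))\<^sup>2)"
    using sum_rank1_form[where d = "\<lambda>_. 1" and n = n and y = y and x = x] by (simp add: P_def)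
  ultimately show ?thesis
    by (simp only: blinfun.add_left blinfun.diff_left blinfun.scaleR_left inner_add_left inner_diff_left
        inner_scaleR_left blinfun_apply_id_blinfun sum_rank1_form power2_norm_eq_inner[of x])
qed

section \<open>From operator monotonicity on the sequence space to divided differences\<close>

lift_definition ell2_unit :: "nat \<Rightarrow> ell2" is "\<lambda>i n. if n = i then 1 else 0"
  by (rule summable_finite[of "{i}" for i]) auto

lemma cinner_ell2_unit: "cinner x (ell2_unit i) = ell2_coord x i"
proof -
  have "cinner x (ell2_unit i) = (\<Sum>n. if n = i then ell2_coord x i else 0)"
    unfolding cinner_ell2_def by (rule suminf_cong) (simp add: ell2_unit.rep_eq)
  also have "\<dots> = ell2_coord x i" using sums_single[of i "\<lambda>_. ell2_coord x i"] by (simp add: sums_iff)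
  finally show ?thesis .
qed

lemma cinner_sum_right: "cinner x (\<Sum>i\<in>S. g i) = (\<Sum>i\<in>S. cinner x (g i :: 'h::complex_hilbert_space))"
proof -
  have "cinner x 0 = 0" using cinner_add_right[of x 0 0] by simp
  then show ?thesis by (induction S rule: infinite_finite_induct) (simp_all add: cinner_add_right)
qed

lemma cinner_scaleR_right: "cinner x (r *\<^sub>R y) = of_real r * cinner x (y::'h::complex_hilbert_space)"
  by (simp add: cinner_scaleC_right flip: scaleC_of_real)

text \<open>Operators A \<le> B of finite rank are built with the even- and the odd-indexed nodes as
  eigenvalues, their eigenvectors linked by the orthogonal matrix M. Then f(A) \<le> f(B) is tested
  on the vector that corresponds to q.\<close>

lemma operator_monotone_divided_difference:
  assumes f: "operator_monotone f" and n: "0 < n" and c: "strict_mono_on {..<2 * n} c" and c0: "0 \<le> c 0"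
    and q: "degree q < n"
  shows "0 \<le> (\<Sum>k<2 * n. f (c k) * (poly q (c k))\<^sup>2 / nodal c (2 * n) k)"
proof -
  define w where "w k = 1 / nodal c (2 * n) k" for k
  from interlacing_orthogonal_matrix[OF n c, folded w_def] obtain M where
    M1: "\<forall>j<n. \<forall>k<n. (\<Sum>i<n. M j i * M k i) = (if j = k then 1 else 0)" and
    M2: "\<forall>h. (\<Sum>i<n. c (2 * i) * (h i)\<^sup>2) \<le> (\<Sum>j<n. c (2 * j + 1) * (\<Sum>i<n. M j i * h i)\<^sup>2)" and
    M3: "\<forall>q. degree q < n \<longrightarrow> (\<exists>h. (\<forall>i<n. (h i)\<^sup>2 = - w (2 * i) * (poly q (c (2 * i)))\<^sup>2) \<and>
      (\<forall>j<n. (\<Sum>i<n. M j i * h i)\<^sup>2 = w (2 * j + 1) * (poly q (c (2 * j + 1)))\<^sup>2) \<and>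
      (\<Sum>i<n. (h i)\<^sup>2) = (\<Sum>j<n. (\<Sum>i<n. M j i * h i)\<^sup>2))"
    by (elim exE conjE)
  from M3 q obtain h where
    h1: "\<forall>i<n. (h i)\<^sup>2 = - w (2 * i) * (poly q (c (2 * i)))\<^sup>2" and
    h2: "\<forall>j<n. (\<Sum>i<n. M j i * h i)\<^sup>2 = w (2 * j + 1) * (poly q (c (2 * j + 1)))\<^sup>2" and
    h3: "(\<Sum>i<n. (h i)\<^sup>2) = (\<Sum>j<n. (\<Sum>i<n. M j i * h i)\<^sup>2)" by blast
  define y where "y j = (\<Sum>i<n. M j i *\<^sub>R ell2_unit i)" for j
  have y_coord: "ell2_coord (\<Sum>i<n. g i *\<^sub>R ell2_unit i) k = (if k < n then of_real (g k) else 0)" for g k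
  proof -
    have "ell2_coord (\<Sum>i<m. g i *\<^sub>R ell2_unit i) k = (if k < m then of_real (g k) else 0)" for m
      by (induction m) (auto simp: ell2_unit.rep_eq less_Suc_eq)
    then show ?thesis .
  qed
  have cy: "cinner x (y j) = (\<Sum>i<n. of_real (M j i) * ell2_coord x i)" for x j
    by (simp add: y_def cinner_sum_right cinner_scaleR_right cinner_ell2_unit)
  have yy: "cinner (y i) (y j) = (if i = j then 1 else 0)" if "i < n" "j < n" for i j
  proof -
    have "cinner (y i) (y j) = of_real (\<Sum>k<n. M j k * M i k)"
      unfolding cy by (simp add: y_def y_coord)
    also have "\<dots> = (if i = j then 1 else 0)" using M1 that by simp
    finally show ?thesis .
  qed
  have ee: "cinner (ell2_unit i) (ell2_unit j) = (if i = j then 1 else 0)" for i j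
    by (simp add: cinner_ell2_unit ell2_unit.rep_eq)
  let ?A = "\<Sum>i<n. c (2 * i) *\<^sub>R rank1 (ell2_unit i)" let ?B = "\<Sum>j<n. c (2 * j + 1) *\<^sub>R rank1 (y j)"
  have cpos: "0 \<le> c k" if "k < 2 * n" for k
    using c0 strict_mono_onD[OF c, of 0 k] that by (cases "k = 0") auto
  have A: "?A \<in> pos_ops" and B: "?B \<in> pos_ops" by (auto intro!: sum_rank1_pos cpos)
  have "?A \<preceq> ?B"
  proof -
    have "inner (?A x) x \<le> inner (?B x) x" for x
    proof -
      \<comment> \<open>M is real, so real and imaginary parts of the coordinates can be compared
        separately.\<close>
      let ?r = "\<lambda>i. Re (ell2_coord x i)" and ?s = "\<lambda>i. Im (ell2_coord x i)"
      have "inner (?A x) x = (\<Sum>i<n. c (2 * i) * (?r i)\<^sup>2) + (\<Sum>i<n. c (2 * i) * (?s i)\<^sup>2)"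
        unfolding sum_rank1_form
        by (simp add: cinner_ell2_unit cmod_power2 distrib_left sum.distrib)
      also have "\<dots> \<le> (\<Sum>j<n. c (2 * j + 1) * (\<Sum>i<n. M j i * ?r i)\<^sup>2) + (\<Sum>j<n. c (2 * j + 1) * (\<Sum>i<n. M j i * ?s i)\<^sup>2)"
        by (intro add_mono M2[rule_format])
      also have "\<dots> = inner (?B x) x"
        unfolding sum_rank1_form by (simp add: cy cmod_power2 distrib_left sum.distrib)
      finally show ?thesis .
    qed
    then show ?thesis using A B by (simp add: loewner_iff pos_ops_selfadj)
  qed
  then have le: "fun_op f ?A \<preceq> fun_op f ?B" using f A B by (simp add: operator_monotone_def)
  \<comment> \<open>The test vector for q. By h3 it has the same norm as its projection onto the
    span of the y j; hence the terms with f 0, which stem from the complements, vanish for both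
    operators.\<close>
  define x where "x = (\<Sum>i<n. h i *\<^sub>R ell2_unit i)"
  have xe: "cinner x (ell2_unit i) = of_real (h i)" if "i < n" for i
    using that by (simp add: x_def cinner_ell2_unit y_coord)
  have xy: "cinner x (y j) = of_real (\<Sum>i<n. M j i * h i)" for j
    by (simp add: cy x_def y_coord)
  have xx: "(norm x)\<^sup>2 = (\<Sum>i<n. (h i)\<^sup>2)"
  proof -
    have "cinner x x = (\<Sum>i<n. of_real (h i) * ell2_coord x i)"
      by (subst (2) x_def) (simp add: cinner_sum_right cinner_scaleR_right cinner_ell2_unit)
    also have "\<dots> = of_real (\<Sum>i<n. (h i)\<^sup>2)" by (simp add: x_def y_coord power2_eq_square)
    finally show ?thesis by (simp add: power2_norm_eq_inner inner_eq_Re_cinner)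
  qed
  have "(\<Sum>i<n. f (c (2 * i)) * (h i)\<^sup>2) \<le> (\<Sum>j<n. f (c (2 * j + 1)) * (\<Sum>i<n. M j i * h i)\<^sup>2)"
  proof -
    have "inner (fun_op f ?A x) x = (\<Sum>i<n. f (c (2 * i)) * (h i)\<^sup>2)"
      by (subst fun_op_diagonal_form) (simp_all add: ee xe xx)
    moreover have "inner (fun_op f ?B x) x = (\<Sum>j<n. f (c (2 * j + 1)) * (\<Sum>i<n. M j i * h i)\<^sup>2)"
      by (subst fun_op_diagonal_form) (simp_all add: yy xy xx h3 norm_of_real del: of_real_sum)
    ultimately show ?thesis using loewnerD[OF le, of x] by simp
  qed
  then have "(\<Sum>i<n. f (c (2 * i)) * (- w (2 * i) * (poly q (c (2 * i)))\<^sup>2))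
      \<le> (\<Sum>j<n. f (c (2 * j + 1)) * (w (2 * j + 1) * (poly q (c (2 * j + 1)))\<^sup>2))"
    using h1 h2 by simp
  then have "0 \<le> (\<Sum>k<2 * n. f (c k) * (w k * (poly q (c k))\<^sup>2))"
    by (simp add: sum_even_odd sum_negf)
  then show ?thesis by (simp add: w_def)
qed

subsection \<open>Polynomials that are nonnegative on the half-line\<close>

text \<open>The number d bounds the degree of each summand. For d = 2 n - 1 it forces degree r < n
  in both kinds of generators, the range in which divided differences over 2 n nodes have a known
  sign.\<close>

inductive halfline_sos :: "nat \<Rightarrow> real poly \<Rightarrow> bool" where
  square: "2 * degree r \<le> d \<Longrightarrow> halfline_sos d (r * r)"
| shifted_square: "2 * degree r + 1 \<le> d \<Longrightarrow> halfline_sos d ([:0, 1:] * (r * r))"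
| add: "halfline_sos d p \<Longrightarrow> halfline_sos d q \<Longrightarrow> halfline_sos d (p + q)"

lemma halfline_sos_mono: "halfline_sos d p \<Longrightarrow> d \<le> e \<Longrightarrow> halfline_sos e p"
proof (induction rule: halfline_sos.induct)
  case (square r d)
  then show ?case by (intro halfline_sos.square) linarith
next
  case (shifted_square r d)
  then show ?case by (intro halfline_sos.shifted_square) linarith
qed (blast intro: halfline_sos.add)

text \<open>The only product of generators that changes its kind is that of two shifted squares: (x
  r^2) (x s^2) = (x r s)^2.\<close>

lemma halfline_sos_mult:
  assumes "halfline_sos d p" "halfline_sos e q"
  shows "halfline_sos (d + e) (p * q)"
  using assms(1)
proof (induction rule: halfline_sos.induct)
  case (square r d)
  show ?case using assms(2)
  proof (induction rule: halfline_sos.induct)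
    case (square s e)
    have "halfline_sos (d + e) ((r * s) * (r * s))"
      using square \<open>2 * degree r \<le> d\<close> degree_mult_le[of r s] by (intro halfline_sos.square) linarith
    then show ?case by (simp only: mult_ac)
  next
    case (shifted_square s e)
    have "halfline_sos (d + e) ([:0, 1:] * ((r * s) * (r * s)))"
      using shifted_square \<open>2 * degree r \<le> d\<close> degree_mult_le[of r s] by (intro halfline_sos.shifted_square) linarith
    then show ?case by (simp only: mult_ac)
  next
    case (add e p q)
    then show ?case by (simp only: distrib_left halfline_sos.add)
  qed
next
  case (shifted_square r d)
  show ?case using assms(2)
  proof (induction rule: halfline_sos.induct)
    case (square s e)
    have "halfline_sos (d + e) ([:0, 1:] * ((r * s) * (r * s)))"
      using square \<open>2 * degree r + 1 \<le> d\<close> degree_mult_le[of r s] by (intro halfline_sos.shifted_square) linarith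
    then show ?case by (simp only: mult_ac)
  next
    case (shifted_square s e)
    have "degree ([:0, 1:] * (r * s)) \<le> 1 + (degree r + degree s)"
      using degree_mult_le[of "[:0, 1:]" "r * s"] degree_mult_le[of r s] by simp
    then have "halfline_sos (d + e) (([:0, 1:] * (r * s)) * ([:0, 1:] * (r * s)))"
      using shifted_square \<open>2 * degree r + 1 \<le> d\<close> by (intro halfline_sos.square) linarith
    then show ?case by (simp only: mult_ac)
  next
    case (add e p q)
    then show ?case by (simp only: distrib_left halfline_sos.add)
  qed
next
  case (add d p q)
  then show ?case by (simp only: distrib_right halfline_sos.add)
qed

lemma poly_ge_limit_right:
  fixes g :: "real poly"
  assumes "\<And>x. c < x \<Longrightarrow> 0 \<le> poly g x"
  shows "0 \<le> poly g c"
proof (rule LIMSEQ_le_const)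
  have "(\<lambda>n. c + 1 / real (Suc n)) \<longlonglongrightarrow> c + 0"
    by (intro tendsto_intros LIMSEQ_Suc lim_1_over_n)
  then have "(\<lambda>n. poly g (c + 1 / real (Suc n))) \<longlonglongrightarrow> poly g (c + 0)"
    by (intro isCont_tendsto_compose[of "c + 0" "poly g"]) simp_all
  then show "(\<lambda>n. poly g (c + 1 / real (Suc n))) \<longlonglongrightarrow> poly g c" by simp
qed (auto intro!: assms exI[of _ 0])

section \<open>Roots and factors of real polynomials\<close>

lemma poly_map_of_real_add:
  "poly (map_poly complex_of_real (p + q)) z = poly (map_poly complex_of_real p) z + poly (map_poly complex_of_real q) z"
proof -
  have "map_poly complex_of_real (p + q) = map_poly complex_of_real p + map_poly complex_of_real q"
    by (rule poly_eqI) (simp add: coeff_map_poly)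
  then show ?thesis by simp
qed

lemma poly_map_of_real_mult:
  "poly (map_poly complex_of_real (p * q)) z = poly (map_poly complex_of_real p) z * poly (map_poly complex_of_real q) z"
proof -
  have "map_poly complex_of_real (smult a q) = smult (of_real a) (map_poly complex_of_real q)" for a
    by (rule poly_eqI) (simp add: coeff_map_poly)
  then show ?thesis
    by (induction p) (simp_all add: map_poly_pCons poly_map_of_real_add algebra_simps)
qed

lemma poly_map_of_real_of_real: "poly (map_poly complex_of_real p) (of_real x) = of_real (poly p x)"
  by (induction p) (simp_all add: map_poly_pCons)

text \<open>The remainder modulo the quadratic has degree at most 1 and a nonreal root, so it is
  0.\<close>

lemma real_quadratic_dvd:
  fixes p :: "real poly" and z :: complex
  assumes "poly (map_poly complex_of_real p) z = 0" "Im z \<noteq> 0"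
  shows "[:(cmod z)\<^sup>2, - 2 * Re z, 1:] dvd p"
proof -
  let ?m = "[:(cmod z)\<^sup>2, - 2 * Re z, 1:]" let ?r = "p mod ?m"
  have mz: "poly (map_poly complex_of_real ?m) z = 0"
    by (rule complex_eqI; simp add: map_poly_pCons cmod_power2; simp add: power2_eq_square algebra_simps)
  have "degree ?r < degree ?m \<or> ?r = 0" using degree_mod_less[of ?m p] by auto
  then have "degree ?r \<le> 1" by auto
  then have r: "?r = [:coeff ?r 0, coeff ?r 1:]"
    by (intro poly_eqI) (auto simp: coeff_pCons coeff_eq_0 split: nat.split)
  have "poly (map_poly complex_of_real (?m * (p div ?m) + ?r)) z = 0"
    using assms(1) by (simp only: mult_div_mod_eq)
  then have "poly (map_poly complex_of_real ?r) z = 0"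
    by (simp only: poly_map_of_real_add poly_map_of_real_mult mz mult_zero_left add_0_left)
  then have *: "of_real (coeff ?r 0) + z * of_real (coeff ?r 1) = 0"
    by (subst (asm) r) (simp add: map_poly_pCons)
  have "coeff ?r 1 = 0" using arg_cong[OF *, of Im] assms(2) by simp
  moreover from this have "coeff ?r 0 = 0" using * by simp
  ultimately have "?r = 0" using r by simp
  then show ?thesis by (simp add: dvd_eq_mod_eq_0)
qed

lemma halfline_sos_const: "0 \<le> a \<Longrightarrow> halfline_sos d [:a:]"
  using halfline_sos.square[of "[:sqrt a:]" d] by simp

text \<open>Induction on the degree, splitting off a factor at a complex root z. A nonreal root
  gives (x - Re z)^2 + (Im z)^2, a real root c \<le> 0 gives x + (-c), a root c > 0 gives (x - c)^2.
  Each factor is in the cone and leaves a cofactor that is nonnegative on the half-line.\<close>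

lemma nonneg_imp_halfline_sos:
  fixes p :: "real poly"
  assumes "\<And>x. 0 \<le> x \<Longrightarrow> 0 \<le> poly p x"
  shows "halfline_sos (degree p) p"
  using assms
proof (induction "degree p" arbitrary: p rule: less_induct)
  case less
  note nonneg = less.prems
  show ?case
  proof (cases "degree p = 0")
    case True
    then obtain a where "p = [:a:]" by (rule degree_eq_zeroE)
    then show ?thesis using nonneg[of 0] by (simp add: halfline_sos_const)
  next
    case False
    then have "p \<noteq> 0" by auto
    have factor: "halfline_sos (degree p) p"
      if pm: "p = m * g" and sm: "halfline_sos (degree m) m" and dm: "0 < degree m"
        and g: "\<And>x. 0 \<le> x \<Longrightarrow> 0 \<le> poly g x" for m g
    proof -
      have "degree p = degree m + degree g" using \<open>p \<noteq> 0\<close> by (simp add: pm degree_mult_eq)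
      then show ?thesis using halfline_sos_mult[OF sm less.hyps[OF _ g]] dm by (simp add: pm)
    qed
    have "\<not> constant (poly (map_poly complex_of_real p))"
      using False by (simp add: degree_map_poly constant_degree)
    from fundamental_theorem_of_algebra[OF this]
    obtain z where z: "poly (map_poly complex_of_real p) z = 0" ..
    show ?thesis
    proof (cases "Im z = 0")
      case False
      let ?m = "[:(cmod z)\<^sup>2, - 2 * Re z, 1:]"
      obtain g where g: "p = ?m * g" using real_quadratic_dvd[OF z False] by (elim dvdE)
      have m_eq: "?m = [:- Re z, 1:] * [:- Re z, 1:] + [:Im z:] * [:Im z:]"
        by (simp add: cmod_power2) (simp add: power2_eq_square)
      have mpos: "0 < poly ?m x" for x
        unfolding m_eq using False by (simp add: add_nonneg_pos flip: power2_eq_square)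
      show ?thesis
      proof (rule factor[OF g])
        show "halfline_sos (degree ?m) ?m"
          unfolding m_eq by (intro halfline_sos.intros) (simp_all add: numeral_2_eq_2)
        show "0 \<le> poly g x" if "0 \<le> x" for x
          using nonneg[OF that] mpos[of x] unfolding g poly_mult by (simp only: zero_le_mult_iff) linarith
      qed simp
    next
      case True
      define c where "c = Re z"
      have "z = of_real c" using True by (simp add: c_def complex_eq_iff)
      with z have "poly p c = 0" by (simp add: poly_map_of_real_of_real)
      then obtain g where g: "p = [:- c, 1:] * g" unfolding poly_eq_0_iff_dvd by (elim dvdE)
      have gr: "0 \<le> poly g x" if "0 \<le> x" "c < x" for x
      proof -
        have "0 \<le> (x - c) * poly g x" using nonneg[OF that(1)] unfolding g poly_mult by simp
        then show ?thesis using that(2) by (simp add: zero_le_mult_iff)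
      qed
      show ?thesis
      proof (cases "c \<le> 0")
        case True
        show ?thesis
        proof (rule factor[OF g])
          have eq: "[:- c, 1:] = [:sqrt (- c):] * [:sqrt (- c):] + [:0, 1:] * ([:1:] * [:1:])"
            using True by simp
          have "halfline_sos 1 ([:sqrt (- c):] * [:sqrt (- c):] + [:0, 1:] * ([:1:] * [:1:]))"
            by (intro halfline_sos.add halfline_sos.square halfline_sos.shifted_square) simp_all
          then show "halfline_sos (degree [:- c, 1:]) [:- c, 1:]"
            unfolding eq[symmetric] by simp
          show "0 \<le> poly g x" if "0 \<le> x" for x
          proof (rule poly_ge_limit_right)
            show "0 \<le> poly g y" if "x < y" for y using gr[of y] that \<open>0 \<le> x\<close> True by simp
          qed
        qed simp
      next
        case False
        then have "0 < c" by simp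
        \<comment> \<open>The polynomial p = (x - c) g cannot change its sign at an interior point,
          so c must be a double root: g is nonnegative to the right of c, and g c > 0 would make p
          negative just to the left.\<close>
        have "0 \<le> poly g c" by (rule poly_ge_limit_right) (use gr \<open>0 < c\<close> in simp)
        moreover have "poly g c \<le> 0"
        proof (rule ccontr)
          assume "\<not> poly g c \<le> 0"
          then have "0 < poly g c" by simp
          moreover have "isCont (poly g) c" by simp
          ultimately have "\<forall>\<^sub>F x in at c. 0 < poly g x"
            by (auto simp: isCont_def dest: order_tendstoD(1))
          then obtain e where e: "0 < e" "\<And>x. x \<noteq> c \<Longrightarrow> dist x c < e \<Longrightarrow> 0 < poly g x"
            by (auto simp: eventually_at)
          define x where "x = max (c / 2) (c - e / 2)"
          have x: "0 \<le> x" "x < c" "dist x c < e"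
            using \<open>0 < c\<close> e(1) by (auto simp: x_def dist_real_def)
          then have "0 < poly g x" using e(2) by simp
          then have "(x - c) * poly g x < 0" using x by (simp add: mult_neg_pos)
          then show False using nonneg[OF x(1)] unfolding g poly_mult by simp
        qed
        ultimately have "poly g c = 0" by simp
        then obtain h where h: "g = [:- c, 1:] * h" unfolding poly_eq_0_iff_dvd by (elim dvdE)
        have ph: "p = ([:- c, 1:] * [:- c, 1:]) * h" by (simp only: g h mult.assoc)
        have h1: "0 \<le> poly h x" if "0 \<le> x" "x \<noteq> c" for x
        proof -
          have "0 \<le> (x - c)\<^sup>2 * poly h x"
            using nonneg[OF that(1)] unfolding ph poly_mult by (simp add: power2_eq_square)
          then show ?thesis using that(2) by (simp add: zero_le_mult_iff)
        qed
        have deg: "degree ([:- c, 1:] * [:- c, 1:]) = 2" by (simp add: degree_mult_eq)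
        show ?thesis
        proof (rule factor[OF ph])
          show "halfline_sos (degree ([:- c, 1:] * [:- c, 1:])) ([:- c, 1:] * [:- c, 1:])"
            by (rule halfline_sos.square, subst deg) simp
          show "0 \<le> poly h x" if "0 \<le> x" for x
          proof (cases "x = c")
            case True
            show ?thesis unfolding True
              by (rule poly_ge_limit_right) (use h1 \<open>0 < c\<close> in simp)
          qed (use h1 that in simp)
        qed (simp only: deg)
      qed
    qed
  qed
qed

subsection \<open>Approximation by mixtures of harmonic functions\<close>

text \<open>The scalar facts on f that the approximation needs. The growth bound controls the
  contribution of a node that is sent to infinity.\<close>

locale loewner_function =
  fixes f :: "real \<Rightarrow> real"
  assumes divided_difference: "\<And>n c q. 0 < n \<Longrightarrow> strict_mono_on {..<2 * n} c \<Longrightarrow> 0 \<le> c 0 \<Longrightarrow> degree q < n \<Longrightarrow>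
      0 \<le> (\<Sum>k<2 * n. f (c k) * (poly q (c k))\<^sup>2 / nodal c (2 * n) k)"
    and nonneg: "\<And>t. 0 \<le> t \<Longrightarrow> 0 \<le> f t"
    and sublinear: "\<And>t. 1 \<le> t \<Longrightarrow> f t \<le> t"
    and normalized: "f 1 = 1"
begin

text \<open>Adds the nodes \<open>0\<close> and \<open>T\<close> and lets \<open>T \<rightarrow> \<infinity>\<close>.\<close>

lemma divided_difference_quotient:
  assumes n: "0 < n" and t: "strict_mono_on {..<2 * n} t" and t0: "0 < t 0" and q: "degree q < n"
  shows "(\<Sum>k<2 * n. f (t k) * (poly q (t k))\<^sup>2 / (t k * nodal t (2 * n) k)) \<le> 0"
proof -
  have lt: "t i < t j" if "i < j" "j < 2 * n" for i j
    using strict_mono_onD[OF t, of i j] less_trans[of i j "2 * n"] that by simp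
  have tpos: "0 < t k" if "k < 2 * n" for k
    using t0 lt[of 0 k] that by (cases "k = 0") auto
  define \<omega> where "\<omega> = (\<Prod>l<2 * n. [:- t l, 1:])"
  \<comment> \<open>T times the divided difference over the nodes 0, t and T. Its term at 0 is
    nonpositive, since f 0 \<ge> 0 and the weight there is negative, and is dropped. For large T the
    factors T / (T - t k) tend to 1, while the right-hand side tends to 0 as a quotient of degrees
    at most 2 n - 1 and 2 n.\<close>
  have bound: "(\<Sum>k<2 * n. f (t k) * (poly q (t k))\<^sup>2 / (t k * nodal t (2 * n) k) * (T / (T - t k)))
      \<le> poly ([:0, 1:] * (q * q)) T / poly \<omega> T"
    if T: "t (2 * n - 1) < T" "1 \<le> T" for T
  proof -
    have tT: "t k < T" if "k < 2 * n" for k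
    proof (cases "k = 2 * n - 1")
      case False
      with that have "k < 2 * n - 1" by linarith
      then show ?thesis using lt[of k "2 * n - 1"] n T by simp
    qed (use T in simp)
    define c where "c k = (if k = 0 then 0 else if k = 2 * n + 1 then T else t (k - 1))" for k
    have c_simps: "c 0 = 0" "c (Suc (2 * n)) = T" "\<And>k. k < 2 * n \<Longrightarrow> c (Suc k) = t k"
      by (auto simp: c_def)
    have c: "strict_mono_on {..<2 * (n + 1)} c"
    proof (rule strict_mono_onI)
      fix i j assume ij: "i \<in> {..<2 * (n + 1)}" "j \<in> {..<2 * (n + 1)}" "i < j"
      show "c i < c j"
        using ij tpos[of "j - 1"] tT[of "i - 1"] lt[of "i - 1" "j - 1"] T
        by (auto simp: c_def)
    qed
    let ?g = "\<lambda>k. f (c k) * (poly q (c k))\<^sup>2 / nodal c (2 * (n + 1)) k"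
    have N: "2 * (n + 1) = Suc (Suc (2 * n))" by simp
    have prodT: "(\<Prod>l<2 * n. T - t l) = poly \<omega> T" by (simp add: \<omega>_def poly_prod)
    have \<omega>_pos: "0 < poly \<omega> T" unfolding prodT[symmetric] by (intro prod_pos) (auto simp: tT)
    have nodal_T: "nodal c (2 * (n + 1)) (Suc (2 * n)) = T * poly \<omega> T"
    proof -
      have "{..<2 * (n + 1)} - {Suc (2 * n)} = {..<Suc (2 * n)}" by auto
      then have "nodal c (2 * (n + 1)) (Suc (2 * n)) = (\<Prod>l<Suc (2 * n). T - c l)"
        by (simp add: nodal_def c_simps)
      also have "\<dots> = (T - c 0) * (\<Prod>l<2 * n. T - c (Suc l))" by (rule prod.lessThan_Suc_shift)
      also have "(\<Prod>l<2 * n. T - c (Suc l)) = (\<Prod>l<2 * n. T - t l)"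
        by (rule prod.cong) (auto simp: c_simps)
      finally show ?thesis by (simp add: c_simps prodT)
    qed
    have nodal_Suc: "nodal c (2 * (n + 1)) (Suc k) = t k * (t k - T) * nodal t (2 * n) k" if k: "k < 2 * n" for k
    proof -
      have "{..<2 * (n + 1)} - {Suc k} = insert 0 (insert (Suc (2 * n)) (Suc ` ({..<2 * n} - {k})))"
      proof (rule set_eqI)
        fix i show "i \<in> {..<2 * (n + 1)} - {Suc k} \<longleftrightarrow> i \<in> insert 0 (insert (Suc (2 * n)) (Suc ` ({..<2 * n} - {k})))"
          using k by (cases i) auto
      qed
      then have "nodal c (2 * (n + 1)) (Suc k)
          = (t k - c 0) * ((t k - c (Suc (2 * n))) * (\<Prod>l\<in>Suc ` ({..<2 * n} - {k}). t k - c l))"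
        using k by (simp add: nodal_def c_simps(3) del: mult_Suc_right) (subst prod.insert, auto)
      also have "(\<Prod>l\<in>Suc ` ({..<2 * n} - {k}). t k - c l) = (\<Prod>l\<in>{..<2 * n} - {k}. t k - c (Suc l))"
        by (subst prod.reindex) simp_all
      also have "\<dots> = nodal t (2 * n) k"
        unfolding nodal_def by (rule prod.cong) (auto simp: c_simps)
      finally show ?thesis by (simp add: c_simps)
    qed
    have "0 \<le> (\<Sum>k<2 * (n + 1). ?g k)"
      using q by (intro divided_difference c) (auto simp: c_simps)
    also have "\<dots> = ?g 0 + (\<Sum>k<2 * n. ?g (Suc k)) + ?g (Suc (2 * n))"
      unfolding N by (subst sum.lessThan_Suc, subst sum.lessThan_Suc_shift) (rule refl)
    also have "?g 0 \<le> 0"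
      using nodal_sign(1)[OF c, of 0] nonneg[of 0] by (simp add: c_simps divide_nonneg_neg)
    also have "(\<Sum>k<2 * n. ?g (Suc k)) = - (\<Sum>k<2 * n. f (t k) * (poly q (t k))\<^sup>2 / (t k * nodal t (2 * n) k) * (T / (T - t k))) / T"
      unfolding sum_divide_distrib sum_negf[symmetric]
    proof (rule sum.cong)
      fix k assume "k \<in> {..<2 * n}"
      then have k: "k < 2 * n" by simp
      have eq: "A / (u * - w * z) = - (A / (u * z) * (T / w)) / T" if "w \<noteq> 0" "u \<noteq> 0" "z \<noteq> 0" "T \<noteq> 0" for A u w z :: real
        using that by (simp add: field_simps)
      have nz: "nodal t (2 * n) k \<noteq> 0" using nodal_sign[OF t k] by (cases "even k") auto
      show "?g (Suc k) = - (f (t k) * (poly q (t k))\<^sup>2 / (t k * nodal t (2 * n) k) * (T / (T - t k))) / T"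
      proof -
        have "?g (Suc k) = f (t k) * (poly q (t k))\<^sup>2 / (t k * - (T - t k) * nodal t (2 * n) k)"
          by (simp only: nodal_Suc[OF k] c_simps(3)[OF k] minus_diff_eq)
        also have "\<dots> = - (f (t k) * (poly q (t k))\<^sup>2 / (t k * nodal t (2 * n) k) * (T / (T - t k))) / T"
          by (rule eq) (use tpos[OF k] tT[OF k] nz T in auto)
        finally show ?thesis .
      qed
    qed simp
    also have "?g (Suc (2 * n)) = f T * (poly q T)\<^sup>2 / (T * poly \<omega> T)" by (simp only: nodal_T c_simps)
    finally have "(\<Sum>k<2 * n. f (t k) * (poly q (t k))\<^sup>2 / (t k * nodal t (2 * n) k) * (T / (T - t k))) / T
        \<le> f T * (poly q T)\<^sup>2 / (T * poly \<omega> T)" by simp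
    then have "(\<Sum>k<2 * n. f (t k) * (poly q (t k))\<^sup>2 / (t k * nodal t (2 * n) k) * (T / (T - t k)))
        \<le> f T * (poly q T)\<^sup>2 / poly \<omega> T" using T \<omega>_pos by (simp add: field_simps)
    also have "\<dots> \<le> T * (poly q T)\<^sup>2 / poly \<omega> T"
      using T \<omega>_pos by (intro divide_right_mono mult_right_mono sublinear) auto
    finally show ?thesis by (simp add: power2_eq_square)
  qed
  have "degree ([:0, 1:] * (q * q)) < degree \<omega>"
  proof -
    have "degree \<omega> = 2 * n" unfolding \<omega>_def by (subst degree_prod_eq_sum_degree) auto
    moreover have "degree ([:0, 1:] * (q * q)) \<le> 1 + (degree q + degree q)"
      using degree_mult_le[of "[:0, 1:]" "q * q"] degree_mult_le[of q q] by simp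
    ultimately show ?thesis using q by linarith
  qed
  note lim = poly_divide_tendsto_0_at_infinity[OF this]
  have "((\<lambda>T. poly ([:0, 1:] * (q * q)) T / poly \<omega> T) \<longlongrightarrow> 0) at_top"
    by (rule filterlim_mono[OF lim order_refl at_top_le_at_infinity])
  moreover have "((\<lambda>T. \<Sum>k<2 * n. f (t k) * (poly q (t k))\<^sup>2 / (t k * nodal t (2 * n) k) * (T / (T - t k)))
      \<longlongrightarrow> (\<Sum>k<2 * n. f (t k) * (poly q (t k))\<^sup>2 / (t k * nodal t (2 * n) k) * 1)) at_top"
  proof (intro tendsto_sum tendsto_mult_left)
    fix k
    have "((\<lambda>T. 1 / (1 - t k * inverse T)) \<longlongrightarrow> 1 / (1 - t k * 0)) at_top"
      by (intro tendsto_intros tendsto_inverse_0_at_top filterlim_ident) simp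
    moreover have "\<forall>\<^sub>F T in at_top. 1 / (1 - t k * inverse T) = T / (T - t k)"
      using eventually_gt_at_top[of "0::real"] by eventually_elim (simp add: field_simps)
    ultimately show "((\<lambda>T. T / (T - t k)) \<longlongrightarrow> 1) at_top" by (simp add: tendsto_cong)
  qed
  moreover have "\<forall>\<^sub>F T in at_top. (\<Sum>k<2 * n. f (t k) * (poly q (t k))\<^sup>2 / (t k * nodal t (2 * n) k) * (T / (T - t k)))
      \<le> poly ([:0, 1:] * (q * q)) T / poly \<omega> T"
    using eventually_gt_at_top[of "t (2 * n - 1)"] eventually_ge_at_top[of 1]
    by eventually_elim (rule bound)
  ultimately have "(\<Sum>k<2 * n. f (t k) * (poly q (t k))\<^sup>2 / (t k * nodal t (2 * n) k) * 1) \<le> 0"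
    by (intro tendsto_le[OF trivial_limit_at_top_linorder])
  then show ?thesis by simp
qed

text \<open>With x = s / (1 - s) and denominators cleared, the hypothesis says that a polynomial p
  is nonnegative on the half-line. Its values at - t k return the weights: p (- t k) = - w k t k
  nodal k. The conclusion thus becomes a linear functional \<Lambda> of p, and its sign on r^2 and
  on x r^2 is that of the two kinds of divided differences.\<close>

lemma dual_cone:
  fixes n :: nat
  assumes n: "0 < n" and t: "strict_mono_on {..<2 * n} t" and t0: "0 < t 0"
    and w: "\<And>s. 0 \<le> s \<Longrightarrow> s \<le> 1 \<Longrightarrow> 0 \<le> (\<Sum>k<2 * n. w k * harmonic_fun s (t k))"
  shows "0 \<le> (\<Sum>k<2 * n. w k * f (t k))"
proof -
  have lt: "t i < t j" if "i < j" "j < 2 * n" for i j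
    using strict_mono_onD[OF t, of i j] less_trans[of i j "2 * n"] that by simp
  have tpos: "0 < t k" if "k < 2 * n" for k
    using t0 lt[of 0 k] that by (cases "k = 0") auto
  have nz: "nodal t (2 * n) k \<noteq> 0" if "k < 2 * n" for k
    using nodal_sign[OF t that] by (cases "even k") auto
  define \<pi> where "\<pi> k = (\<Prod>l\<in>{..<2 * n} - {k}. [:t l, 1:])" for k
  define p where "p = (\<Sum>k<2 * n. smult (w k * t k) (\<pi> k))"
  have deg: "degree p \<le> 2 * n - 1"
    unfolding p_def
  proof (intro degree_sum_le order.trans[OF degree_smult_le])
    show "degree (\<pi> k) \<le> 2 * n - 1" if "k \<in> {..<2 * n}" for k
      unfolding \<pi>_def using that by (subst degree_prod_eq_sum_degree) auto
  qed simp
  have "0 \<le> poly p x" if x: "0 \<le> x" for x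
  proof -
    define Q where "Q = (\<Prod>l<2 * n. t l + x)"
    have Q: "0 < Q" unfolding Q_def using tpos x by (intro prod_pos) (auto intro: add_pos_nonneg)
    define s where "s = x / (1 + x)"
    have s: "0 \<le> s" "s \<le> 1" using x by (auto simp: s_def)
    have "poly p x = (\<Sum>k<2 * n. w k * harmonic_fun s (t k) * (Q / (1 + x)))"
      unfolding p_def poly_sum
    proof (rule sum.cong)
      fix k assume "k \<in> {..<2 * n}"
      then have k: "k < 2 * n" by simp
      have "Q = (t k + x) * poly (\<pi> k) x"
        unfolding Q_def \<pi>_def poly_prod using k by (subst prod.remove[of _ k]) auto
      moreover have "harmonic_fun s (t k) = (1 + x) * t k / (t k + x)"
      proof -
        have "(1 - s) + s / t k = (t k + x) / ((1 + x) * t k)"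
          using x tpos[OF k] by (simp add: s_def divide_simps)
        then show ?thesis by (simp add: harmonic_fun_def)
      qed
      ultimately show "poly (smult (w k * t k) (\<pi> k)) x = w k * harmonic_fun s (t k) * (Q / (1 + x))"
        using x tpos[OF k] by (simp add: add_pos_nonneg less_imp_neq[symmetric])
    qed simp
    also have "\<dots> = (\<Sum>k<2 * n. w k * harmonic_fun s (t k)) * (Q / (1 + x))" by (simp only: sum_distrib_right)
    also have "0 \<le> \<dots>" using w[OF s] Q x by (intro mult_nonneg_nonneg) auto
    finally show ?thesis .
  qed
  then have "halfline_sos (degree p) p" by (rule nonneg_imp_halfline_sos)
  then have sos: "halfline_sos (2 * n - 1) p" using deg by (rule halfline_sos_mono)
  define \<Lambda> where "\<Lambda> p = (\<Sum>k<2 * n. f (t k) * - poly p (- t k) / (t k * nodal t (2 * n) k))" for p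
  \<comment> \<open>\<Lambda> evaluates r at - t k, the divided differences evaluate q at t
    k.\<close>
  have reflect: "degree (pcompose r [:0, -1:]) = degree r" "poly (pcompose r [:0, -1:]) x = poly r (- x)" for r :: "real poly" and x
    by (simp_all add: degree_pcompose poly_pcompose)
  have "0 \<le> \<Lambda> p" if "halfline_sos d p" "d = 2 * n - 1" for d p
    using that
  proof (induction rule: halfline_sos.induct)
    case (square r d)
    then have "degree r < n" using n by linarith
    then have "(\<Sum>k<2 * n. f (t k) * (poly r (- t k))\<^sup>2 / (t k * nodal t (2 * n) k)) \<le> 0"
      using divided_difference_quotient[OF n t t0, of "pcompose r [:0, -1:]"] by (simp only: reflect)
    then show ?case by (simp add: \<Lambda>_def sum_negf power2_eq_square)
  next
    case (shifted_square r d)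
    then have "degree r < n" using n by linarith
    then have "0 \<le> (\<Sum>k<2 * n. f (t k) * (poly r (- t k))\<^sup>2 / nodal t (2 * n) k)"
      using divided_difference[OF n t, of "pcompose r [:0, -1:]"] t0 by (simp add: reflect)
    also have "\<dots> = \<Lambda> ([:0, 1:] * (r * r))"
      unfolding \<Lambda>_def by (rule sum.cong) (use tpos in \<open>auto simp: power2_eq_square less_imp_neq[symmetric]\<close>)
    finally show ?case .
  next
    case (add d p q)
    have "\<Lambda> (p + q) = \<Lambda> p + \<Lambda> q"
      unfolding \<Lambda>_def sum.distrib[symmetric] by (rule sum.cong) (simp_all add: add_divide_distrib[symmetric] algebra_simps)
    with add show ?case by simp
  qed
  from this[OF sos refl] have "0 \<le> \<Lambda> p" .
  also have "\<Lambda> p = (\<Sum>k<2 * n. w k * f (t k))"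
    unfolding \<Lambda>_def
  proof (rule sum.cong)
    fix k assume "k \<in> {..<2 * n}"
    then have k: "k < 2 * n" by simp
    have "poly p (- t k) = (\<Sum>j<2 * n. if j = k then w k * t k * poly (\<pi> k) (- t k) else 0)"
      unfolding p_def poly_sum
    proof (rule sum.cong)
      fix j assume j: "j \<in> {..<2 * n}"
      have "poly (\<pi> j) (- t k) = 0" if "j \<noteq> k"
        unfolding \<pi>_def poly_prod using that k by (intro prod_zero) auto
      then show "poly (smult (w j * t j) (\<pi> j)) (- t k) = (if j = k then w k * t k * poly (\<pi> k) (- t k) else 0)"
        by simp
    qed simp
    also have "\<dots> = w k * t k * poly (\<pi> k) (- t k)" using k by simp
    also have "poly (\<pi> k) (- t k) = - nodal t (2 * n) k"
    proof -
      have "poly (\<pi> k) (- t k) = (\<Prod>l\<in>{..<2 * n} - {k}. - 1 * (t k - t l))"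
        unfolding \<pi>_def poly_prod by (rule prod.cong) auto
      also have "\<dots> = (- 1) ^ card ({..<2 * n} - {k}) * nodal t (2 * n) k"
        by (simp only: prod.distrib prod_constant nodal_def)
      finally show ?thesis using k by simp
    qed
    finally show "f (t k) * - poly p (- t k) / (t k * nodal t (2 * n) k) = w k * f (t k)"
      using tpos[OF k] nz[OF k] by simp
  qed simp
  finally show ?thesis .
qed

end

text \<open>The convex hull, generated by mixtures of two, so that an operation for each mixture can
  be assembled by induction.\<close>

inductive harmonic_mixture :: "(real \<Rightarrow> real) \<Rightarrow> bool" where
  harmonic: "0 \<le> s \<Longrightarrow> s \<le> 1 \<Longrightarrow> harmonic_mixture (harmonic_fun s)"
| mix: "harmonic_mixture g \<Longrightarrow> harmonic_mixture h \<Longrightarrow> 0 \<le> u \<Longrightarrow> u \<le> 1 \<Longrightarrow>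
    harmonic_mixture (\<lambda>t. (1 - u) * g t + u * h t)"

text \<open>The point is uniformity over all mixtures: it bounds the second-order term in the
  minimization of the distance to f.\<close>

lemma harmonic_mixture_bounds:
  assumes "harmonic_mixture h" "0 < t"
  shows "0 \<le> h t \<and> h t \<le> 1 + t"
  using assms(1)
proof (induction rule: harmonic_mixture.induct)
  case (harmonic s)
  have "0 < 1 - s + s / t" using harmonic assms(2) by (cases "s = 1") (auto intro: add_pos_nonneg)
  moreover have "1 \<le> (1 + t) * (1 - s + s / t)"
  proof -
    have "(1 + t) * (1 - s + s / t) = 1 + (t * (1 - s) + s / t)" using assms(2) by (simp add: field_simps)
    then show ?thesis using harmonic assms(2) by simp
  qed
  ultimately show ?case by (simp add: harmonic_fun_def divide_simps)
next
  case (mix g h u)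
  then have "(1 - u) * g t + u * h t \<le> (1 - u) * (1 + t) + u * (1 + t)"
    by (intro add_mono mult_left_mono) auto
  moreover have "0 \<le> (1 - u) * g t + u * h t" using mix by (intro add_nonneg_nonneg mult_nonneg_nonneg) auto
  ultimately show ?case by (simp add: algebra_simps)
qed

context loewner_function
begin

text \<open>A mixture that almost minimizes the distance to \<open>f\<close> on the nodes would otherwise provide a
  functional that contradicts \<open>dual_cone\<close>.\<close>

lemma harmonic_mixture_approx_nodes:
  fixes n :: nat
  assumes n: "0 < n" and t: "strict_mono_on {..<2 * n} t" and t0: "0 < t 0"
    and k1: "k1 < 2 * n" "t k1 = 1" and e: "0 < e"
  shows "\<exists>h. harmonic_mixture h \<and> (\<forall>k<2 * n. \<bar>h (t k) - f (t k)\<bar> \<le> e)"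
proof (rule ccontr)
  assume far: "\<not> ?thesis"
  have lt: "t i < t j" if "i < j" "j < 2 * n" for i j
    using strict_mono_onD[OF t, of i j] less_trans[of i j "2 * n"] that by simp
  have tpos: "0 < t k" if "k < 2 * n" for k
    using t0 lt[of 0 k] that by (cases "k = 0") auto
  define ds where "ds h = (\<Sum>k<2 * n. (h (t k) - f (t k))\<^sup>2)" for h
  define D where "D = {x. \<exists>h. harmonic_mixture h \<and> x = ds h}"
  have D_ne: "D \<noteq> {}" unfolding D_def using harmonic[of 0] by (auto simp: ex_in_conv[symmetric])
  have D_lower: "e\<^sup>2 \<le> x" if x: "x \<in> D" for x
  proof -
    from x obtain h where h: "harmonic_mixture h" "x = ds h" unfolding D_def by blast
    then obtain k where k: "k < 2 * n" "e < \<bar>h (t k) - f (t k)\<bar>" using far by (meson not_le)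
    have "e\<^sup>2 \<le> (h (t k) - f (t k))\<^sup>2" using k(2) e by (simp add: abs_le_square_iff[symmetric])
    also have "\<dots> \<le> ds h" unfolding ds_def using k(1) by (intro member_le_sum) auto
    finally show ?thesis by (simp add: h)
  qed
  have bdd: "bdd_below D" using D_lower by (auto simp: bdd_below_def)
  define d where "d = Inf D"
  have d: "0 < d" using cInf_greatest[OF D_ne D_lower] e by (simp add: d_def less_le_trans[of 0 "e\<^sup>2"])
  define B where "B = (\<Sum>k<2 * n. (1 + t k)\<^sup>2)"
  have B: "0 < B" unfolding B_def
  proof (rule sum_pos)
    show "{..<2 * n} \<noteq> {}" using n by (simp add: lessThan_empty_iff)
    show "0 < (1 + t k)\<^sup>2" if "k \<in> {..<2 * n}" for k using tpos[of k] that by simp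
  qed simp
  \<comment> \<open>The step length from h towards another mixture g; it is so small that the
    second-order term u^2 B is at most u d / 2.\<close>
  define u where "u = min 1 (d / (2 * B))"
  have u: "0 < u" "u \<le> 1" "u * B \<le> d / 2" using d B by (auto simp: u_def min_def field_simps)
  \<comment> \<open>An almost minimizer suffices and spares a compactness argument: its excess u d /
    2 becomes d / 2 after division by u.\<close>
  have "Inf D < d + u * d / 2" using d u by (simp add: d_def)
  from cInf_lessD[OF D_ne this] obtain h where h: "harmonic_mixture h" and dh: "ds h < d + u * d / 2"
    by (auto simp: D_def)
  define v where "v k = h (t k) - f (t k)" for k
  \<comment> \<open>The first-order condition at the almost minimizer. An exact minimizer would give
    0 on the left; the loss d / 2 is smaller than the gain \<open>ds h \<ge> d\<close> used
    afterwards.\<close>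
  have key: "- d / 2 \<le> (\<Sum>k<2 * n. v k * (g (t k) - h (t k)))" if g: "harmonic_mixture g" for g
  proof -
    have "d \<le> ds (\<lambda>x. (1 - u) * h x + u * g x)"
      unfolding d_def
    proof (rule cInf_lower[OF _ bdd])
      have "harmonic_mixture (\<lambda>x. (1 - u) * h x + u * g x)"
        using u by (intro harmonic_mixture.mix h g) auto
      then show "ds (\<lambda>x. (1 - u) * h x + u * g x) \<in> D" unfolding D_def by blast
    qed
    also have "\<dots> = (\<Sum>k<2 * n. (v k)\<^sup>2 + 2 * u * (v k * (g (t k) - h (t k))) + u\<^sup>2 * (g (t k) - h (t k))\<^sup>2)"
      unfolding ds_def v_def by (rule sum.cong) (simp_all add: power2_eq_square algebra_simps)
    also have "\<dots> = ds h + 2 * u * (\<Sum>k<2 * n. v k * (g (t k) - h (t k))) + u\<^sup>2 * (\<Sum>k<2 * n. (g (t k) - h (t k))\<^sup>2)"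
      by (simp add: sum.distrib ds_def v_def sum_distrib_left)
    finally have 1: "d \<le> ds h + 2 * u * (\<Sum>k<2 * n. v k * (g (t k) - h (t k))) + u\<^sup>2 * (\<Sum>k<2 * n. (g (t k) - h (t k))\<^sup>2)" .
    have "(\<Sum>k<2 * n. (g (t k) - h (t k))\<^sup>2) \<le> B"
      unfolding B_def
    proof (rule sum_mono)
      fix k assume "k \<in> {..<2 * n}"
      then have "0 < t k" using tpos by simp
      from harmonic_mixture_bounds[OF g this] harmonic_mixture_bounds[OF h this]
      have "\<bar>g (t k) - h (t k)\<bar> \<le> \<bar>1 + t k\<bar>" using \<open>0 < t k\<close> by linarith
      then show "(g (t k) - h (t k))\<^sup>2 \<le> (1 + t k)\<^sup>2" by (simp only: abs_le_square_iff)
    qed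
    then have "u\<^sup>2 * (\<Sum>k<2 * n. (g (t k) - h (t k))\<^sup>2) \<le> u * (u * B)"
      unfolding power2_eq_square[of u] mult.assoc using u by (intro mult_left_mono) auto
    also have "\<dots> \<le> u * (d / 2)" using u by (intro mult_left_mono) auto
    finally have 2: "u\<^sup>2 * (\<Sum>k<2 * n. (g (t k) - h (t k))\<^sup>2) \<le> u * (d / 2)" .
    define S where "S = (\<Sum>k<2 * n. v k * (g (t k) - h (t k)))"
    have "ds h < d + u * (d / 2)" using dh by simp
    with 1 2 have "0 \<le> u * (d / 2) + 2 * u * S + u * (d / 2)" unfolding S_def by linarith
    also have "\<dots> = u * (d + 2 * S)" by (simp add: field_simps)
    finally have "0 \<le> d + 2 * S" using u(1) by (simp only: zero_le_mult_iff) linarith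
    then show ?thesis by (simp add: S_def)
  qed
  have dsh: "d \<le> ds h" unfolding d_def by (rule cInf_lower[OF _ bdd]) (use h in \<open>auto simp: D_def\<close>)
  \<comment> \<open>The functional v is at least \<gamma> on all harmonic functions and equals
    \<gamma> - d / 2 at f. To move the threshold to 0, \<gamma> is subtracted from the weight at the
    node 1, where all these functions have the value 1.\<close>
  define \<gamma> where "\<gamma> = (\<Sum>k<2 * n. v k * f (t k)) + d / 2"
  define w where "w k = v k - (if k = k1 then \<gamma> else 0)" for k
  have w_sum: "(\<Sum>k<2 * n. w k * g (t k)) = (\<Sum>k<2 * n. v k * g (t k)) - \<gamma> * g 1" for g
  proof -
    have "(\<Sum>k<2 * n. w k * g (t k)) = (\<Sum>k<2 * n. v k * g (t k) - (if k = k1 then \<gamma> * g (t k1) else 0))"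
      by (rule sum.cong) (auto simp: w_def algebra_simps)
    then show ?thesis using k1 by (simp add: sum_subtractf)
  qed
  have "0 \<le> (\<Sum>k<2 * n. w k * f (t k))"
  proof (rule dual_cone[OF n t t0])
    fix s :: real assume s: "0 \<le> s" "s \<le> 1"
    have "(\<Sum>k<2 * n. v k * harmonic_fun s (t k)) = (\<Sum>k<2 * n. v k * (harmonic_fun s (t k) - h (t k))) + ds h + (\<Sum>k<2 * n. v k * f (t k))"
      unfolding ds_def sum.distrib[symmetric] by (rule sum.cong) (simp_all add: v_def power2_eq_square algebra_simps)
    then have "\<gamma> \<le> (\<Sum>k<2 * n. v k * harmonic_fun s (t k))"
      using key[OF harmonic[OF s]] dsh by (simp add: \<gamma>_def)
    then show "0 \<le> (\<Sum>k<2 * n. w k * harmonic_fun s (t k))"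
      using w_sum[of "harmonic_fun s"] by (simp add: harmonic_fun_def[of s 1])
  qed
  then show False using d by (simp add: w_sum \<gamma>_def normalized)
qed

text \<open>The set is padded to an increasing list of even length that contains 1;
  \<open>Max S1 + 1\<close> is a new positive point for the case of odd cardinality.\<close>

lemma harmonic_mixture_approx:
  assumes S: "finite S" "\<And>x. x \<in> S \<Longrightarrow> 0 < x" and e: "0 < e"
  shows "\<exists>h. harmonic_mixture h \<and> (\<forall>x\<in>S. \<bar>h x - f x\<bar> \<le> e)"
proof -
  define S1 where "S1 = insert 1 S"
  define S2 where "S2 = (if even (card S1) then S1 else insert (Max S1 + 1) S1)"
  have S1: "finite S1" "1 \<in> S1" "\<And>x. x \<in> S1 \<Longrightarrow> 0 < x" using S by (auto simp: S1_def)
  have new: "Max S1 + 1 \<notin> S1" using Max_ge[OF S1(1), of "Max S1 + 1"] by auto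
  have "1 \<le> Max S1" using S1 by (intro Max_ge)
  then have mp: "0 < Max S1 + 1" by linarith
  have S2: "finite S2" "S1 \<subseteq> S2" "even (card S2)" "\<And>x. x \<in> S2 \<Longrightarrow> 0 < x"
    using S1 new mp by (auto simp: S2_def split: if_splits)
  then obtain n where n: "card S2 = 2 * n" by (elim evenE)
  have "card S2 \<noteq> 0" using S1 S2 by auto
  then have n0: "0 < n" using n by simp
  define t where "t k = sorted_list_of_set S2 ! k" for k
  have len: "length (sorted_list_of_set S2) = 2 * n" using n by simp
  have t_img: "t ` {..<2 * n} = S2"
    using nth_image[of "2 * n" "sorted_list_of_set S2"] S2(1) len by (simp add: t_def atLeast0LessThan image_def)
  have t: "strict_mono_on {..<2 * n} t"
    unfolding t_def by (rule strict_mono_onI, rule sorted_wrt_nth_less[OF strict_sorted_list_of_set]) (auto simp: n)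
  have "t 0 \<in> t ` {..<2 * n}" using n0 by (intro imageI) simp
  then have "t 0 \<in> S2" unfolding t_img .
  then have t0: "0 < t 0" by (rule S2(4))
  have "1 \<in> t ` {..<2 * n}" unfolding t_img using S1(2) S2(2) by (rule subsetD[rotated])
  then obtain k1 where "k1 < 2 * n" "t k1 = 1" by auto
  from harmonic_mixture_approx_nodes[OF n0 t t0 this e] obtain h where
    h: "harmonic_mixture h" "\<forall>k<2 * n. \<bar>h (t k) - f (t k)\<bar> \<le> e" by blast
  have "\<bar>h x - f x\<bar> \<le> e" if "x \<in> S" for x
  proof -
    have "x \<in> t ` {..<2 * n}" using that S2(2) unfolding t_img by (auto simp: S1_def)
    then show ?thesis using h(2) by auto
  qed
  with h(1) show ?thesis by blast
qed

end

text \<open>The properties used of the mean \<open>H\<close> with representing function \<open>h\<close>.\<close>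

definition mixture_operation :: "(real \<Rightarrow> real) \<Rightarrow> 'h::complex_hilbert_space binop \<Rightarrow> bool" where
  "mixture_operation h H \<longleftrightarrow> superadditive H \<and>
    (\<forall>A\<in>pos_inv_ops. \<forall>B\<in>pos_inv_ops.
      sqrt_op A o\<^sub>L H id_blinfun (inv_op (sqrt_op A) o\<^sub>L B o\<^sub>L inv_op (sqrt_op A)) o\<^sub>L sqrt_op A = H A B) \<and>
    (\<forall>E\<in>pos_ops. \<forall>X\<in>pos_inv_ops. \<forall>t>0. E o\<^sub>L X = X o\<^sub>L E \<longrightarrow>
      (t *\<^sub>R E \<preceq> E o\<^sub>L X \<longrightarrow> h t *\<^sub>R E \<preceq> E o\<^sub>L H id_blinfun X) \<and>
      (E o\<^sub>L X \<preceq> t *\<^sub>R E \<longrightarrow> E o\<^sub>L H id_blinfun X \<preceq> h t *\<^sub>R E))"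

lemma mixture_operationD:
  assumes "mixture_operation h H"
  shows "superadditive H"
    and "A \<in> pos_inv_ops \<Longrightarrow> B \<in> pos_inv_ops \<Longrightarrow>
      sqrt_op A o\<^sub>L H id_blinfun (inv_op (sqrt_op A) o\<^sub>L B o\<^sub>L inv_op (sqrt_op A)) o\<^sub>L sqrt_op A = H A B"
    and "E \<in> pos_ops \<Longrightarrow> X \<in> pos_inv_ops \<Longrightarrow> E o\<^sub>L X = X o\<^sub>L E \<Longrightarrow> 0 < t \<Longrightarrow>
      t *\<^sub>R E \<preceq> E o\<^sub>L X \<Longrightarrow> h t *\<^sub>R E \<preceq> E o\<^sub>L H id_blinfun X"
    and "E \<in> pos_ops \<Longrightarrow> X \<in> pos_inv_ops \<Longrightarrow> E o\<^sub>L X = X o\<^sub>L E \<Longrightarrow> 0 < t \<Longrightarrow>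
      E o\<^sub>L X \<preceq> t *\<^sub>R E \<Longrightarrow> E o\<^sub>L H id_blinfun X \<preceq> h t *\<^sub>R E"
  using assms by (simp_all add: mixture_operation_def)

lemma mixture_operation_harmonic:
  assumes "0 \<le> s" "s \<le> 1"
  shows "mixture_operation (harmonic_fun s) (harmonic_mean s)"
  unfolding mixture_operation_def
proof (intro conjI ballI allI impI)
  show "superadditive (harmonic_mean s)" by (rule superadditive_harmonic_mean[OF assms])
next
  fix A B :: "'a \<Rightarrow>\<^sub>L 'a" assume "A \<in> pos_inv_ops" "B \<in> pos_inv_ops"
  then show "sqrt_op A o\<^sub>L harmonic_mean s id_blinfun (inv_op (sqrt_op A) o\<^sub>L B o\<^sub>L inv_op (sqrt_op A)) o\<^sub>L sqrt_op A
    = harmonic_mean s A B" by (rule harmonic_mean_congr[OF _ _ assms])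
next
  fix E X :: "'a \<Rightarrow>\<^sub>L 'a" and t :: real
  assume E: "E \<in> pos_ops" "X \<in> pos_inv_ops" "0 < t" "E o\<^sub>L X = X o\<^sub>L E"
  show "harmonic_fun s t *\<^sub>R E \<preceq> E o\<^sub>L harmonic_mean s id_blinfun X" if "t *\<^sub>R E \<preceq> E o\<^sub>L X"
    by (rule harmonic_mean_local(1)[OF E(1,2,4,3) assms that])
  show "E o\<^sub>L harmonic_mean s id_blinfun X \<preceq> harmonic_fun s t *\<^sub>R E" if "E o\<^sub>L X \<preceq> t *\<^sub>R E"
    by (rule harmonic_mean_local(2)[OF E(1,2,4,3) assms that])
qed

lemma mixture_operation_mix:
  fixes G H :: "'h::complex_hilbert_space binop"
  assumes G: "mixture_operation g G" and H: "mixture_operation h H" and u: "0 \<le> u" "u \<le> 1"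
  shows "mixture_operation (\<lambda>t. (1 - u) * g t + u * h t) (\<lambda>A B. (1 - u) *\<^sub>R G A B + u *\<^sub>R H A B)"
  unfolding mixture_operation_def
proof (intro conjI ballI allI impI)
  have u': "0 \<le> 1 - u" using u by simp
  note G = mixture_operationD[OF G] and H = mixture_operationD[OF H]
  show "superadditive (\<lambda>A B. (1 - u) *\<^sub>R G A B + u *\<^sub>R H A B)"
    unfolding superadditive_def
  proof (intro ballI)
    fix A B C D :: "'h \<Rightarrow>\<^sub>L 'h"
    assume P: "A \<in> pos_inv_ops" "B \<in> pos_inv_ops" "C \<in> pos_inv_ops" "D \<in> pos_inv_ops"
    have "(1 - u) *\<^sub>R (G A B + G C D) + u *\<^sub>R (H A B + H C D)
        \<preceq> (1 - u) *\<^sub>R G (A + C) (B + D) + u *\<^sub>R H (A + C) (B + D)"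
      by (rule loewner_add[OF loewner_scaleR[OF superadditiveD[OF G(1) P] u'] loewner_scaleR[OF superadditiveD[OF H(1) P] u(1)]])
    then show "((1 - u) *\<^sub>R G A B + u *\<^sub>R H A B) + ((1 - u) *\<^sub>R G C D + u *\<^sub>R H C D)
        \<preceq> (1 - u) *\<^sub>R G (A + C) (B + D) + u *\<^sub>R H (A + C) (B + D)" by (simp add: algebra_simps)
  qed
  show "sqrt_op A o\<^sub>L ((1 - u) *\<^sub>R G id_blinfun (inv_op (sqrt_op A) o\<^sub>L B o\<^sub>L inv_op (sqrt_op A))
      + u *\<^sub>R H id_blinfun (inv_op (sqrt_op A) o\<^sub>L B o\<^sub>L inv_op (sqrt_op A))) o\<^sub>L sqrt_op A
    = (1 - u) *\<^sub>R G A B + u *\<^sub>R H A B" if "A \<in> pos_inv_ops" "B \<in> pos_inv_ops" for A B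
    by (simp only: op_comp_bilinear G(2)[OF that] H(2)[OF that])
  fix E X :: "'h \<Rightarrow>\<^sub>L 'h" and t :: real
  assume E: "E \<in> pos_ops" "X \<in> pos_inv_ops" "0 < t" "E o\<^sub>L X = X o\<^sub>L E"
  have split: "((1 - u) * g t + u * h t) *\<^sub>R E = (1 - u) *\<^sub>R (g t *\<^sub>R E) + u *\<^sub>R (h t *\<^sub>R E)"
    "E o\<^sub>L ((1 - u) *\<^sub>R G id_blinfun X + u *\<^sub>R H id_blinfun X)
      = (1 - u) *\<^sub>R (E o\<^sub>L G id_blinfun X) + u *\<^sub>R (E o\<^sub>L H id_blinfun X)"
    by (simp_all add: scaleR_add_left op_comp_bilinear)
  show "((1 - u) * g t + u * h t) *\<^sub>R E \<preceq> E o\<^sub>L ((1 - u) *\<^sub>R G id_blinfun X + u *\<^sub>R H id_blinfun X)"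
    if "t *\<^sub>R E \<preceq> E o\<^sub>L X"
    unfolding split
    by (rule loewner_add[OF loewner_scaleR[OF G(3)[OF E(1,2,4,3) that] u'] loewner_scaleR[OF H(3)[OF E(1,2,4,3) that] u(1)]])
  show "E o\<^sub>L ((1 - u) *\<^sub>R G id_blinfun X + u *\<^sub>R H id_blinfun X) \<preceq> ((1 - u) * g t + u * h t) *\<^sub>R E"
    if "E o\<^sub>L X \<preceq> t *\<^sub>R E"
    unfolding split
    by (rule loewner_add[OF loewner_scaleR[OF G(4)[OF E(1,2,4,3) that] u'] loewner_scaleR[OF H(4)[OF E(1,2,4,3) that] u(1)]])
qed

lemma harmonic_mixture_operation:
  assumes "harmonic_mixture h"
  shows "\<exists>H :: 'h::complex_hilbert_space binop. mixture_operation h H"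
  using assms
proof (induction rule: harmonic_mixture.induct)
  case (harmonic s)
  show ?case by (rule exI, rule mixture_operation_harmonic[OF harmonic])
next
  case (mix g h u)
  from mix.IH obtain G H :: "'h binop" where "mixture_operation g G" "mixture_operation h H" by (elim exE)
  from mixture_operation_mix[OF this mix.hyps(3,4)] show ?case
    by (rule exI[where x = "\<lambda>A B. (1 - u) *\<^sub>R G A B + u *\<^sub>R H A B"])
qed

section \<open>Approximation and superadditivity of operator means\<close>

lemma operator_mean_scalar:
  assumes "operator_mean \<sigma>" "0 < e"
  shows "\<sigma> (e *\<^sub>R id_blinfun) (e *\<^sub>R id_blinfun) = e *\<^sub>R id_blinfun"
  using operator_mean_congr[OF assms(1) pos_ops_id pos_ops_id pos_inv_scaleR[OF pos_inv_id, of "sqrt e"]] assms(2)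
  by (simp add: operator_mean_id[OF assms(1)] op_comp_bilinear)

lemma operator_mean_pos_inv:
  assumes m: "operator_mean \<sigma>" and A: "A \<in> pos_inv_ops" and B: "B \<in> pos_inv_ops"
  shows "\<sigma> A B \<in> pos_inv_ops"
proof -
  obtain a b where a: "0 < a" "a *\<^sub>R id_blinfun \<preceq> A" and b: "0 < b" "b *\<^sub>R id_blinfun \<preceq> B"
    using A B by (auto simp: pos_inv_ops_iff)
  define e where "e = min a b"
  have e: "0 < e" "e \<le> a" "e \<le> b" using a b by (auto simp: e_def)
  have "e *\<^sub>R id_blinfun \<preceq> A" "e *\<^sub>R id_blinfun \<preceq> B"
    by (rule loewner_trans[OF loewner_scaleR_mono[OF pos_ops_id e(2)] a(2)],
        rule loewner_trans[OF loewner_scaleR_mono[OF pos_ops_id e(3)] b(2)])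
  then have "\<sigma> (e *\<^sub>R id_blinfun) (e *\<^sub>R id_blinfun) \<preceq> \<sigma> A B"
    using e A B by (intro operator_mean_mono[OF m]) (auto simp: pos_ops_scaleR pos_ops_id pos_inv_pos)
  then show ?thesis
    using e A B by (intro pos_inv_opsI[of _ e]) (simp_all add: operator_mean_scalar[OF m] pos_ops_selfadj operator_mean_pos[OF m] pos_inv_pos)
qed

lemma operator_mean_eq_congr:
  assumes m: "operator_mean \<sigma>" and A: "A \<in> pos_inv_ops" and B: "B \<in> pos_ops"
  shows "\<sigma> A B = sqrt_op A o\<^sub>L \<sigma> id_blinfun (inv_op (sqrt_op A) o\<^sub>L B o\<^sub>L inv_op (sqrt_op A)) o\<^sub>L sqrt_op A"
proof -
  note R = sqrt_op_pos_inv[OF A]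
  have "inv_op (sqrt_op A) o\<^sub>L B o\<^sub>L inv_op (sqrt_op A) \<in> pos_ops"
    by (intro pos_ops_congr inv_op_selfadj R B)
  from operator_mean_congr[OF m pos_ops_id this R] show ?thesis
    by (simp add: congr_cancel[OF R] sqrt_op_props(2)[OF pos_inv_pos[OF A]])
qed

text \<open>On the zero space all these comparisons hold trivially, so a nonzero vector is
  indispensable for reading off scalars.\<close>

lemma loewner_scalar_iff:
  assumes "x \<noteq> (0::'h::complex_hilbert_space)"
  shows "a *\<^sub>R (id_blinfun :: 'h \<Rightarrow>\<^sub>L 'h) \<preceq> b *\<^sub>R id_blinfun \<Longrightarrow> a \<le> b"
  using loewnerD[of "a *\<^sub>R id_blinfun" "b *\<^sub>R id_blinfun" x] assms by (simp add: op_apply)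

text \<open>The pair (1, t) lies between (a, a) and (b, b) for a = min 1 t and b = max 1 t, and a
  mean fixes equal scalar arguments. The lower bound gives positivity of f away from 0, the upper
  one its growth.\<close>

lemma representing_function_bounds:
  fixes \<sigma> :: "'h::complex_hilbert_space binop"
  assumes x: "x \<noteq> (0::'h)" and m: "operator_mean \<sigma>" and f: "representing_function \<sigma> f" and t: "0 < t"
  shows "min 1 t \<le> f t" "f t \<le> max 1 t"
proof -
  have ft: "\<sigma> id_blinfun (t *\<^sub>R id_blinfun) = f t *\<^sub>R id_blinfun"
    using f t by (simp add: representing_function_def)
  have p: "r *\<^sub>R id_blinfun \<in> (pos_ops :: ('h \<Rightarrow>\<^sub>L 'h) set)" if "0 < r" for r
    using that by (simp add: pos_ops_scaleR pos_ops_id)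
  have le: "r *\<^sub>R id_blinfun \<preceq> s *\<^sub>R (id_blinfun :: 'h \<Rightarrow>\<^sub>L 'h)" if "r \<le> s" for r s
    using that by (intro loewner_scaleR_mono pos_ops_id)
  let ?a = "min 1 t" and ?b = "max 1 t"
  have "\<sigma> (?a *\<^sub>R id_blinfun) (?a *\<^sub>R id_blinfun) \<preceq> \<sigma> (1 *\<^sub>R id_blinfun) (t *\<^sub>R id_blinfun)"
    using t by (intro operator_mean_mono[OF m] p le) auto
  then show "?a \<le> f t" using operator_mean_scalar[OF m, of ?a] t ft loewner_scalar_iff[OF x] by simp
  have "\<sigma> (1 *\<^sub>R id_blinfun) (t *\<^sub>R id_blinfun) \<preceq> \<sigma> (?b *\<^sub>R id_blinfun) (?b *\<^sub>R id_blinfun)"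
    using t by (intro operator_mean_mono[OF m] p le) auto
  then show "f t \<le> ?b" using operator_mean_scalar[OF m, of ?b] t ft loewner_scalar_iff[OF x] by simp
qed

lemma representing_function_loewner:
  fixes \<sigma> :: "'h::complex_hilbert_space binop"
  assumes x: "x \<noteq> (0::'h)" and m: "operator_mean \<sigma>" and f: "representing_function \<sigma> f"
  shows "loewner_function f"
proof
  show "0 \<le> (\<Sum>k<2 * n. f (c k) * (poly q (c k))\<^sup>2 / nodal c (2 * n) k)"
    if "0 < n" "strict_mono_on {..<2 * n} c" "0 \<le> c 0" "degree q < n" for n c q
    using f that by (intro operator_monotone_divided_difference) (simp_all add: representing_function_def)
  show "f t \<le> t" if "1 \<le> t" for t
    using representing_function_bounds(2)[OF x m f, of t] that by simp
qed (use f in \<open>simp_all add: representing_function_def\<close>)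

text \<open>H is chosen for the interval [a, b] before X is given, so that one operation can serve
  several operators at once. Local bounds for \<sigma> and for H on each cell are compared there and
  then reassembled by localization.\<close>

lemma operator_mean_approx:
  fixes \<sigma> :: "'h::complex_hilbert_space binop"
  assumes x: "x \<noteq> (0::'h)" and m: "operator_mean \<sigma>" and f: "representing_function \<sigma> f"
    and a: "0 < a" and ab: "a < b" and e: "0 < e"
  shows "\<exists>h H. mixture_operation h H \<and>
    (\<forall>X. a *\<^sub>R id_blinfun \<preceq> X \<longrightarrow> X \<preceq> b *\<^sub>R id_blinfun \<longrightarrow>
      \<sigma> id_blinfun X \<preceq> H id_blinfun X + e *\<^sub>R id_blinfun \<and> H id_blinfun X \<preceq> \<sigma> id_blinfun X + e *\<^sub>R id_blinfun)"
proof -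
  interpret loewner_function f by (rule representing_function_loewner[OF x m f])
  have "continuous_on {a..b} f"
    using f a by (auto simp: representing_function_def operator_monotone_def elim!: continuous_on_subset)
  then have "uniformly_continuous_on {a..b} f" by (rule compact_uniformly_continuous) simp
  then obtain d where d: "0 < d" and fd: "\<And>r s. r \<in> {a..b} \<Longrightarrow> s \<in> {a..b} \<Longrightarrow> \<bar>s - r\<bar> < d \<Longrightarrow> \<bar>f s - f r\<bar> < e / 2"
    using e unfolding uniformly_continuous_on_def dist_real_def by (metis half_gt_zero)
  from localization_grid[OF ab d] obtain S where S: "finite S" "S \<subseteq> {a..b}" and
    loc: "\<forall>X D :: 'h \<Rightarrow>\<^sub>L 'h. selfadj X \<longrightarrow> a *\<^sub>R id_blinfun \<preceq> X \<longrightarrow> X \<preceq> b *\<^sub>R id_blinfun \<longrightarrow>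
      (\<forall>E\<in>pos_ops. \<forall>s\<in>S. \<forall>t\<in>S. s < t \<longrightarrow> t - s < d \<longrightarrow> E o\<^sub>L X = X o\<^sub>L E \<longrightarrow>
        s *\<^sub>R E \<preceq> E o\<^sub>L X \<longrightarrow> E o\<^sub>L X \<preceq> t *\<^sub>R E \<longrightarrow> E o\<^sub>L D \<in> pos_ops) \<longrightarrow> D \<in> pos_ops"
    by (elim exE conjE)
  have S_pos: "0 < s" if "s \<in> S" for s using that S a by force
  obtain h where h: "harmonic_mixture h" and hf: "\<forall>s\<in>S. \<bar>h s - f s\<bar> \<le> e / 2"
    using harmonic_mixture_approx[OF S(1) S_pos, of "e / 2"] e by auto
  have osc: "\<bar>f t - f s\<bar> < e / 2" if "s \<in> S" "t \<in> S" "s < t" "t - s < d" for s t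
    using that S by (intro fd) auto
  from harmonic_mixture_operation[OF h] obtain H :: "'h binop" where H: "mixture_operation h H" ..
  have "\<sigma> id_blinfun X \<preceq> H id_blinfun X + e *\<^sub>R id_blinfun \<and> H id_blinfun X \<preceq> \<sigma> id_blinfun X + e *\<^sub>R id_blinfun"
    if X: "a *\<^sub>R id_blinfun \<preceq> X" "X \<preceq> b *\<^sub>R id_blinfun" for X
  proof -
    have Xinv: "X \<in> pos_inv_ops" by (rule pos_inv_mono[OF pos_inv_scaleR[OF pos_inv_id a] X(1)])
    note Xp = pos_inv_pos[OF Xinv] and Xs = pos_inv_selfadj[OF Xinv]
    let ?Y = "\<sigma> id_blinfun X" and ?Z = "H id_blinfun X"
    have combine: "E o\<^sub>L (U + e *\<^sub>R id_blinfun - V) \<in> pos_ops"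
      if "E \<in> pos_ops" "r *\<^sub>R E \<preceq> E o\<^sub>L U" "E o\<^sub>L V \<preceq> s *\<^sub>R E" "s \<le> r + e" for E U V r s
    proof -
      have "((E o\<^sub>L U) - r *\<^sub>R E) + (s *\<^sub>R E - (E o\<^sub>L V)) + (r + e - s) *\<^sub>R E \<in> pos_ops"
        using that by (intro pos_ops_add pos_ops_scaleR) (auto simp: loewner_le_def)
      then show ?thesis by (simp add: op_comp_bilinear algebra_simps)
    qed
    have "?Z + e *\<^sub>R id_blinfun - ?Y \<in> pos_ops"
    proof (rule loc[rule_format, OF Xs X])
      fix E s t assume E: "E \<in> pos_ops" and st: "s \<in> S" "t \<in> S" "s < t" "t - s < d"
        and c: "E o\<^sub>L X = X o\<^sub>L E" and le: "s *\<^sub>R E \<preceq> E o\<^sub>L X" "E o\<^sub>L X \<preceq> t *\<^sub>R E"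
      \<comment> \<open>On a cell the value at its lower end bounds H from below and that at its
        upper end bounds \<sigma> from above. One half of e pays for the oscillation of f between
        the ends, the other half for the distance of h to f.\<close>
      have "\<bar>h s - f s\<bar> \<le> e / 2" using hf st by blast
      then have "f t \<le> h s + e" using osc[OF st] by linarith
      then show "E o\<^sub>L (?Z + e *\<^sub>R id_blinfun - ?Y) \<in> pos_ops"
        by (rule combine[OF E mixture_operationD(3)[OF H E Xinv c S_pos[OF st(1)] le(1)]
            representing_function_local(1)[OF m f Xp E c less_imp_le[OF S_pos[OF st(2)]] le(2)]])
    qed
    moreover have "?Y + e *\<^sub>R id_blinfun - ?Z \<in> pos_ops"
    proof (rule loc[rule_format, OF Xs X])
      fix E s t assume E: "E \<in> pos_ops" and st: "s \<in> S" "t \<in> S" "s < t" "t - s < d"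
        and c: "E o\<^sub>L X = X o\<^sub>L E" and le: "s *\<^sub>R E \<preceq> E o\<^sub>L X" "E o\<^sub>L X \<preceq> t *\<^sub>R E"
      have "\<bar>h t - f t\<bar> \<le> e / 2" using hf st by blast
      then have "h t \<le> f s + e" using osc[OF st] by linarith
      then show "E o\<^sub>L (?Y + e *\<^sub>R id_blinfun - ?Z) \<in> pos_ops"
        by (rule combine[OF E representing_function_local(2)[OF m f Xp E c less_imp_le[OF S_pos[OF st(1)]] le(1)]
            mixture_operationD(4)[OF H E Xinv c S_pos[OF st(2)] le(2)]])
    qed
    ultimately show ?thesis by (simp add: loewner_le_def)
  qed
  with H show ?thesis by (intro exI[of _ h] exI[of _ H]) simp
qed

lemma pos_inv_bounds:
  assumes "X \<in> pos_inv_ops"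
  shows "\<exists>a b. 0 < a \<and> a < b \<and> a *\<^sub>R id_blinfun \<preceq> X \<and> X \<preceq> b *\<^sub>R id_blinfun"
proof -
  obtain a where a: "0 < a" "a *\<^sub>R id_blinfun \<preceq> X" using assms by (auto simp: pos_inv_ops_iff)
  have "X \<preceq> norm X *\<^sub>R id_blinfun" by (rule loewner_norm[OF pos_inv_selfadj[OF assms]])
  also have "\<dots> \<preceq> (max a (norm X) + 1) *\<^sub>R id_blinfun" by (intro loewner_scaleR_mono pos_ops_id) simp
  finally show ?thesis using a by (intro exI[of _ a] exI[of _ "max a (norm X) + 1"]) simp
qed

text \<open>The normalized operators of the pairs (A, B), (C, D) and of the sum are placed in a
  common interval, so that the same superadditive H approximates \<sigma> on all three. Congruence
  turns the errors into e A, e C and e (A + C), together 2 e (A + C).\<close>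

lemma superadditive_operator_mean:
  fixes \<sigma> :: "'h::complex_hilbert_space binop"
  assumes x: "x \<noteq> (0::'h)" and m: "operator_mean \<sigma>" and f: "representing_function \<sigma> f"
  shows "superadditive \<sigma>"
  unfolding superadditive_def
proof (intro ballI)
  fix A B C D :: "'h \<Rightarrow>\<^sub>L 'h"
  assume A: "A \<in> pos_inv_ops" and B: "B \<in> pos_inv_ops" and C: "C \<in> pos_inv_ops" and D: "D \<in> pos_inv_ops"
  have AC: "A + C \<in> pos_inv_ops" and BD: "B + D \<in> pos_inv_ops"
    by (simp_all add: A B C D pos_inv_add pos_inv_pos)
  define W where "W S T = inv_op (sqrt_op S) o\<^sub>L T o\<^sub>L inv_op (sqrt_op S)" for S T :: "'h \<Rightarrow>\<^sub>L 'h"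
  have W: "W S T \<in> pos_inv_ops" if "S \<in> pos_inv_ops" "T \<in> pos_inv_ops" for S T
    unfolding W_def by (intro pos_inv_congr inv_op_pos_inv sqrt_op_pos_inv that)
  obtain a1 b1 where 1: "0 < a1" "a1 < b1" "a1 *\<^sub>R id_blinfun \<preceq> W A B" "W A B \<preceq> b1 *\<^sub>R id_blinfun"
    using pos_inv_bounds[OF W[OF A B]] by blast
  obtain a2 b2 where 2: "0 < a2" "a2 < b2" "a2 *\<^sub>R id_blinfun \<preceq> W C D" "W C D \<preceq> b2 *\<^sub>R id_blinfun"
    using pos_inv_bounds[OF W[OF C D]] by blast
  obtain a3 b3 where 3: "0 < a3" "a3 < b3" "a3 *\<^sub>R id_blinfun \<preceq> W (A + C) (B + D)"
    "W (A + C) (B + D) \<preceq> b3 *\<^sub>R id_blinfun"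
    using pos_inv_bounds[OF W[OF AC BD]] by blast
  define a where "a = min a1 (min a2 a3)"
  define b where "b = max b1 (max b2 b3)"
  have ab: "0 < a" "a < b" using 1 2 3 by (auto simp: a_def b_def)
  have lo: "a *\<^sub>R id_blinfun \<preceq> X" if "a' *\<^sub>R id_blinfun \<preceq> X" "a \<le> a'" for a' and X :: "'h \<Rightarrow>\<^sub>L 'h"
    by (rule loewner_trans[OF loewner_scaleR_mono[OF pos_ops_id that(2)] that(1)])
  have hi: "X \<preceq> b *\<^sub>R id_blinfun" if "X \<preceq> b' *\<^sub>R id_blinfun" "b' \<le> b" for b' and X :: "'h \<Rightarrow>\<^sub>L 'h"
    by (rule loewner_trans[OF that(1) loewner_scaleR_mono[OF pos_ops_id that(2)]])
  have lo': "a *\<^sub>R id_blinfun \<preceq> W A B" "a *\<^sub>R id_blinfun \<preceq> W C D" "a *\<^sub>R id_blinfun \<preceq> W (A + C) (B + D)"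
    by (rule lo[OF 1(3)] lo[OF 2(3)] lo[OF 3(3)]; simp add: a_def)+
  have hi': "W A B \<preceq> b *\<^sub>R id_blinfun" "W C D \<preceq> b *\<^sub>R id_blinfun" "W (A + C) (B + D) \<preceq> b *\<^sub>R id_blinfun"
    by (rule hi[OF 1(4)] hi[OF 2(4)] hi[OF 3(4)]; simp add: b_def)+
  show "\<sigma> A B + \<sigma> C D \<preceq> \<sigma> (A + C) (B + D)"
  proof (rule loewner_epsI)
    fix e :: real assume e: "0 < e"
    from operator_mean_approx[OF x m f ab e] obtain h H where H: "mixture_operation h H" and
      H3: "\<forall>X. a *\<^sub>R id_blinfun \<preceq> X \<longrightarrow> X \<preceq> b *\<^sub>R id_blinfun \<longrightarrow>
        \<sigma> id_blinfun X \<preceq> H id_blinfun X + e *\<^sub>R id_blinfun \<and> H id_blinfun X \<preceq> \<sigma> id_blinfun X + e *\<^sub>R id_blinfun"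
      by (elim exE conjE)
    note H1 = mixture_operationD(1)[OF H] and H2 = mixture_operationD(2)[OF H]
    have approx: "\<sigma> S T \<preceq> H S T + e *\<^sub>R S \<and> H S T \<preceq> \<sigma> S T + e *\<^sub>R S"
      if S: "S \<in> pos_inv_ops" and T: "T \<in> pos_inv_ops"
        and b: "a *\<^sub>R id_blinfun \<preceq> W S T" "W S T \<preceq> b *\<^sub>R id_blinfun" for S T
    proof -
      let ?R = "sqrt_op S"
      note R = pos_inv_selfadj[OF sqrt_op_pos_inv[OF S]]
      have RW: "?R o\<^sub>L (U + e *\<^sub>R id_blinfun) o\<^sub>L ?R = (?R o\<^sub>L U o\<^sub>L ?R) + e *\<^sub>R S" for U
        by (simp add: op_comp_bilinear sqrt_op_props(2)[OF pos_inv_pos[OF S]])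
      have eqs: "?R o\<^sub>L \<sigma> id_blinfun (W S T) o\<^sub>L ?R = \<sigma> S T" "?R o\<^sub>L H id_blinfun (W S T) o\<^sub>L ?R = H S T"
        unfolding W_def using operator_mean_eq_congr[OF m S pos_inv_pos[OF T]] H2[OF S T] by simp_all
      from H3[rule_format, OF b] have
        "?R o\<^sub>L \<sigma> id_blinfun (W S T) o\<^sub>L ?R \<preceq> ?R o\<^sub>L (H id_blinfun (W S T) + e *\<^sub>R id_blinfun) o\<^sub>L ?R \<and>
         ?R o\<^sub>L H id_blinfun (W S T) o\<^sub>L ?R \<preceq> ?R o\<^sub>L (\<sigma> id_blinfun (W S T) + e *\<^sub>R id_blinfun) o\<^sub>L ?R"
        by (intro conjI loewner_congr[OF _ R]) (elim conjE, assumption)+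
      then show ?thesis unfolding RW eqs .
    qed
    have "\<sigma> A B + \<sigma> C D \<preceq> (H A B + e *\<^sub>R A) + (H C D + e *\<^sub>R C)"
      using approx[OF A B lo'(1) hi'(1)] approx[OF C D lo'(2) hi'(2)] by (intro loewner_add) auto
    also have "\<dots> = (H A B + H C D) + e *\<^sub>R (A + C)" by (simp add: algebra_simps)
    also have "\<dots> \<preceq> H (A + C) (B + D) + e *\<^sub>R (A + C)"
      by (intro loewner_add superadditiveD[OF H1] A B C D loewner_refl)
    also have "\<dots> \<preceq> (\<sigma> (A + C) (B + D) + e *\<^sub>R (A + C)) + e *\<^sub>R (A + C)"
      using approx[OF AC BD lo'(3) hi'(3)] by (intro loewner_add) auto
    also have "\<dots> = \<sigma> (A + C) (B + D) + e *\<^sub>R (2 *\<^sub>R (A + C))" by (simp add: scaleR_2 algebra_simps)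
    finally show "\<sigma> A B + \<sigma> C D \<preceq> \<sigma> (A + C) (B + D) + e *\<^sub>R (2 *\<^sub>R (A + C))" .
  qed
qed

subsection \<open>A mean and its dual\<close>

text \<open>Let Y and Z be the two means of I and X. Where X lies between s and t, so does Y Z,
  because f g is the identity function; for a grid with t - s < e the difference of Y Z and X is at
  most e.\<close>

lemma dual_mean_product:
  fixes \<sigma> :: "'h::complex_hilbert_space binop"
  assumes x: "x \<noteq> (0::'h)" and dual: "dual_mean \<sigma> \<tau>" and X: "X \<in> pos_inv_ops"
  shows "\<sigma> id_blinfun X o\<^sub>L \<tau> id_blinfun X = X"
proof -
  obtain f g where f: "representing_function \<sigma> f" and g: "representing_function \<tau> g"
    and fg: "\<And>t. 0 < t \<Longrightarrow> g t = t / f t" and m: "operator_mean \<sigma>" "operator_mean \<tau>"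
    using dual by (auto simp: dual_mean_def)
  have f_pos: "0 < f t" if "0 < t" for t
    using representing_function_bounds(1)[OF x m(1) f that] that by (auto simp: min_def split: if_splits)
  have prod: "f t * g t = t" "0 < g t" if "0 < t" for t using fg[OF that] f_pos[OF that] that by simp_all
  note Xp = pos_inv_pos[OF X] and Xs = pos_inv_selfadj[OF X]
  let ?Y = "\<sigma> id_blinfun X" and ?Z = "\<tau> id_blinfun X"
  have Yp: "?Y \<in> pos_ops" and Zp: "?Z \<in> pos_ops"
    by (rule operator_mean_pos[OF m(1) pos_ops_id Xp], rule operator_mean_pos[OF m(2) pos_ops_id Xp])
  have comm: "K o\<^sub>L ?Y = ?Y o\<^sub>L K" "K o\<^sub>L ?Z = ?Z o\<^sub>L K" if "selfadj K" "K o\<^sub>L X = X o\<^sub>L K" for K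
    by (rule operator_mean_commute[OF m(1) pos_ops_id Xp that(1) _ that(2)], simp)
      (rule operator_mean_commute[OF m(2) pos_ops_id Xp that(1) _ that(2)], simp)
  have XY: "?Y o\<^sub>L X = X o\<^sub>L ?Y" using comm(1)[OF Xs] by simp
  have YZ: "?Y o\<^sub>L ?Z = ?Z o\<^sub>L ?Y" by (rule comm(2)[OF pos_ops_selfadj[OF Yp] XY])
  obtain a b where ab: "0 < a" "a < b" "a *\<^sub>R id_blinfun \<preceq> X" "X \<preceq> b *\<^sub>R id_blinfun"
    using pos_inv_bounds[OF X] by blast
  have near: "(?Y o\<^sub>L ?Z) - X + e *\<^sub>R id_blinfun \<in> pos_ops \<and> X - (?Y o\<^sub>L ?Z) + e *\<^sub>R id_blinfun \<in> pos_ops"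
    if e: "0 < e" for e
  proof -
    from localization_grid[OF ab(2) e] obtain S where S: "finite S" "S \<subseteq> {a..b}" and
      loc: "\<forall>X D :: 'h \<Rightarrow>\<^sub>L 'h. selfadj X \<longrightarrow> a *\<^sub>R id_blinfun \<preceq> X \<longrightarrow> X \<preceq> b *\<^sub>R id_blinfun \<longrightarrow>
        (\<forall>E\<in>pos_ops. \<forall>s\<in>S. \<forall>t\<in>S. s < t \<longrightarrow> t - s < e \<longrightarrow> E o\<^sub>L X = X o\<^sub>L E \<longrightarrow>
          s *\<^sub>R E \<preceq> E o\<^sub>L X \<longrightarrow> E o\<^sub>L X \<preceq> t *\<^sub>R E \<longrightarrow> E o\<^sub>L D \<in> pos_ops) \<longrightarrow> D \<in> pos_ops"
      by (elim exE conjE)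
    have S_pos: "0 < s" if "s \<in> S" for s using that S ab by force
    \<comment> \<open>The bound for E Y by f t is multiplied by the commuting positive operator Z;
      the remaining factor E Z is then bounded by g t, and f t g t = t.\<close>
    have cell: "(t *\<^sub>R E \<preceq> E o\<^sub>L X \<longrightarrow> t *\<^sub>R E \<preceq> E o\<^sub>L (?Y o\<^sub>L ?Z)) \<and> (E o\<^sub>L X \<preceq> t *\<^sub>R E \<longrightarrow> E o\<^sub>L (?Y o\<^sub>L ?Z) \<preceq> t *\<^sub>R E)"
      if E: "E \<in> pos_ops" "E o\<^sub>L X = X o\<^sub>L E" and t: "0 < t" for E t
    proof (intro conjI impI)
      have EY: "E o\<^sub>L ?Y = ?Y o\<^sub>L E" and EZ: "E o\<^sub>L ?Z = ?Z o\<^sub>L E"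
        by (rule comm[OF pos_ops_selfadj[OF E(1)] E(2)])+
      have c: "?Z o\<^sub>L (E o\<^sub>L ?Y) = (E o\<^sub>L ?Y) o\<^sub>L ?Z" by (intro comm_comp EZ[symmetric] YZ[symmetric])
      have c': "((E o\<^sub>L ?Y) - f t *\<^sub>R E) o\<^sub>L ?Z = ?Z o\<^sub>L ((E o\<^sub>L ?Y) - f t *\<^sub>R E)"
        "(f t *\<^sub>R E - (E o\<^sub>L ?Y)) o\<^sub>L ?Z = ?Z o\<^sub>L (f t *\<^sub>R E - (E o\<^sub>L ?Y))"
        by (rule sym, intro comm_diff comm_scaleR c EZ[symmetric])+
      note fl = representing_function_local[OF m(1) f Xp E less_imp_le[OF t]]
      note gl = representing_function_local[OF m(2) g Xp E less_imp_le[OF t]]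
      show "t *\<^sub>R E \<preceq> E o\<^sub>L (?Y o\<^sub>L ?Z)" if le: "t *\<^sub>R E \<preceq> E o\<^sub>L X"
      proof -
        have "((E o\<^sub>L ?Y) - f t *\<^sub>R E) o\<^sub>L ?Z \<in> pos_ops"
          using fl(2)[OF le] by (intro pos_ops_comp[OF _ Zp c'(1)]) (simp add: loewner_le_def)
        then have "f t *\<^sub>R (E o\<^sub>L ?Z) \<preceq> E o\<^sub>L (?Y o\<^sub>L ?Z)"
          by (simp add: loewner_le_def op_comp_bilinear op_comp_assoc)
        from loewner_trans[OF loewner_scaleR[OF gl(2)[OF le] less_imp_le[OF f_pos[OF t]]] this]
        show ?thesis by (simp add: prod(1)[OF t])
      qed
      show "E o\<^sub>L (?Y o\<^sub>L ?Z) \<preceq> t *\<^sub>R E" if le: "E o\<^sub>L X \<preceq> t *\<^sub>R E"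
      proof -
        have "(f t *\<^sub>R E - (E o\<^sub>L ?Y)) o\<^sub>L ?Z \<in> pos_ops"
          using fl(1)[OF le] by (intro pos_ops_comp[OF _ Zp c'(2)]) (simp add: loewner_le_def)
        then have "E o\<^sub>L (?Y o\<^sub>L ?Z) \<preceq> f t *\<^sub>R (E o\<^sub>L ?Z)"
          by (simp add: loewner_le_def op_comp_bilinear op_comp_assoc)
        from loewner_trans[OF this loewner_scaleR[OF gl(1)[OF le] less_imp_le[OF f_pos[OF t]]]]
        show ?thesis by (simp add: prod(1)[OF t])
      qed
    qed
    have combine: "E o\<^sub>L (U - V + e *\<^sub>R id_blinfun) \<in> pos_ops"
      if "E \<in> pos_ops" "s *\<^sub>R E \<preceq> E o\<^sub>L U" "E o\<^sub>L V \<preceq> t *\<^sub>R E" "t - s < e" for E U V s t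
    proof -
      have "((E o\<^sub>L U) - s *\<^sub>R E) + (t *\<^sub>R E - (E o\<^sub>L V)) + (e - (t - s)) *\<^sub>R E \<in> pos_ops"
        using that by (intro pos_ops_add pos_ops_scaleR) (auto simp: loewner_le_def)
      then show ?thesis by (simp add: op_comp_bilinear algebra_simps)
    qed
    show ?thesis
    proof
      show "(?Y o\<^sub>L ?Z) - X + e *\<^sub>R id_blinfun \<in> pos_ops"
        by (rule loc[rule_format, OF Xs ab(3,4)], rule combine) (use cell S_pos in blast)+
      show "X - (?Y o\<^sub>L ?Z) + e *\<^sub>R id_blinfun \<in> pos_ops"
        by (rule loc[rule_format, OF Xs ab(3,4)], rule combine) (use cell S_pos in blast)+
    qed
  qed
  show ?thesis
    by (rule loewner_antisym; rule loewner_epsI[where R = id_blinfun])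
      (use near in \<open>simp_all add: loewner_le_def algebra_simps\<close>)
qed

text \<open>After congruence with the root of A, the Riccati equation for
  \<open>A \<sharp> B\<close> with respect to the two means becomes V Y^-1 V = Z with V^2 = Y Z. It
  holds because V commutes with Y.\<close>

lemma dual_mean_geometric_mean:
  fixes \<sigma> :: "'h::complex_hilbert_space binop"
  assumes x: "x \<noteq> (0::'h)" and dual: "dual_mean \<sigma> \<tau>" and A: "A \<in> pos_inv_ops" and B: "B \<in> pos_inv_ops"
  shows "\<sigma> A B \<sharp> \<tau> A B = A \<sharp> B"
proof -
  have m: "operator_mean \<sigma>" "operator_mean \<tau>" using dual by (auto simp: dual_mean_def)
  let ?R = "sqrt_op A" let ?W = "inv_op ?R o\<^sub>L B o\<^sub>L inv_op ?R"
  note R = sqrt_op_pos_inv[OF A]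
  have W: "?W \<in> pos_inv_ops" by (intro pos_inv_congr inv_op_pos_inv R B)
  let ?Y = "\<sigma> id_blinfun ?W" and ?Z = "\<tau> id_blinfun ?W" and ?V = "sqrt_op ?W"
  note V = sqrt_op_props[OF pos_inv_pos[OF W]]
  have Y: "?Y \<in> pos_inv_ops" by (rule operator_mean_pos_inv[OF m(1) pos_inv_id W])
  have VY: "?V o\<^sub>L ?Y = ?Y o\<^sub>L ?V"
    by (rule operator_mean_commute[OF m(1) pos_ops_id pos_inv_pos[OF W] pos_ops_selfadj[OF V(1)]])
      (simp_all add: V(3)[OF refl])
  have \<sigma>: "\<sigma> A B = ?R o\<^sub>L ?Y o\<^sub>L ?R" and \<tau>: "\<tau> A B = ?R o\<^sub>L ?Z o\<^sub>L ?R"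
    by (rule operator_mean_eq_congr[OF m(1) A pos_inv_pos[OF B]],
        rule operator_mean_eq_congr[OF m(2) A pos_inv_pos[OF B]])
  show ?thesis
  proof (rule geometric_mean_eqI)
    show "\<sigma> A B \<in> pos_inv_ops" by (rule operator_mean_pos_inv[OF m(1) A B])
    show "A \<sharp> B \<in> pos_ops" by (rule pos_inv_pos[OF geometric_mean_props(1)[OF A B]])
    have "(A \<sharp> B) o\<^sub>L inv_op (\<sigma> A B) o\<^sub>L (A \<sharp> B) = ?R o\<^sub>L (?V o\<^sub>L inv_op ?Y o\<^sub>L ?V) o\<^sub>L ?R"
      unfolding \<sigma> pos_inv_congr(2)[OF R Y] geometric_mean_def
      by (simp add: op_comp_assoc op_left_cancel[OF inv_op_props(2)[OF R]] op_left_cancel[OF inv_op_props(3)[OF R]])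
    also have "?V o\<^sub>L inv_op ?Y o\<^sub>L ?V = inv_op ?Y o\<^sub>L (?V o\<^sub>L ?V)"
      unfolding inv_op_commute[OF Y VY] by (rule op_comp_assoc)
    also have "?V o\<^sub>L ?V = ?Y o\<^sub>L ?Z" by (simp only: V(2) dual_mean_product[OF x dual W])
    also have "inv_op ?Y o\<^sub>L (?Y o\<^sub>L ?Z) = ?Z" by (simp add: op_left_cancel[OF inv_op_props(3)[OF Y]])
    finally show "(A \<sharp> B) o\<^sub>L inv_op (\<sigma> A B) o\<^sub>L (A \<sharp> B) = \<tau> A B" by (simp only: \<tau>)
  qed
qed

lemma trivial_loewner_le:
  assumes "\<And>x :: 'h::complex_hilbert_space. x = 0"
  shows "S \<preceq> (T :: 'h \<Rightarrow>\<^sub>L 'h)"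
proof -
  have "S = T" by (rule blinfun_eqI) (metis assms)
  then show ?thesis by simp
qed

lemma dual_mean_sum_le:
  fixes \<sigma> :: "'h::complex_hilbert_space binop"
  assumes dual: "dual_mean \<sigma> \<tau>" and J: "finite J" "J \<noteq> {}"
    and A: "\<And>j. j \<in> J \<Longrightarrow> A j \<in> pos_inv_ops" and B: "\<And>j. j \<in> J \<Longrightarrow> B j \<in> pos_inv_ops"
  shows "(\<Sum>j\<in>J. A j \<sharp> B j) \<preceq> (\<Sum>j\<in>J. \<sigma> (A j) (B j)) \<sharp> (\<Sum>j\<in>J. \<tau> (A j) (B j))"
    and "(\<Sum>j\<in>J. \<sigma> (A j) (B j)) \<sharp> (\<Sum>j\<in>J. \<tau> (A j) (B j)) \<preceq> sum A J \<sharp> sum B J"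
proof -
  have *: "(\<Sum>j\<in>J. A j \<sharp> B j) \<preceq> (\<Sum>j\<in>J. \<sigma> (A j) (B j)) \<sharp> (\<Sum>j\<in>J. \<tau> (A j) (B j)) \<and>
    (\<Sum>j\<in>J. \<sigma> (A j) (B j)) \<sharp> (\<Sum>j\<in>J. \<tau> (A j) (B j)) \<preceq> sum A J \<sharp> sum B J" if x: "x \<noteq> (0::'h)" for x
  proof
    obtain f g where f: "representing_function \<sigma> f" and g: "representing_function \<tau> g"
      and m: "operator_mean \<sigma>" "operator_mean \<tau>" using dual by (auto simp: dual_mean_def)
    have p: "\<sigma> (A j) (B j) \<in> pos_inv_ops" "\<tau> (A j) (B j) \<in> pos_inv_ops" if "j \<in> J" for j
      by (rule operator_mean_pos_inv[OF m(1) A[OF that] B[OF that]],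
          rule operator_mean_pos_inv[OF m(2) A[OF that] B[OF that]])
    have "(\<Sum>j\<in>J. A j \<sharp> B j) = (\<Sum>j\<in>J. \<sigma> (A j) (B j) \<sharp> \<tau> (A j) (B j))"
      by (rule sum.cong[OF refl]) (simp add: dual_mean_geometric_mean[OF x dual] A B)
    also have "\<dots> \<preceq> (\<Sum>j\<in>J. \<sigma> (A j) (B j)) \<sharp> (\<Sum>j\<in>J. \<tau> (A j) (B j))"
      by (rule superadditive_sum[OF superadditive_geometric_mean J p])
    finally show "(\<Sum>j\<in>J. A j \<sharp> B j) \<preceq> (\<Sum>j\<in>J. \<sigma> (A j) (B j)) \<sharp> (\<Sum>j\<in>J. \<tau> (A j) (B j))" .
    have "(\<Sum>j\<in>J. \<sigma> (A j) (B j)) \<sharp> (\<Sum>j\<in>J. \<tau> (A j) (B j)) \<preceq> \<sigma> (sum A J) (sum B J) \<sharp> \<tau> (sum A J) (sum B J)"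
      by (rule geometric_mean_mono[OF pos_inv_sum[OF J p(1)] pos_inv_sum[OF J p(2)]
          superadditive_sum[OF superadditive_operator_mean[OF x m(1) f] J A B]
          superadditive_sum[OF superadditive_operator_mean[OF x m(2) g] J A B]])
    also have "\<dots> = sum A J \<sharp> sum B J"
      by (rule dual_mean_geometric_mean[OF x dual pos_inv_sum[OF J A] pos_inv_sum[OF J B]])
    finally show "(\<Sum>j\<in>J. \<sigma> (A j) (B j)) \<sharp> (\<Sum>j\<in>J. \<tau> (A j) (B j)) \<preceq> sum A J \<sharp> sum B J" .
  qed
  show "(\<Sum>j\<in>J. A j \<sharp> B j) \<preceq> (\<Sum>j\<in>J. \<sigma> (A j) (B j)) \<sharp> (\<Sum>j\<in>J. \<tau> (A j) (B j))"
    by (cases "\<exists>x::'h. x \<noteq> 0") (use * trivial_loewner_le in \<open>auto simp only: not_ex not_not\<close>)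
  show "(\<Sum>j\<in>J. \<sigma> (A j) (B j)) \<sharp> (\<Sum>j\<in>J. \<tau> (A j) (B j)) \<preceq> sum A J \<sharp> sum B J"
    by (cases "\<exists>x::'h. x \<noteq> 0") (use * trivial_loewner_le in \<open>auto simp only: not_ex not_not\<close>)
qed

subsection \<open>Interpolational paths\<close>

text \<open>A missing point r lies in a gap of Z whose ends belong to Z since Z is closed; the
  midpoint of the gap would lie in Z and strictly inside the gap.\<close>

lemma closed_midpoint_unit_interval:
  fixes Z :: "real set"
  assumes "closed Z" "0 \<in> Z" "1 \<in> Z" and mid: "\<And>x y. x \<in> Z \<Longrightarrow> y \<in> Z \<Longrightarrow> (x + y) / 2 \<in> Z"
  shows "{0..1} \<subseteq> Z"
proof (rule subsetI, rule ccontr)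
  fix r assume r: "r \<in> {0..1}" "r \<notin> Z"
  let ?L = "Z \<inter> {..r}" and ?U = "Z \<inter> {r..}"
  have L: "Sup ?L \<in> ?L" by (rule closed_contains_Sup) (use assms r in \<open>auto intro: closed_Int\<close>)
  have U: "Inf ?U \<in> ?U" by (rule closed_contains_Inf) (use assms r in \<open>auto intro: closed_Int\<close>)
  define c where "c = (Sup ?L + Inf ?U) / 2"
  have "Sup ?L \<noteq> r" "Inf ?U \<noteq> r" using L U r(2) by auto
  then have lt: "Sup ?L < r" "r < Inf ?U" using L U by auto
  have "c \<in> Z" unfolding c_def using L U by (intro mid) auto
  then consider "c \<in> ?L" | "c \<in> ?U" by fastforce
  then show False
  proof cases
    case 1
    then have "c \<le> Sup ?L" by (intro cSup_upper) auto
    then show False using lt by (simp add: c_def)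
  next
    case 2
    then have "Inf ?U \<le> c" by (intro cInf_lower) auto
    then show False using lt by (simp add: c_def)
  qed
qed

text \<open>As functions of r both sides agree at 0 and 1. The set of agreement is closed by norm
  continuity and closed under midpoints by the interpolation property, used once for the pair (C, D)
  and once for (A, B).\<close>

lemma interpolational_path_compose:
  assumes path: "interpolational_path \<sigma> \<sigma>t" and A: "A \<in> pos_inv_ops" and B: "B \<in> pos_inv_ops"
    and p: "p \<in> {0..1}" and q: "q \<in> {0..1}" and r: "r \<in> {0..1}"
  shows "\<sigma>t r (\<sigma>t p A B) (\<sigma>t q A B) = \<sigma>t ((1 - r) * p + r * q) A B"
proof -
  have om: "operator_mean (\<sigma>t t)" if "t \<in> {0..1}" for t
    using path that by (simp add: interpolational_path_def)
  have ends: "\<sigma>t 0 A B = A" "\<sigma>t 1 A B = B"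
    and mid: "\<And>p q. p \<in> {0..1} \<Longrightarrow> q \<in> {0..1} \<Longrightarrow> \<sigma> (\<sigma>t p A B) (\<sigma>t q A B) = \<sigma>t ((p + q) / 2) A B"
    and cont: "continuous_on {0..1} (\<lambda>t. \<sigma>t t A B)"
    if "A \<in> pos_inv_ops" "B \<in> pos_inv_ops" for A B
    using path that by (simp_all add: interpolational_path_def)
  define C where "C = \<sigma>t p A B"
  define D where "D = \<sigma>t q A B"
  have C: "C \<in> pos_inv_ops" and D: "D \<in> pos_inv_ops"
    unfolding C_def D_def by (rule operator_mean_pos_inv[OF om[OF p] A B], rule operator_mean_pos_inv[OF om[OF q] A B])
  define \<theta> where "\<theta> r = (1 - r) * p + r * q" for r
  have \<theta>: "\<theta> r \<in> {0..1}" if "r \<in> {0..1}" for r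
    using convexD_alt[OF convex_real_interval(5)[of 0 1] p q, of r] that by (simp add: \<theta>_def)
  define Z where "Z = {r \<in> {0..1}. \<sigma>t r C D = \<sigma>t (\<theta> r) A B}"
  have "{0..1} \<subseteq> Z"
  proof (rule closed_midpoint_unit_interval)
    have "continuous_on {0..1} (\<lambda>r. \<sigma>t (\<theta> r) A B)"
      by (rule continuous_on_compose2[OF cont[OF A B]])
        (use \<theta> in \<open>auto simp: \<theta>_def intro!: continuous_intros\<close>)
    then have "closed {r \<in> {0..1}. \<sigma>t r C D - \<sigma>t (\<theta> r) A B = 0}"
      by (intro continuous_closed_preimage_constant continuous_on_diff cont C D) auto
    then show "closed Z" by (simp only: Z_def right_minus_eq)
    show "0 \<in> Z" "1 \<in> Z" using ends[OF C D] by (simp_all add: Z_def \<theta>_def C_def D_def)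
    show "(x + y) / 2 \<in> Z" if "x \<in> Z" "y \<in> Z" for x y
    proof -
      have xy: "x \<in> {0..1}" "y \<in> {0..1}" "\<sigma>t x C D = \<sigma>t (\<theta> x) A B" "\<sigma>t y C D = \<sigma>t (\<theta> y) A B"
        using that by (auto simp: Z_def)
      have "\<sigma>t ((x + y) / 2) C D = \<sigma>t ((\<theta> x + \<theta> y) / 2) A B"
        using mid[OF C D xy(1,2)] mid[OF A B \<theta>[OF xy(1)] \<theta>[OF xy(2)]] by (simp add: xy(3,4))
      also have "(\<theta> x + \<theta> y) / 2 = \<theta> ((x + y) / 2)" by (simp add: \<theta>_def field_simps)
      finally show ?thesis using xy(1,2) by (simp add: Z_def)
    qed
  qed
  then show ?thesis using r by (auto simp: Z_def \<theta>_def C_def D_def)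
qed

text \<open>The second inequality is applied to the mean \<open>\<sigma>t r\<close> with dual
  \<open>\<sigma>t (1 - r)\<close> and to the operators \<open>\<sigma>t t (A j) (B j)\<close> and
  \<open>\<sigma>t (1 - t) (A j) (B j)\<close>; replacing r by 1 - r replaces s by 1 - s.\<close>

lemma interpolational_path_sum_le:
  assumes path: "interpolational_path \<sigma> \<sigma>t" and dual: "\<And>t. t \<in> {0..1} \<Longrightarrow> dual_mean (\<sigma>t t) (\<sigma>t (1 - t))"
    and J: "finite J" "J \<noteq> {}"
    and A: "\<And>j. j \<in> J \<Longrightarrow> A j \<in> pos_inv_ops" and B: "\<And>j. j \<in> J \<Longrightarrow> B j \<in> pos_inv_ops"
    and t: "t \<in> {0..1}" and s: "s \<in> {min t (1 - t)..max t (1 - t)}"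
  shows "(\<Sum>j\<in>J. \<sigma>t s (A j) (B j)) \<sharp> (\<Sum>j\<in>J. \<sigma>t (1 - s) (A j) (B j))
    \<preceq> (\<Sum>j\<in>J. \<sigma>t t (A j) (B j)) \<sharp> (\<Sum>j\<in>J. \<sigma>t (1 - t) (A j) (B j))"
proof -
  have t': "1 - t \<in> {0..1}" using t by simp
  obtain r where r: "r \<in> {0..1}" "s = (1 - r) * t + r * (1 - t)"
  \<comment> \<open>At t = 1/2 the range of s shrinks to that point and any r serves; otherwise r is
    determined by s.\<close>
  proof (cases "t = 1 / 2")
    case True
    then show ?thesis using that[of 0] s by simp
  next
    case False
    define r where "r = (s - t) / (1 - 2 * t)"
    have "r * (1 - 2 * t) = s - t" using False by (simp add: r_def)
    then have "s = (1 - r) * t + r * (1 - t)" by (simp add: algebra_simps)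
    moreover have "r \<in> {0..1}"
      using s False by (cases "t < 1 / 2") (auto simp: r_def min_def max_def divide_simps split: if_splits)
    ultimately show ?thesis using that by blast
  qed
  have r': "1 - r \<in> {0..1}" using r(1) by simp
  have 1: "(1 - (1 - r)) * t + (1 - r) * (1 - t) = 1 - s" using r(2) by (simp add: algebra_simps)
  have om: "operator_mean (\<sigma>t t)" "operator_mean (\<sigma>t (1 - t))"
    using dual[OF t] by (auto simp: dual_mean_def)
  have "(\<Sum>j\<in>J. \<sigma>t r (\<sigma>t t (A j) (B j)) (\<sigma>t (1 - t) (A j) (B j)))
      \<sharp> (\<Sum>j\<in>J. \<sigma>t (1 - r) (\<sigma>t t (A j) (B j)) (\<sigma>t (1 - t) (A j) (B j)))
    \<preceq> (\<Sum>j\<in>J. \<sigma>t t (A j) (B j)) \<sharp> (\<Sum>j\<in>J. \<sigma>t (1 - t) (A j) (B j))"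
    by (rule dual_mean_sum_le(2)[OF dual[OF r(1)] J operator_mean_pos_inv[OF om(1) A B] operator_mean_pos_inv[OF om(2) A B]])
  moreover have "(\<Sum>j\<in>J. \<sigma>t r (\<sigma>t t (A j) (B j)) (\<sigma>t (1 - t) (A j) (B j))) = (\<Sum>j\<in>J. \<sigma>t s (A j) (B j))"
    by (rule sum.cong[OF refl]) (simp add: interpolational_path_compose[OF path A B t t' r(1)] r(2))
  moreover have "(\<Sum>j\<in>J. \<sigma>t (1 - r) (\<sigma>t t (A j) (B j)) (\<sigma>t (1 - t) (A j) (B j))) = (\<Sum>j\<in>J. \<sigma>t (1 - s) (A j) (B j))"
    by (rule sum.cong[OF refl]) (simp only: interpolational_path_compose[OF path A B t t' r'] 1)
  ultimately show ?thesis by simp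
qed

theorem theorem2p1:
  fixes A B :: "nat \<Rightarrow> ('h::complex_hilbert_space \<Rightarrow>\<^sub>L 'h)"
    and \<sigma> \<sigma>d :: "'h binop"
    and m :: nat
  assumes "m \<ge> 1"
    and "\<forall>j\<in>{1..m}. A j \<in> pos_inv_ops"
    and "\<forall>j\<in>{1..m}. B j \<in> pos_inv_ops"
    and "operator_mean \<sigma>"
    and "dual_mean \<sigma> \<sigma>d"
  shows "(\<Sum>j=1..m. A j \<sharp> B j) \<preceq> (\<Sum>j=1..m. \<sigma> (A j) (B j)) \<sharp> (\<Sum>j=1..m. \<sigma>d (A j) (B j))
    \<and> (\<Sum>j=1..m. \<sigma> (A j) (B j)) \<sharp> (\<Sum>j=1..m. \<sigma>d (A j) (B j)) \<preceq> (\<Sum>j=1..m. A j) \<sharp> (\<Sum>j=1..m. B j)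
    \<and> (\<forall>\<sigma>t :: real \<Rightarrow> 'h binop.
         interpolational_path \<sigma> \<sigma>t \<and> (\<forall>t\<in>{0..1}. dual_mean (\<sigma>t t) (\<sigma>t (1 - t))) \<longrightarrow>
         (\<forall>t\<in>{0..1}. \<forall>s\<in>{min t (1 - t)..max t (1 - t)}.
            (\<Sum>j=1..m. \<sigma>t s (A j) (B j)) \<sharp> (\<Sum>j=1..m. \<sigma>t (1 - s) (A j) (B j))
            \<preceq> (\<Sum>j=1..m. \<sigma>t t (A j) (B j)) \<sharp> (\<Sum>j=1..m. \<sigma>t (1 - t) (A j) (B j))))"
proof (intro conjI allI impI ballI)
  have J: "finite {1..m}" "{1..m} \<noteq> {}" using assms(1) by auto
  note A = assms(2)[rule_format] and B = assms(3)[rule_format]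
  show "(\<Sum>j=1..m. A j \<sharp> B j) \<preceq> (\<Sum>j=1..m. \<sigma> (A j) (B j)) \<sharp> (\<Sum>j=1..m. \<sigma>d (A j) (B j))"
    by (rule dual_mean_sum_le(1)[OF assms(5) J A B])
  show "(\<Sum>j=1..m. \<sigma> (A j) (B j)) \<sharp> (\<Sum>j=1..m. \<sigma>d (A j) (B j)) \<preceq> (\<Sum>j=1..m. A j) \<sharp> (\<Sum>j=1..m. B j)"
    by (rule dual_mean_sum_le(2)[OF assms(5) J A B])
  fix \<sigma>t :: "real \<Rightarrow> 'h binop" and t s :: real
  assume path: "interpolational_path \<sigma> \<sigma>t \<and> (\<forall>t\<in>{0..1}. dual_mean (\<sigma>t t) (\<sigma>t (1 - t)))"
    and t: "t \<in> {0..1}" and s: "s \<in> {min t (1 - t)..max t (1 - t)}"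
  show "(\<Sum>j=1..m. \<sigma>t s (A j) (B j)) \<sharp> (\<Sum>j=1..m. \<sigma>t (1 - s) (A j) (B j))
      \<preceq> (\<Sum>j=1..m. \<sigma>t t (A j) (B j)) \<sharp> (\<Sum>j=1..m. \<sigma>t (1 - t) (A j) (B j))"
    by (rule interpolational_path_sum_le[OF conjunct1[OF path] conjunct2[OF path, rule_format] J A B t s])
qed

end
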